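(* Let $\sigma>0$, let $\Psi:\Theta\to\mathbb{R}$ be a $\mathcal{C}^2$ functional, let $\pi$ be $\mathcal{C}^1$, let $\hat\Psi_0$ be an estimator, and let $\chi_n:\Theta\to[0,1]$ be a sequence of compactly supported $\mathcal{C}^1$ functions such that $A_0:=1-\Pi_n[\chi_n]=o_p(1)$ and $A_1:=\Pi_n[|\langle\nabla\chi_n|\nabla\Psi\rangle|]=o_p(\sqrt n)$. Assume that 1. $A_2:=\sup_{\mathrm{supp}(\chi_n)}|\hat\Psi-\hat\Psi_0+n^{-1}\Delta_\pi\Psi|=o_p(n^{-1/2})$, where $\hat\Psi=\Psi+n^{-1}\langle\nabla\Psi|\nabla\ell_n\rangle$, 2. $A_3:=\sup_{\mathrm{supp}(\chi_n)}|\sigma^2-|\nabla\Psi|^2|=o_p(1)$. Then with $Z_n=\sqrt n(\Psi-\hat\Psi_0)$, $$d_{BL}\left(\Pi_n\circ Z_n^{-1},\mathcal{N}(0,\sigma^2)\right)\le4\left(A_0+\sigma^{-1}\frac{A_1}{\sqrt n(1-A_0)}+\sigma^{-1}\sqrt nA_2+\sigma^{-2}A_3\right)=o_p(1)$$ (the upper bound being read as $+\infty$ on the event $A_0=1$).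
   Context: Setting. $\{P_\theta:\theta\in\Theta\}$ is a statistical model on a measurable space, dominated by a measure $\lambda$, where $\Theta$ is a manifold without boundary of finite dimension $p$. Write $\ell(\theta,x)=\ln\frac{dP_\theta}{d\lambda}(x)$, assumed $\mathcal{C}^1$ in $\theta$. $\Theta$ carries the Fisher information metric, given in local coordinates by $g_{\mu\nu}(\theta)=\int(\partial_\mu\ell)(\partial_\nu\ell)\,dP_\theta$, assumed to be a well-defined (smooth) Riemannian metric; $\langle\cdot|\cdot\rangle$, $|\cdot|$, $\nabla$, $\mathrm{Div}$, $\Delta=\mathrm{Div}\nabla$, $\mathrm{vol}_\Theta$ are the associated inner product, norm, gradient, divergence, Laplacian and Riemannian volume. The model, $\Theta$, $p$, the prior, $\Psi$ and $\hat\Psi_0$ may all depend on $n$; $\sigma$ does not. Prior and posterior. $\Pi$ is a (possibly improper) measure on $\Theta$ with an everywhere positive density $\pi$ with respect to $\mathrm{vol}_\Theta$. The data are $X^n=(X_1,\dots,X_n)$ i.i.d. from some probability distribution $\mathbb{P}_0$ (not necessarily in the model), and all $o_p$ are with respect to $X^n\sim\mathbb{P}_0^n$ as $n\to\infty$. $\ell_n(\theta)=\sum_{i=1}^n\ell(\theta,X_i)$; it is assumed that $e^{\ell_n}\in L^1(\Pi)$, and the posterior is $\Pi_n(d\theta)=e^{\ell_n(\theta)}\Pi(d\theta)/\int e^{\ell_n}d\Pi$. For a measure $\mu$ and a function $f$, $\mu[f]=\int f\,d\mu$. An estimator is a real-valued $X^n$-measurable random variable. The weighted Laplacian is $\Delta_\pi\Psi=\Delta\Psi+\langle\nabla\ln\pi|\nabla\Psi\rangle$.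 $\Pi_n\circ Z_n^{-1}$ is the law of $Z_n(\theta)$ when $\theta\sim\Pi_n$ (with $X^n$ fixed). Bounded Lipschitz distance: for probability measures $\mu,\nu$ on $\mathbb{R}$, $d_{BL}(\mu,\nu)=\sup\{|\int h\,d(\mu-\nu)|:\ h:\mathbb{R}\to[-1,1],\ |h(x)-h(y)|\le|x-y|\ \forall x,y\}$. *)

theory Defs
  imports
    "HOL-Probability.Probability"
    "Jordan_Normal_Form.Gauss_Jordan_Elimination"
    "Jordan_Normal_Form.Determinant"
begin

section \<open>Calculus in coordinates\<close>

text \<open>
  The dimension of the manifold must be able to vary along a sequence, so it cannot be a type.
  The coordinate space of dimension \<open>p\<close> is the set of extensional functions
  \<open>{..<p} \<rightarrow>\<^sub>E UNIV\<close>; this is both the carrier of the product topology below and the space of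
  \<open>PiM {..<p} (\<lambda>_. lborel)\<close>, which serves as \<open>p\<close>-dimensional Lebesgue measure.
\<close>

definition coord_space :: "nat \<Rightarrow> (nat \<Rightarrow> real) topology" where
  "coord_space p = product_topology (\<lambda>_. euclideanreal) {..<p}"

definition coord_lebesgue :: "nat \<Rightarrow> (nat \<Rightarrow> real) measure" where
  "coord_lebesgue p = PiM {..<p} (\<lambda>_. lborel)"

definition partial :: "nat \<Rightarrow> ((nat \<Rightarrow> real) \<Rightarrow> real) \<Rightarrow> (nat \<Rightarrow> real) \<Rightarrow> real" where
  "partial i f y = deriv (\<lambda>t. f (y(i := t))) (y i)"

text \<open>\<open>Ck_on p k S f\<close>: \<open>f\<close> is of class \<open>C\<^sup>k\<close> on \<open>S\<close>. Only used for \<open>S\<close> open in \<open>coord_space p\<close>.\<close>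

primrec Ck_on :: "nat \<Rightarrow> nat \<Rightarrow> (nat \<Rightarrow> real) set \<Rightarrow> ((nat \<Rightarrow> real) \<Rightarrow> real) \<Rightarrow> bool" where
  "Ck_on p 0 S f \<longleftrightarrow> continuous_map (subtopology (coord_space p) S) euclideanreal f"
| "Ck_on p (Suc k) S f \<longleftrightarrow>
     continuous_map (subtopology (coord_space p) S) euclideanreal f \<and>
     (\<forall>i<p. (\<forall>y\<in>S. (\<lambda>t. f (y(i := t))) differentiable (at (y i))) \<and> Ck_on p k S (partial i f))"

section \<open>Smooth manifolds\<close>

text \<open>A chart is a pair of its domain and its coordinate map.\<close>

type_synonym 'a chart = "'a set \<times> ('a \<Rightarrow> nat \<Rightarrow> real)"

record 'a manifold =
  mtop :: "'a topology"
  mdim :: nat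
  matlas :: "'a chart set"

abbreviation points :: "('a, 'm) manifold_scheme \<Rightarrow> 'a set" where
  "points M \<equiv> topspace (mtop M)"

definition chart_inv :: "'a chart \<Rightarrow> (nat \<Rightarrow> real) \<Rightarrow> 'a" where
  "chart_inv c = inv_into (fst c) (snd c)"

definition is_chart :: "('a, 'm) manifold_scheme \<Rightarrow> 'a chart \<Rightarrow> bool" where
  "is_chart M c \<longleftrightarrow>
     openin (mtop M) (fst c) \<and>
     openin (coord_space (mdim M)) (snd c ` fst c) \<and>
     homeomorphic_map (subtopology (mtop M) (fst c))
       (subtopology (coord_space (mdim M)) (snd c ` fst c)) (snd c)"

definition smooth_manifold :: "('a, 'm) manifold_scheme \<Rightarrow> bool" where
  "smooth_manifold M \<longleftrightarrow>
     points M \<noteq> {} \<and> Hausdorff_space (mtop M) \<and> second_countable (mtop M) \<and>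
     (\<forall>c\<in>matlas M. is_chart M c) \<and>
     (\<Union>c\<in>matlas M. fst c) = points M \<and>
     (\<forall>c\<in>matlas M. \<forall>d\<in>matlas M. \<forall>i<mdim M. \<forall>k.
        Ck_on (mdim M) k (snd c ` (fst c \<inter> fst d)) (\<lambda>y. snd d (chart_inv c y) i))"

definition Ck_manifold :: "('a, 'm) manifold_scheme \<Rightarrow> nat \<Rightarrow> ('a \<Rightarrow> real) \<Rightarrow> bool" where
  "Ck_manifold M k f \<longleftrightarrow>
     (\<forall>c\<in>matlas M. Ck_on (mdim M) k (snd c ` fst c) (\<lambda>y. f (chart_inv c y)))"

definition supp :: "('a, 'm) manifold_scheme \<Rightarrow> ('a \<Rightarrow> real) \<Rightarrow> 'a set" where
  "supp M f = mtop M closure_of {\<theta> \<in> points M. f \<theta> \<noteq> 0}"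

text \<open>The coordinate derivative \<open>\<partial>\<^sub>if\<close> at a point \<open>\<theta>\<close> with respect to the chart \<open>c\<close>.\<close>

definition coord_deriv :: "'a chart \<Rightarrow> nat \<Rightarrow> ('a \<Rightarrow> real) \<Rightarrow> 'a \<Rightarrow> real" where
  "coord_deriv c i f \<theta> = partial i (\<lambda>y. f (chart_inv c y)) (snd c \<theta>)"

section \<open>Riemannian geometry\<close>

text \<open>
  A metric is given by its coefficient matrix in every chart, a vector field \<open>V\<close> by its components
  \<open>V c \<theta> i\<close> in every chart. The inner product and the divergence are chart independent for fields
  that transform correctly; their coordinate formulas are evaluated in some chart around the point.
\<close>

record 'a riemannian = "'a manifold" +
  metric :: "'a chart \<Rightarrow> 'a \<Rightarrow> real mat"
  rvolume :: "'a measure"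

type_synonym 'a vfield = "'a chart \<Rightarrow> 'a \<Rightarrow> nat \<Rightarrow> real"

definition riemannian_metric :: "('a, 'm) riemannian_scheme \<Rightarrow> bool" where
  "riemannian_metric M \<longleftrightarrow>
     (\<forall>c\<in>matlas M. \<forall>\<theta>\<in>fst c.
        metric M c \<theta> \<in> carrier_mat (mdim M) (mdim M) \<and>
        (\<forall>i<mdim M. \<forall>j<mdim M. metric M c \<theta> $$ (i, j) = metric M c \<theta> $$ (j, i)) \<and>
        (\<forall>v. (\<exists>i<mdim M. v i \<noteq> 0) \<longrightarrow>
           (\<Sum>i<mdim M. \<Sum>j<mdim M. metric M c \<theta> $$ (i, j) * v i * v j) > 0)) \<and>
     (\<forall>c\<in>matlas M. \<forall>i<mdim M. \<forall>j<mdim M. \<forall>k.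
        Ck_on (mdim M) k (snd c ` fst c) (\<lambda>y. metric M c (chart_inv c y) $$ (i, j))) \<and>
     (\<forall>c\<in>matlas M. \<forall>d\<in>matlas M. \<forall>\<theta>\<in>fst c \<inter> fst d. \<forall>i<mdim M. \<forall>j<mdim M.
        metric M c \<theta> $$ (i, j) =
          (\<Sum>a<mdim M. \<Sum>b<mdim M.
             coord_deriv c i (\<lambda>\<eta>. snd d \<eta> a) \<theta> * coord_deriv c j (\<lambda>\<eta>. snd d \<eta> b) \<theta> *
             metric M d \<theta> $$ (a, b)))"

definition vol_density :: "('a, 'm) riemannian_scheme \<Rightarrow> 'a chart \<Rightarrow> 'a \<Rightarrow> real" where
  "vol_density M c \<theta> = sqrt (Determinant.det (metric M c \<theta>))"

text \<open>
  The Riemannian volume is the Borel measure with density \<open>\<surd>(det g)\<close> in every chart. As countably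
  many chart domains cover the manifold, it is uniquely determined by this property.
\<close>

definition riemannian_volume :: "('a, 'm) riemannian_scheme \<Rightarrow> bool" where
  "riemannian_volume M \<longleftrightarrow>
     sets (rvolume M) = sigma_sets (points M) {U. openin (mtop M) U} \<and>
     (\<forall>c\<in>matlas M. \<forall>A\<in>sets (rvolume M). A \<subseteq> fst c \<longrightarrow>
        emeasure (rvolume M) A =
          (\<integral>\<^sup>+ y. ennreal (vol_density M c (chart_inv c y)) * indicator (snd c ` A) y
             \<partial>coord_lebesgue (mdim M)))"

definition chart_at :: "('a, 'm) manifold_scheme \<Rightarrow> 'a \<Rightarrow> 'a chart" where
  "chart_at M \<theta> = (SOME c. c \<in> matlas M \<and> \<theta> \<in> fst c)"

definition rinner :: "('a, 'm) riemannian_scheme \<Rightarrow> 'a vfield \<Rightarrow> 'a vfield \<Rightarrow> 'a \<Rightarrow> real" where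
  "rinner M V W \<theta> = (let c = chart_at M \<theta> in
     \<Sum>i<mdim M. \<Sum>j<mdim M. metric M c \<theta> $$ (i, j) * V c \<theta> i * W c \<theta> j)"

definition rnorm :: "('a, 'm) riemannian_scheme \<Rightarrow> 'a vfield \<Rightarrow> 'a \<Rightarrow> real" where
  "rnorm M V \<theta> = sqrt (rinner M V V \<theta>)"

definition gradient :: "('a, 'm) riemannian_scheme \<Rightarrow> ('a \<Rightarrow> real) \<Rightarrow> 'a vfield" where
  "gradient M f = (\<lambda>c \<theta> i.
     \<Sum>j<mdim M. the (mat_inverse (metric M c \<theta>)) $$ (i, j) * coord_deriv c j f \<theta>)"

definition divergence :: "('a, 'm) riemannian_scheme \<Rightarrow> 'a vfield \<Rightarrow> 'a \<Rightarrow> real" where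
  "divergence M V \<theta> = (let c = chart_at M \<theta> in
     (\<Sum>i<mdim M. coord_deriv c i (\<lambda>\<eta>. vol_density M c \<eta> * V c \<eta> i) \<theta>) / vol_density M c \<theta>)"

definition laplacian :: "('a, 'm) riemannian_scheme \<Rightarrow> ('a \<Rightarrow> real) \<Rightarrow> 'a \<Rightarrow> real" where
  "laplacian M f = divergence M (gradient M f)"

definition weighted_laplacian ::
  "('a, 'm) riemannian_scheme \<Rightarrow> ('a \<Rightarrow> real) \<Rightarrow> ('a \<Rightarrow> real) \<Rightarrow> 'a \<Rightarrow> real" where
  "weighted_laplacian M w f \<theta> =
     laplacian M f \<theta> + rinner M (gradient M (\<lambda>\<eta>. ln (w \<eta>))) (gradient M f) \<theta>"

section \<open>The statistical model\<close>

record ('a, 'x) bayes_model = "'a riemannian" +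
  dominating :: "'x measure"
  law :: "'a \<Rightarrow> 'x measure"
  loglik :: "'a \<Rightarrow> 'x \<Rightarrow> real"
  prior_density :: "'a \<Rightarrow> real"

text \<open>
  \<open>loglik\<close> is a version of the logarithm of the density of \<open>P\<^sub>\<theta>\<close> that is \<open>C\<^sup>1\<close> in the parameter.
\<close>

definition dominated_model :: "('a, 'x, 'm) bayes_model_scheme \<Rightarrow> bool" where
  "dominated_model M \<longleftrightarrow>
     (\<forall>\<theta>\<in>points M.
        prob_space (law M \<theta>) \<and>
        loglik M \<theta> \<in> borel_measurable (dominating M) \<and>
        law M \<theta> = density (dominating M) (\<lambda>x. ennreal (exp (loglik M \<theta> x)))) \<and>
     (\<forall>x\<in>space (dominating M). Ck_manifold M 1 (\<lambda>\<theta>. loglik M \<theta> x))"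

definition fisher_metric :: "('a, 'x, 'm) bayes_model_scheme \<Rightarrow> bool" where
  "fisher_metric M \<longleftrightarrow>
     (\<forall>c\<in>matlas M. \<forall>\<theta>\<in>fst c.
        (\<forall>i<mdim M. \<forall>j<mdim M.
           integrable (law M \<theta>) (\<lambda>x. coord_deriv c i (\<lambda>\<eta>. loglik M \<eta> x) \<theta> *
                                      coord_deriv c j (\<lambda>\<eta>. loglik M \<eta> x) \<theta>)) \<and>
        metric M c \<theta> = Matrix.mat (mdim M) (mdim M) (\<lambda>(i, j).
           \<integral>x. coord_deriv c i (\<lambda>\<eta>. loglik M \<eta> x) \<theta> *
                coord_deriv c j (\<lambda>\<eta>. loglik M \<eta> x) \<theta> \<partial>law M \<theta>))"

text \<open>A sample of size \<open>n\<close> is a function \<open>\<omega>\<close> on \<open>{..<n}\<close>.\<close>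

definition sample_law :: "'x measure \<Rightarrow> nat \<Rightarrow> (nat \<Rightarrow> 'x) measure" where
  "sample_law Q n = PiM {..<n} (\<lambda>_. Q)"

definition sample_loglik ::
  "('a, 'x, 'm) bayes_model_scheme \<Rightarrow> nat \<Rightarrow> (nat \<Rightarrow> 'x) \<Rightarrow> 'a \<Rightarrow> real" where
  "sample_loglik M n \<omega> \<theta> = (\<Sum>i<n. loglik M \<theta> (\<omega> i))"

definition prior :: "('a, 'x, 'm) bayes_model_scheme \<Rightarrow> 'a measure" where
  "prior M = density (rvolume M) (\<lambda>\<theta>. ennreal (prior_density M \<theta>))"

definition posterior_exists ::
  "('a, 'x, 'm) bayes_model_scheme \<Rightarrow> nat \<Rightarrow> (nat \<Rightarrow> 'x) \<Rightarrow> bool" where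
  "posterior_exists M n \<omega> \<longleftrightarrow> integrable (prior M) (\<lambda>\<theta>. exp (sample_loglik M n \<omega> \<theta>))"

definition posterior ::
  "('a, 'x, 'm) bayes_model_scheme \<Rightarrow> nat \<Rightarrow> (nat \<Rightarrow> 'x) \<Rightarrow> 'a measure" where
  "posterior M n \<omega> = density (prior M) (\<lambda>\<theta>.
     ennreal (exp (sample_loglik M n \<omega> \<theta>) / (\<integral>\<eta>. exp (sample_loglik M n \<omega> \<eta>) \<partial>prior M)))"

definition psi_hat ::
  "('a, 'x, 'm) bayes_model_scheme \<Rightarrow> nat \<Rightarrow> ('a \<Rightarrow> real) \<Rightarrow> (nat \<Rightarrow> 'x) \<Rightarrow> 'a \<Rightarrow> real" where
  "psi_hat M n \<psi> \<omega> \<theta> =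
     \<psi> \<theta> + rinner M (gradient M \<psi>) (gradient M (sample_loglik M n \<omega>)) \<theta> / real n"

section \<open>Stochastic order and the bounded Lipschitz distance\<close>

text \<open>
  \<open>little_op Q X a\<close>: \<open>X\<^sub>n = o\<^sub>p(a\<^sub>n)\<close> under \<open>Q\<^sub>n\<close>. The outer measure equals the probability of the event
  whenever the latter is measurable (\<open>emeasure\<close> would be \<open>0\<close> on a non-measurable set).
\<close>

definition little_op ::
  "(nat \<Rightarrow> 'w measure) \<Rightarrow> (nat \<Rightarrow> 'w \<Rightarrow> ereal) \<Rightarrow> (nat \<Rightarrow> real) \<Rightarrow> bool" where
  "little_op Q X a \<longleftrightarrow>
     (\<forall>\<epsilon>>0. (\<lambda>n. outer_measure_of (Q n) {\<omega> \<in> space (Q n). ereal (\<epsilon> * a n) < \<bar>X n \<omega>\<bar>})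
        \<longlonglongrightarrow> 0)"

definition d_BL :: "real measure \<Rightarrow> real measure \<Rightarrow> real" where
  "d_BL \<mu> \<nu> =
     (SUP h \<in> {h. (\<forall>x. h x \<in> {-1..1}) \<and> (\<forall>x y. \<bar>h x - h y\<bar> \<le> \<bar>x - y\<bar>)}.
        \<bar>(\<integral>x. h x \<partial>\<mu>) - (\<integral>x. h x \<partial>\<nu>)\<bar>)"

abbreviation normal_law :: "real \<Rightarrow> real measure" where
  "normal_law s \<equiv> density lborel (\<lambda>x. ennreal (normal_density 0 s x))"

section \<open>The error terms\<close>

definition A0 :: "('a, 'x, 'm) bayes_model_scheme \<Rightarrow> nat \<Rightarrow> ('a \<Rightarrow> real) \<Rightarrow> (nat \<Rightarrow> 'x) \<Rightarrow> real" where
  "A0 M n c \<omega> = 1 - (\<integral>\<theta>. c \<theta> \<partial>posterior M n \<omega>)"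

definition A1 ::
  "('a, 'x, 'm) bayes_model_scheme \<Rightarrow> nat \<Rightarrow> ('a \<Rightarrow> real) \<Rightarrow> ('a \<Rightarrow> real) \<Rightarrow> (nat \<Rightarrow> 'x) \<Rightarrow> real" where
  "A1 M n c \<psi> \<omega> = (\<integral>\<theta>. \<bar>rinner M (gradient M c) (gradient M \<psi>) \<theta>\<bar> \<partial>posterior M n \<omega>)"

text \<open>
  The suprema below are of continuous functions over a compact set, hence finite, unless the support
  is empty, in which case \<open>A0 = 1\<close> and the values of \<open>A2\<close> and \<open>A3\<close> do not matter.
\<close>

definition A2 ::
  "('a, 'x, 'm) bayes_model_scheme \<Rightarrow> nat \<Rightarrow> ('a \<Rightarrow> real) \<Rightarrow> ('a \<Rightarrow> real) \<Rightarrow> ((nat \<Rightarrow> 'x) \<Rightarrow> real) \<Rightarrow>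
    (nat \<Rightarrow> 'x) \<Rightarrow> real" where
  "A2 M n c \<psi> est \<omega> =
     (SUP \<theta>\<in>supp M c. \<bar>psi_hat M n \<psi> \<omega> \<theta> - est \<omega> +
        weighted_laplacian M (prior_density M) \<psi> \<theta> / real n\<bar>)"

definition A3 ::
  "('a, 'x, 'm) bayes_model_scheme \<Rightarrow> ('a \<Rightarrow> real) \<Rightarrow> ('a \<Rightarrow> real) \<Rightarrow> real \<Rightarrow> real" where
  "A3 M c \<psi> s = (SUP \<theta>\<in>supp M c. \<bar>s\<^sup>2 - (rnorm M (gradient M \<psi>) \<theta>)\<^sup>2\<bar>)"

end

theory Submission
  imports Defs
begin

text \<open>
  The proof is Stein's method. Let \<open>f\<close> solve \<open>\<sigma>\<^sup>2 f' - x f = h - \<nu>[h]\<close> with \<open>\<nu>\<close> the normal law; the Mills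
  ratio bounds give \<open>|f| \<le> 4 / \<sigma>\<close> and \<open>|f'| \<le> 4 / \<sigma>\<^sup>2\<close>. Integrating the divergence of
  \<open>\<phi> f(Z) e^l \<pi> \<nabla>\<psi>\<close> over the manifold, where \<open>\<phi>\<close> is the cutoff, \<open>l\<close> the log-likelihood of the
  sample and \<open>\<pi>\<close> the prior density, turns the posterior mean of \<open>\<phi> (\<sigma>\<^sup>2 f'(Z) - Z f(Z))\<close> into three
  terms controlled by \<open>A1\<close>, \<open>A2\<close> and \<open>A3\<close>; replacing the posterior by its reweighting with \<open>\<phi>\<close> costs
  at most twice \<open>A0\<close>.

  The divergence theorem is proved for functions supported in one chart by Fubini and the fundamental
  theorem of calculus, and extended to compact supports by splitting \<open>w = w b + w (1 - b)\<close> with bump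
  functions \<open>b\<close>. That the coordinate formula of the Laplacian does not depend on the chart follows by
  duality: both formulas integrate in the same way against every bump function, because the volume
  measure is the same in both charts.
\<close>

section \<open>Partial derivatives in coordinates\<close>

text \<open>The dimension is a number and not a type, so differentiability is expressed by
  continuous partial derivatives, and the chain rule has to be derived from them. The obstacle that
  shapes the geometric part is \<open>chart_at\<close>: it picks a chart by choice, point by point,
  so the formulas for \<open>rinner\<close> and \<open>laplacian\<close> may use unrelated charts at
  neighbouring points. They cannot be shown continuous, or be differentiated or integrated, before
  they are moved to a fixed chart. For the inner product this is linear algebra with the Jacobian.
  For the Laplacian a direct computation would involve second derivatives of transition maps and the
  derivative of a determinant; the duality argument avoids both. The constant 4 comes from the test
  functions: subtracting its normal mean from \<open>h\<close> gives a right-hand side bounded by 2,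
  and solving Stein's equation costs another factor 2.\<close>

definition coord_box :: "nat \<Rightarrow> (nat \<Rightarrow> real) \<Rightarrow> real \<Rightarrow> (nat \<Rightarrow> real) set" where
  "coord_box p y r = PiE {..<p} (\<lambda>i. {y i - r<..<y i + r})"

lemma topspace_coord_space [simp]: "topspace (coord_space p) = extensional {..<p}"
  by (simp add: coord_space_def PiE_def)

lemma mem_coord_box: "z \<in> coord_box p y r \<longleftrightarrow> z \<in> extensional {..<p} \<and> (\<forall>i<p. \<bar>z i - y i\<bar> < r)"
  unfolding coord_box_def PiE_iff by (simp add: abs_less_iff Ball_def) (smt (verit))

lemma coord_box_self: "y \<in> extensional {..<p} \<Longrightarrow> r > 0 \<Longrightarrow> y \<in> coord_box p y r"
  by (simp add: mem_coord_box)

lemma coord_box_mono: "r \<le> s \<Longrightarrow> coord_box p y r \<subseteq> coord_box p y s"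
  by (auto simp: mem_coord_box) (meson order_less_le_trans)

lemma openin_coord_box: "openin (coord_space p) (coord_box p y r)"
  unfolding coord_space_def coord_box_def by (simp add: openin_PiE)

text \<open>Cubes are basic neighbourhoods because only finitely many coordinates are constrained.
  They serve instead of balls since they are also measurable rectangles, and a coordinatewise path
  from the centre to a point of the cube stays inside it.\<close>

lemma openin_coord_space_iff:
  "openin (coord_space p) S \<longleftrightarrow> S \<subseteq> extensional {..<p} \<and> (\<forall>y\<in>S. \<exists>r>0. coord_box p y r \<subseteq> S)"
proof (intro iffI conjI ballI)
  assume S: "openin (coord_space p) S"
  then show "S \<subseteq> extensional {..<p}" using openin_subset by fastforce
  fix y assume "y \<in> S"
  then obtain U where "\<forall>i\<in>{..<p}. openin euclidean (U i)" and U: "y \<in> PiE {..<p} U" "PiE {..<p} U \<subseteq> S"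
    using bspec[OF S[unfolded coord_space_def openin_product_topology_alt]] by blast
  then have U_open: "\<And>i. i < p \<Longrightarrow> open (U i)" by simp
  have "\<exists>e>0. ball (y i) e \<subseteq> U i" if "i < p" for i
    using U_open[OF that] U(1) that unfolding open_contains_ball PiE_iff by blast
  then obtain e where e: "\<And>i. i < p \<Longrightarrow> e i > 0" "\<And>i. i < p \<Longrightarrow> ball (y i) (e i) \<subseteq> U i"
    by metis
  \<comment> \<open>The element 1 keeps the set nonempty when \<open>p = 0\<close>.\<close>
  define r where "r = Min (insert 1 (e ` {..<p}))"
  have "r > 0" unfolding r_def using e(1) by (subst Min_gr_iff) auto
  have r: "r \<le> e i" if "i < p" for i unfolding r_def using that by (intro Min_le) auto
  have "coord_box p y r \<subseteq> PiE {..<p} U"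
  proof
    fix z assume z: "z \<in> coord_box p y r"
    have "z i \<in> U i" if "i < p" for i
    proof -
      have "\<bar>z i - y i\<bar> < e i" using z r[OF that] that by (fastforce simp: mem_coord_box)
      then have "z i \<in> ball (y i) (e i)" by (simp add: dist_real_def abs_minus_commute)
      then show ?thesis using e(2)[OF that] by blast
    qed
    then show "z \<in> PiE {..<p} U" using z by (auto simp: mem_coord_box PiE_iff)
  qed
  with U(2) \<open>r > 0\<close> show "\<exists>r>0. coord_box p y r \<subseteq> S" by blast
next
  assume S: "S \<subseteq> extensional {..<p} \<and> (\<forall>y\<in>S. \<exists>r>0. coord_box p y r \<subseteq> S)"
  show "openin (coord_space p) S"
  proof (subst openin_subopen, intro ballI)
    fix y assume "y \<in> S"
    with S show "\<exists>T. openin (coord_space p) T \<and> y \<in> T \<and> T \<subseteq> S"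
      by (meson coord_box_self openin_coord_box subsetD)
  qed
qed

abbreviation cont_on :: "nat \<Rightarrow> (nat \<Rightarrow> real) set \<Rightarrow> ((nat \<Rightarrow> real) \<Rightarrow> real) \<Rightarrow> bool" where
  "cont_on p S \<equiv> continuous_map (subtopology (coord_space p) S) euclideanreal"

lemma continuous_map_real_iff:
  "continuous_map X euclideanreal f \<longleftrightarrow>
    (\<forall>x\<in>topspace X. \<forall>e>0. \<exists>U. openin X U \<and> x \<in> U \<and> (\<forall>y\<in>U. \<bar>f y - f x\<bar> < e))"
  using Met_TC.continuous_map_to_metric[of X f] by (simp add: dist_real_def abs_minus_commute)

lemma cont_on_iff:
  assumes S: "openin (coord_space p) S"
  shows "cont_on p S f \<longleftrightarrow>
    (\<forall>y\<in>S. \<forall>e>0. \<exists>r>0. coord_box p y r \<subseteq> S \<and> (\<forall>z\<in>coord_box p y r. \<bar>f z - f y\<bar> < e))"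
proof -
  have top: "topspace (subtopology (coord_space p) S) = S"
    using S openin_subset by (fastforce simp: topspace_subtopology)
  show ?thesis unfolding continuous_map_real_iff top
  proof (intro ball_cong refl iff_allI imp_cong)
    fix y e assume y: "y \<in> S" and "(e::real) > 0"
    have "(\<exists>U. openin (subtopology (coord_space p) S) U \<and> y \<in> U \<and> (\<forall>z\<in>U. \<bar>f z - f y\<bar> < e)) \<longleftrightarrow>
        (\<exists>U. (openin (coord_space p) U \<and> U \<subseteq> S) \<and> y \<in> U \<and> (\<forall>z\<in>U. \<bar>f z - f y\<bar> < e))"
      by (simp add: openin_open_subtopology[OF S])
    also have "\<dots> \<longleftrightarrow> (\<exists>r>0. coord_box p y r \<subseteq> S \<and> (\<forall>z\<in>coord_box p y r. \<bar>f z - f y\<bar> < e))"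
    proof
      assume "\<exists>U. (openin (coord_space p) U \<and> U \<subseteq> S) \<and> y \<in> U \<and> (\<forall>z\<in>U. \<bar>f z - f y\<bar> < e)"
      then obtain U where U: "openin (coord_space p) U" "U \<subseteq> S" "y \<in> U" "\<forall>z\<in>U. \<bar>f z - f y\<bar> < e" by blast
      then obtain r where "r > 0" "coord_box p y r \<subseteq> U" unfolding openin_coord_space_iff by blast
      with U show "\<exists>r>0. coord_box p y r \<subseteq> S \<and> (\<forall>z\<in>coord_box p y r. \<bar>f z - f y\<bar> < e)"
        by (intro exI[of _ r]) blast
    next
      assume "\<exists>r>0. coord_box p y r \<subseteq> S \<and> (\<forall>z\<in>coord_box p y r. \<bar>f z - f y\<bar> < e)"
      then obtain r where r: "r > 0" "coord_box p y r \<subseteq> S" "\<forall>z\<in>coord_box p y r. \<bar>f z - f y\<bar> < e" by blast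
      have "y \<in> coord_box p y r" using y S r(1) unfolding openin_coord_space_iff by (intro coord_box_self) blast+
      with r show "\<exists>U. (openin (coord_space p) U \<and> U \<subseteq> S) \<and> y \<in> U \<and> (\<forall>z\<in>U. \<bar>f z - f y\<bar> < e)"
        by (intro exI[of _ "coord_box p y r"]) (simp add: openin_coord_box)
    qed
    finally show "(\<exists>U. openin (subtopology (coord_space p) S) U \<and> y \<in> U \<and> (\<forall>z\<in>U. \<bar>f z - f y\<bar> < e)) \<longleftrightarrow>
      (\<exists>r>0. coord_box p y r \<subseteq> S \<and> (\<forall>z\<in>coord_box p y r. \<bar>f z - f y\<bar> < e))" .
  qed
qed

lemma continuous_map_compose_real:
  assumes "continuous_map X euclideanreal f" "continuous_on T g" "f ` topspace X \<subseteq> T"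
  shows "continuous_map X euclideanreal (\<lambda>x. g (f x))"
proof -
  have "continuous_map X (top_of_set T) f"
    using assms by (auto simp: continuous_map_in_subtopology)
  moreover have "continuous_map (top_of_set T) euclideanreal g"
    using assms by simp
  ultimately have "continuous_map X euclideanreal (g \<circ> f)" by (rule continuous_map_compose)
  then show ?thesis by (simp only: o_def)
qed

text \<open>Class C^1 with the partial derivatives carried along as a witness \<open>D\<close>. The
  operator \<open>partial\<close> rests on \<open>deriv\<close>, which is an arbitrary value where
  no derivative exists; with a witness, the product and chain rules yield formulas.\<close>

definition has_partials ::
  "nat \<Rightarrow> (nat \<Rightarrow> real) set \<Rightarrow> ((nat \<Rightarrow> real) \<Rightarrow> real) \<Rightarrow> (nat \<Rightarrow> (nat \<Rightarrow> real) \<Rightarrow> real) \<Rightarrow> bool" where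
  "has_partials p S f D \<longleftrightarrow> cont_on p S f \<and>
     (\<forall>i<p. (\<forall>y\<in>S. ((\<lambda>t. f (y(i := t))) has_real_derivative D i y) (at (y i))) \<and> cont_on p S (D i))"

lemma has_partialsI:
  assumes "cont_on p S f"
    and "\<And>i y. i < p \<Longrightarrow> y \<in> S \<Longrightarrow> ((\<lambda>t. f (y(i := t))) has_real_derivative D i y) (at (y i))"
    and "\<And>i. i < p \<Longrightarrow> cont_on p S (D i)"
  shows "has_partials p S f D"
  using assms by (auto simp: has_partials_def)

lemma has_partials_cont: "has_partials p S f D \<Longrightarrow> cont_on p S f"
  and has_partials_deriv: "has_partials p S f D \<Longrightarrow> i < p \<Longrightarrow> y \<in> S \<Longrightarrow>
    ((\<lambda>t. f (y(i := t))) has_real_derivative D i y) (at (y i))"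
  and has_partials_cont_deriv: "has_partials p S f D \<Longrightarrow> i < p \<Longrightarrow> cont_on p S (D i)"
  by (auto simp: has_partials_def)

lemma has_partials_partial: "has_partials p S f D \<Longrightarrow> i < p \<Longrightarrow> y \<in> S \<Longrightarrow> partial i f y = D i y"
  unfolding partial_def by (intro DERIV_imp_deriv has_partials_deriv)

lemma Ck_on_imp_has_partials:
  assumes "Ck_on p (Suc k) S f"
  shows "has_partials p S f (\<lambda>i. partial i f)"
proof -
  have "cont_on p S g" if "Ck_on p k S g" for g
    using that by (cases k) auto
  then show ?thesis
    using assms unfolding has_partials_def partial_def
    by (auto simp: DERIV_deriv_iff_real_differentiable partial_def[abs_def])
qed

lemma cont_on_cong: "cont_on p S f \<Longrightarrow> (\<And>y. y \<in> S \<Longrightarrow> f y = g y) \<Longrightarrow> cont_on p S g"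
  by (erule continuous_map_eq) simp

lemma has_partials_imp_C1: "has_partials p S f D \<Longrightarrow> Ck_on p 1 S f"
proof -
  assume f: "has_partials p S f D"
  have "cont_on p S (partial i f)" if "i < p" for i
    by (rule cont_on_cong[OF has_partials_cont_deriv[OF f that]]) (simp add: has_partials_partial[OF f that])
  then show ?thesis
    using has_partials_deriv[OF f] has_partials_cont[OF f] by (auto simp: real_differentiable_def)
qed

lemma has_partials_D_cong:
  "has_partials p S f D \<Longrightarrow> (\<And>i y. i < p \<Longrightarrow> y \<in> S \<Longrightarrow> D i y = E i y) \<Longrightarrow> has_partials p S f E"
  unfolding has_partials_def using cont_on_cong[of p S "D _" "E _"] by auto

lemma has_partials_subset:
  "has_partials p S f D \<Longrightarrow> T \<subseteq> S \<Longrightarrow> has_partials p T f D"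
  unfolding has_partials_def using continuous_map_from_subtopology_mono by blast

lemma extensional_fun_upd_lt: "y \<in> extensional {..<p} \<Longrightarrow> i < p \<Longrightarrow> y(i := t) \<in> extensional {..<p::nat}"
  by (auto simp: extensional_def)

lemma openin_coord_eventually_line:
  assumes "openin (coord_space p) S" "y \<in> S" "i < p"
  shows "\<forall>\<^sub>F t in nhds (y i). y(i := t) \<in> S"
proof -
  obtain r where r: "r > 0" "coord_box p y r \<subseteq> S" and y: "y \<in> extensional {..<p}"
    using assms unfolding openin_coord_space_iff by blast
  have "y(i := t) \<in> S" if "dist t (y i) < r" for t
  proof -
    have "y(i := t) \<in> coord_box p y r"
      using that r(1) assms(3) y by (auto simp: mem_coord_box dist_real_def extensional_fun_upd_lt)
    with r show ?thesis by blast
  qed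
  then show ?thesis using r(1) unfolding eventually_nhds_metric by blast
qed

text \<open>Openness of \<open>S\<close> matters: the derivative at \<open>y\<close> looks at
  \<open>f\<close> on a nearby piece of the coordinate line, which must stay in \<open>S\<close> for
  the equation to apply.\<close>

lemma has_partials_cong:
  assumes "has_partials p S f D" "openin (coord_space p) S" "\<And>y. y \<in> S \<Longrightarrow> f y = g y"
  shows "has_partials p S g D"
proof (rule has_partialsI)
  show "cont_on p S g" using has_partials_cont[OF assms(1)] assms(3) by (rule cont_on_cong)
  fix i assume i: "i < p"
  then show "cont_on p S (D i)" by (rule has_partials_cont_deriv[OF assms(1)])
  fix y assume y: "y \<in> S"
  have ev: "\<forall>\<^sub>F t in nhds (y i). f (y(i := t)) = g (y(i := t))"
    using openin_coord_eventually_line[OF assms(2) y i] by eventually_elim (rule assms(3))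
  then show "((\<lambda>t. g (y(i := t))) has_real_derivative D i y) (at (y i))"
    using has_partials_deriv[OF assms(1) i y] by (simp only: DERIV_cong_ev[OF refl ev refl])
qed

text \<open>Continuity and derivatives are decided in a neighbourhood. This is how functions glued
  from different formulas, such as extensions by zero, are shown to be C^1.\<close>

lemma has_partials_local:
  assumes S: "openin (coord_space p) S"
    and loc: "\<And>y. y \<in> S \<Longrightarrow> \<exists>U. openin (coord_space p) U \<and> y \<in> U \<and> U \<subseteq> S \<and> has_partials p U f D"
  shows "has_partials p S f D"
proof -
  have cont: "cont_on p S h" if C: "\<And>y U. openin (coord_space p) U \<Longrightarrow> U \<subseteq> S \<Longrightarrow> has_partials p U f D \<Longrightarrow> cont_on p U h" for h
    unfolding cont_on_iff[OF S]
  proof (intro ballI allI impI)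
    fix y and e :: real assume y: "y \<in> S" and e: "e > 0"
    obtain U where U: "openin (coord_space p) U" "y \<in> U" "U \<subseteq> S" "has_partials p U f D"
      using loc[OF y] by blast
    show "\<exists>r>0. coord_box p y r \<subseteq> S \<and> (\<forall>z\<in>coord_box p y r. \<bar>h z - h y\<bar> < e)"
    proof -
      obtain r where "r > 0" "coord_box p y r \<subseteq> U" "\<forall>z\<in>coord_box p y r. \<bar>h z - h y\<bar> < e"
        using C[OF U(1,3,4)] U(2) e unfolding cont_on_iff[OF U(1)] by blast
      with U(3) show ?thesis by (intro exI[of _ r]) blast
    qed
  qed
  show ?thesis
  proof (rule has_partialsI)
    show "cont_on p S f" by (rule cont) (rule has_partials_cont)
    show "cont_on p S (D i)" if "i < p" for i by (rule cont) (rule has_partials_cont_deriv[OF _ that])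
    show "((\<lambda>t. f (y(i := t))) has_real_derivative D i y) (at (y i))" if i: "i < p" and y: "y \<in> S" for i y
    proof -
      obtain U where "y \<in> U" "has_partials p U f D" using loc[OF y] by blast
      then show ?thesis using i by (intro has_partials_deriv)
    qed
  qed
qed

lemma has_partials_const: "has_partials p S (\<lambda>_. c) (\<lambda>_ _. 0)"
  by (simp add: has_partials_def)

lemma has_partials_add:
  "has_partials p S f D \<Longrightarrow> has_partials p S g E \<Longrightarrow>
   has_partials p S (\<lambda>y. f y + g y) (\<lambda>i y. D i y + E i y)"
  unfolding has_partials_def by (auto intro: continuous_map_add DERIV_add)

lemma has_partials_mult:
  "has_partials p S f D \<Longrightarrow> has_partials p S g E \<Longrightarrow>
   has_partials p S (\<lambda>y. f y * g y) (\<lambda>i y. D i y * g y + E i y * f y)"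
  unfolding has_partials_def
  by (auto intro!: continuous_map_add continuous_map_real_mult DERIV_mult[THEN DERIV_cong])

lemma has_partials_compose:
  assumes f: "has_partials p S f D" and fS: "\<And>y. y \<in> S \<Longrightarrow> f y \<in> T" and S: "S \<subseteq> extensional {..<p}"
    and g: "\<And>t. t \<in> T \<Longrightarrow> (g has_real_derivative g' t) (at t)" and g': "continuous_on T g'"
  shows "has_partials p S (\<lambda>y. g (f y)) (\<lambda>i y. g' (f y) * D i y)"
proof (rule has_partialsI)
  have top: "topspace (subtopology (coord_space p) S) = S" using S by auto
  have "continuous_on T g"
    using g by (intro DERIV_continuous_on) (auto intro: has_field_derivative_at_within)
  then show "cont_on p S (\<lambda>y. g (f y))"
    by (rule continuous_map_compose_real[OF has_partials_cont[OF f]]) (use fS in \<open>auto simp: top\<close>)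
  fix i assume i: "i < p"
  show "cont_on p S (\<lambda>y. g' (f y) * D i y)"
    by (intro continuous_map_real_mult has_partials_cont_deriv[OF f i]
        continuous_map_compose_real[OF has_partials_cont[OF f] g']) (use fS in \<open>auto simp: top\<close>)
  fix y assume y: "y \<in> S"
  show "((\<lambda>t. g (f (y(i := t)))) has_real_derivative g' (f y) * D i y) (at (y i))"
    using DERIV_chain2[of g "g' (f y)" "\<lambda>t. f (y(i := t))" "y i"] g[OF fS[OF y]]
      has_partials_deriv[OF f i y] by simp
qed

lemma cont_on_coord: "a < p \<Longrightarrow> cont_on p S (\<lambda>y. y a)"
  unfolding coord_space_def
  by (intro continuous_map_from_subtopology continuous_map_product_projection) auto

lemma has_partials_coord: "a < p \<Longrightarrow> has_partials p S (\<lambda>y. y a) (\<lambda>i y. if i = a then 1 else 0)"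
  by (rule has_partialsI) (auto simp: cont_on_coord)

section \<open>Mean value expansion and the chain rule for continuous partial derivatives\<close>

lemma mean_value_segment:
  fixes g :: "real \<Rightarrow> real"
  assumes "\<And>t. t \<in> closed_segment a b \<Longrightarrow> (g has_real_derivative g' t) (at t)"
  shows "\<exists>t\<in>closed_segment a b. g b - g a = g' t * (b - a)"
proof (cases a b rule: linorder_cases)
  case less
  then obtain z where "a < z" "z < b" "g b - g a = (b - a) * g' z"
    using MVT2[of a b g g'] assms by (auto simp: closed_segment_eq_real_ivl)
  then show ?thesis using less by (intro bexI[of _ z]) (auto simp: closed_segment_eq_real_ivl)
next
  case greater
  then obtain z where "b < z" "z < a" "g a - g b = (a - b) * g' z"
    using MVT2[of b a g g'] assms by (auto simp: closed_segment_eq_real_ivl)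
  then show ?thesis using greater by (intro bexI[of _ z]) (auto simp: closed_segment_eq_real_ivl algebra_simps)
qed (use assms in auto)

lemma has_partials_increment:
  assumes f: "has_partials q T f D" and box: "coord_box q y r \<subseteq> T" and y: "y \<in> extensional {..<q}"
    and z: "z \<in> coord_box q y r"
  shows "\<exists>\<xi>. (\<forall>k<q. \<xi> k \<in> coord_box q y r) \<and> f z - f y = (\<Sum>k<q. D k (\<xi> k) * (z k - y k))"
proof -
  \<comment> \<open>Pass from \<open>y\<close> to \<open>z\<close> one coordinate at a time.\<close>
  define w where "w k = (\<lambda>j. if j < k then z j else y j)" for k :: nat
  have z': "z \<in> extensional {..<q}" and zr: "\<And>j. j < q \<Longrightarrow> \<bar>z j - y j\<bar> < r" using z by (auto simp: mem_coord_box)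
  have "\<exists>\<xi>\<in>coord_box q y r. f (w (Suc k)) - f (w k) = D k \<xi> * (z k - y k)" if k: "k < q" for k
  proof -
    have box': "(w k)(k := t) \<in> coord_box q y r" if t: "t \<in> closed_segment (y k) (z k)" for t
    proof -
      have "\<bar>t - y k\<bar> \<le> \<bar>z k - y k\<bar>"
        using t by (auto simp: closed_segment_eq_real_ivl split: if_splits)
      moreover have "r > 0" using zr[OF k] by linarith
      ultimately show ?thesis
        using k zr zr[OF k] y z' unfolding mem_coord_box w_def extensional_def
        by (auto intro: order.strict_trans1)
    qed
    have "\<exists>t\<in>closed_segment (y k) (z k). f ((w k)(k := z k)) - f ((w k)(k := y k)) = D k ((w k)(k := t)) * (z k - y k)"
    proof (rule mean_value_segment)
      fix t assume "t \<in> closed_segment (y k) (z k)"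
      from has_partials_deriv[OF f k, of "(w k)(k := t)"] box'[OF this] box
      show "((\<lambda>t. f ((w k)(k := t))) has_real_derivative D k ((w k)(k := t))) (at t)" by auto
    qed
    moreover have "(w k)(k := z k) = w (Suc k)" "(w k)(k := y k) = w k" by (auto simp: w_def)
    ultimately show ?thesis using box' by metis
  qed
  then obtain \<xi> where \<xi>: "\<And>k. k < q \<Longrightarrow> \<xi> k \<in> coord_box q y r"
    "\<And>k. k < q \<Longrightarrow> f (w (Suc k)) - f (w k) = D k (\<xi> k) * (z k - y k)" by metis
  have "w q = z" using y z' by (auto simp: w_def extensional_def)
  moreover have "w 0 = y" by (simp add: w_def)
  ultimately have "f z - f y = (\<Sum>k<q. f (w (Suc k)) - f (w k))"
    using sum_lessThan_telescope[of "\<lambda>k. f (w k)" q] by simp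
  with \<xi> show ?thesis by (intro exI[of _ \<xi>]) auto
qed

text \<open>Continuity of the partial derivatives replaces total differentiability: divide the mean
  value expansion by \<open>t - t0\<close>; its coefficients converge because the intermediate
  points are squeezed towards \<open>\<gamma> t0\<close>.\<close>

lemma has_partials_along_curve:
  assumes f: "has_partials q T f D" and T: "openin (coord_space q) T"
    and ext: "\<forall>\<^sub>F t in nhds t0. \<gamma> t \<in> extensional {..<q}" and t0: "\<gamma> t0 \<in> T"
    and \<gamma>: "\<And>a. a < q \<Longrightarrow> ((\<lambda>t. \<gamma> t a) has_real_derivative \<gamma>' a) (at t0)"
  shows "((\<lambda>t. f (\<gamma> t)) has_real_derivative (\<Sum>a<q. D a (\<gamma> t0) * \<gamma>' a)) (at t0)"
proof -
  let ?y = "\<gamma> t0"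
  obtain r0 where r0: "r0 > 0" "coord_box q ?y r0 \<subseteq> T" and y: "?y \<in> extensional {..<q}"
    using T t0 unfolding openin_coord_space_iff by blast
  have near: "\<forall>\<^sub>F t in at t0. \<gamma> t \<in> coord_box q ?y r" if "r > 0" for r
  proof -
    have "\<forall>\<^sub>F t in at t0. \<bar>\<gamma> t a - ?y a\<bar> < r" if "a < q" for a
      using DERIV_isCont[OF \<gamma>[OF that]] \<open>r > 0\<close>
      unfolding isCont_def by (auto simp: tendsto_iff dist_real_def)
    then have "\<forall>\<^sub>F t in at t0. \<forall>a\<in>{..<q}. \<bar>\<gamma> t a - ?y a\<bar> < r"
      by (intro eventually_ball_finite) auto
    moreover have "\<forall>\<^sub>F t in at t0. \<gamma> t \<in> extensional {..<q}"
      using ext by (auto simp: eventually_at_filter elim: eventually_mono)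
    ultimately show ?thesis by eventually_elim (auto simp: mem_coord_box)
  qed
  \<comment> \<open>The factor 2 puts \<open>\<gamma> t\<close> strictly inside the open cube of
    radius \<open>R t\<close>; the entry \<open>\<bar>t - t0\<bar>\<close> keeps the radius positive
    where the curve stands still, and the set nonempty for \<open>q = 0\<close>.\<close>
  define R where "R t = 2 * Max (insert \<bar>t - t0\<bar> ((\<lambda>a. \<bar>\<gamma> t a - ?y a\<bar>) ` {..<q}))" for t
  have R_less: "R t < 2 * r" if "\<gamma> t \<in> coord_box q ?y r" "\<bar>t - t0\<bar> < r" for t r
    unfolding R_def using that by (subst mult_less_cancel_left_pos, simp, subst Max_less_iff) (auto simp: mem_coord_box)
  have ex: "\<exists>\<xi>. (\<forall>k<q. \<xi> k \<in> coord_box q ?y (R t)) \<and> f (\<gamma> t) - f ?y = (\<Sum>k<q. D k (\<xi> k) * (\<gamma> t k - ?y k))"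
    if t: "\<gamma> t \<in> coord_box q ?y (r0/2)" "\<bar>t - t0\<bar> < r0/2" "t \<noteq> t0" for t
  proof (rule has_partials_increment[OF f _ y])
    show "coord_box q ?y (R t) \<subseteq> T" using R_less[OF t(1,2)] r0(2) coord_box_mono[of "R t" r0 q ?y] by auto
    have pos: "R t > 0"
      unfolding R_def using t(3) by (subst zero_less_mult_iff, subst Max_gr_iff) auto
    have "\<bar>\<gamma> t a - ?y a\<bar> \<le> Max (insert \<bar>t - t0\<bar> ((\<lambda>a. \<bar>\<gamma> t a - ?y a\<bar>) ` {..<q}))" if "a < q" for a
      using that by (intro Max_ge) auto
    then have "\<bar>\<gamma> t a - ?y a\<bar> \<le> R t / 2" if "a < q" for a
      unfolding R_def using that by simp
    then show "\<gamma> t \<in> coord_box q ?y (R t)" using pos t(1) by (force simp: mem_coord_box)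
  qed
  \<comment> \<open>One choice of intermediate points for every \<open>t\<close>, so that limits in
    \<open>t\<close> make sense.\<close>
  define Q where "Q t = (SOME \<xi>. (\<forall>k<q. \<xi> k \<in> coord_box q ?y (R t)) \<and>
      f (\<gamma> t) - f ?y = (\<Sum>k<q. D k (\<xi> k) * (\<gamma> t k - ?y k)))" for t
  have Q: "(\<forall>k<q. Q t k \<in> coord_box q ?y (R t)) \<and> f (\<gamma> t) - f ?y = (\<Sum>k<q. D k (Q t k) * (\<gamma> t k - ?y k))"
    if "\<gamma> t \<in> coord_box q ?y (r0/2)" "\<bar>t - t0\<bar> < r0/2" "t \<noteq> t0" for t
    unfolding Q_def by (rule someI_ex[OF ex[OF that]])
  have ev: "\<forall>\<^sub>F t in at t0. \<gamma> t \<in> coord_box q ?y r \<and> \<bar>t - t0\<bar> < r \<and> t \<noteq> t0" if "r > 0" for r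
  proof -
    have "\<forall>\<^sub>F t in at t0. \<bar>t - t0\<bar> < r \<and> t \<noteq> t0"
      using that by (auto simp: eventually_at dist_real_def intro!: exI[of _ r])
    with near[OF that] show ?thesis by eventually_elim auto
  qed
  have lim: "((\<lambda>t. D k (Q t k)) \<longlongrightarrow> D k ?y) (at t0)" if k: "k < q" for k
  proof (rule tendstoI)
    fix e :: real assume e: "e > 0"
    obtain s where s: "s > 0" "\<And>z. z \<in> coord_box q ?y s \<Longrightarrow> \<bar>D k z - D k ?y\<bar> < e"
      using has_partials_cont_deriv[OF f k] e t0 unfolding cont_on_iff[OF T] by meson
    \<comment> \<open>Half of \<open>s\<close> because \<open>R t\<close> is only known to be below
      \<open>2 * r\<close>; half of \<open>r0\<close> because the expansion is available in that
      cube.\<close>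
    define r where "r = min (s/2) (r0/2)"
    have "r > 0" using s r0 by (simp add: r_def)
    show "\<forall>\<^sub>F t in at t0. dist (D k (Q t k)) (D k ?y) < e"
      using ev[OF \<open>r > 0\<close>]
    proof eventually_elim
      case (elim t)
      have "r \<le> r0 / 2" by (simp add: r_def)
      then have "\<gamma> t \<in> coord_box q ?y (r0/2)" "\<bar>t - t0\<bar> < r0/2" "t \<noteq> t0"
        using elim coord_box_mono[of r "r0/2" q ?y] by auto
      then have "Q t k \<in> coord_box q ?y (R t)" using Q k by blast
      moreover have "R t < s"
        using R_less[of t r] elim by (simp add: r_def)
      ultimately have "Q t k \<in> coord_box q ?y s" using coord_box_mono[of "R t" s q ?y] by auto
      from s(2)[OF this] show ?case by (simp add: dist_real_def)
    qed
  qed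
  have "((\<lambda>t. \<Sum>k<q. D k (Q t k) * ((\<gamma> t k - ?y k) / (t - t0))) \<longlongrightarrow> (\<Sum>a<q. D a ?y * \<gamma>' a)) (at t0)"
    using \<gamma> unfolding has_field_derivative_iff by (intro tendsto_sum tendsto_mult lim) auto
  moreover have "\<forall>\<^sub>F t in at t0. (\<Sum>k<q. D k (Q t k) * ((\<gamma> t k - ?y k) / (t - t0))) = (f (\<gamma> t) - f ?y) / (t - t0)"
    using ev[of "r0/2"] r0(1) by (auto elim!: eventually_mono simp: Q sum_divide_distrib)
  ultimately show ?thesis
    unfolding has_field_derivative_iff by (rule Lim_transform_eventually)
qed

text \<open>When one coordinate of \<open>y\<close> varies, \<open>h\<close> traces a curve, and the
  derivative along curves applies.\<close>

lemma has_partials_chain: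
  assumes f: "has_partials q T f D" and T: "openin (coord_space q) T" and S: "openin (coord_space p) S"
    and h: "\<And>a. a < q \<Longrightarrow> has_partials p S (\<lambda>y. h y a) (E a)" and hS: "\<And>y. y \<in> S \<Longrightarrow> h y \<in> T"
  shows "has_partials p S (\<lambda>y. f (h y)) (\<lambda>i y. \<Sum>a<q. D a (h y) * E a i y)"
proof (rule has_partialsI)
  have TE: "T \<subseteq> extensional {..<q}" using T by (simp add: openin_coord_space_iff)
  have top: "topspace (subtopology (coord_space p) S) = S" 
    using S by (auto simp: openin_coord_space_iff)
  have hc: "continuous_map (subtopology (coord_space p) S) (subtopology (coord_space q) T) h"
    unfolding coord_space_def[of q] continuous_map_in_subtopology continuous_map_componentwise
    using has_partials_cont[OF h] hS TE by (auto simp: top)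
  have comp: "cont_on p S (\<lambda>y. u (h y))" if "cont_on q T u" for u
    using continuous_map_compose[OF hc that] by (simp add: o_def)
  show "cont_on p S (\<lambda>y. f (h y))" by (rule comp[OF has_partials_cont[OF f]])
  fix i assume i: "i < p"
  show "cont_on p S (\<lambda>y. \<Sum>a<q. D a (h y) * E a i y)"
    by (intro continuous_map_sum continuous_map_real_mult comp has_partials_cont_deriv[OF f]
        has_partials_cont_deriv[OF h i]) auto
  fix y assume y: "y \<in> S"
  have "((\<lambda>t. f (h (y(i := t)))) has_real_derivative (\<Sum>a<q. D a (h (y(i := y i))) * E a i y)) (at (y i))"
  proof (rule has_partials_along_curve[OF f T])
    show "\<forall>\<^sub>F t in nhds (y i). h (y(i := t)) \<in> extensional {..<q}"
      using openin_coord_eventually_line[OF S y i] by eventually_elim (use hS TE in auto)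
    show "h (y(i := y i)) \<in> T" using hS[OF y] by simp
  qed (rule has_partials_deriv[OF h i y])
  then show "((\<lambda>t. f (h (y(i := t)))) has_real_derivative (\<Sum>a<q. D a (h y) * E a i y)) (at (y i))"
    by simp
qed

section \<open>Integrals of partial derivatives\<close>

interpretation lborel_family: product_sigma_finite "\<lambda>_::nat. lborel :: real measure"
  by standard

lemma space_coord_lebesgue [simp]: "space (coord_lebesgue p) = extensional {..<p}"
  by (simp add: coord_lebesgue_def space_PiM PiE_def)

lemma sets_coord_box: "coord_box p y r \<in> sets (coord_lebesgue p)"
  unfolding coord_box_def coord_lebesgue_def by (intro sets_PiM_I_finite) auto

lemma emeasure_coord_box:
  assumes "r \<ge> 0"
  shows "emeasure (coord_lebesgue p) (coord_box p y r) = ennreal ((2 * r) ^ p)"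
proof -
  have "emeasure (coord_lebesgue p) (coord_box p y r) = (\<Prod>i<p. emeasure lborel {y i - r<..<y i + r})"
    unfolding coord_box_def coord_lebesgue_def by (intro lborel_family.emeasure_PiM) auto
  also have "\<dots> = ennreal ((2 * r) ^ p)"
    using assms by (simp add: ennreal_power)
  finally show ?thesis .
qed

text \<open>The product sigma algebra is generated by rectangles, so the open set has to be a
  countable union of them: cubes with rational centre and radius.\<close>

lemma openin_coord_sets:
  assumes S: "openin (coord_space p) S"
  shows "S \<in> sets (coord_lebesgue p)"
proof -
  define Q where "Q = {(q, r). q \<in> PiE {..<p} (\<lambda>_. \<rat>) \<and> r \<in> \<rat> \<and> coord_box p q r \<subseteq> S}"
  have "countable Q"
    by (rule countable_subset[of _ "PiE {..<p} (\<lambda>_. \<rat>) \<times> \<rat>"])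
       (auto simp: Q_def intro!: countable_SIGMA countable_PiE countable_rat)
  have "S \<subseteq> (\<Union>(q, r)\<in>Q. coord_box p q r)"
  proof
    fix y assume y: "y \<in> S"
    then obtain e where e: "e > 0" "coord_box p y e \<subseteq> S" and ext: "y \<in> extensional {..<p}"
      using S unfolding openin_coord_space_iff by blast
    \<comment> \<open>With a radius below \<open>e / 2\<close>, a cube that contains
      \<open>y\<close> lies in the cube of radius \<open>e\<close> around \<open>y\<close>.\<close>
    obtain r where r: "r \<in> \<rat>" "0 < r" "r < e / 2"
      using Rats_dense_in_real[of 0 "e/2"] e by auto
    have "\<exists>q\<in>\<rat>. \<bar>q - y i\<bar> < r" for i
      using Rats_dense_in_real[of "y i - r" "y i + r"] r(2) by (auto simp: abs_less_iff intro!: bexI)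
    then obtain q where q: "\<And>i. q i \<in> \<rat>" "\<And>i. \<bar>q i - y i\<bar> < r" by metis
    let ?q = "restrict q {..<p}"
    have "y \<in> coord_box p ?q r"
      using q(2) ext by (auto simp: mem_coord_box abs_minus_commute)
    moreover have "coord_box p ?q r \<subseteq> coord_box p y e"
    proof
      fix z assume z: "z \<in> coord_box p ?q r"
      have "\<bar>z i - y i\<bar> < e" if "i < p" for i
      proof -
        have "\<bar>z i - q i\<bar> < r" using z that by (simp add: mem_coord_box)
        with q(2)[of i] r(3) show ?thesis by linarith
      qed
      then show "z \<in> coord_box p y e" using z by (simp add: mem_coord_box)
    qed
    then have "(?q, r) \<in> Q" using q(1) r(1) e(2) by (auto simp: Q_def)
    ultimately show "y \<in> (\<Union>(q, r)\<in>Q. coord_box p q r)" by blast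
  qed
  then have "S = (\<Union>(q, r)\<in>Q. coord_box p q r)" by (auto simp: Q_def)
  also have "\<dots> \<in> sets (coord_lebesgue p)"
    using \<open>countable Q\<close> by (intro sets.countable_UN') (auto simp: sets_coord_box)
  finally show ?thesis .
qed

lemma continuous_map_borel_measurable:
  fixes f :: "'b \<Rightarrow> real"
  assumes "continuous_map X euclideanreal f" "space N = topspace X"
    "\<And>U. openin X U \<Longrightarrow> U \<in> sets N"
  shows "f \<in> borel_measurable N"
proof (rule borel_measurableI)
  fix U :: "real set" assume "open U"
  then have "openin X {x \<in> topspace X. f x \<in> U}"
    using assms(1) by (intro openin_continuous_map_preimage) auto
  moreover have "{x \<in> topspace X. f x \<in> U} = f -` U \<inter> space N" using assms(2) by auto
  ultimately show "f -` U \<inter> space N \<in> sets N" using assms(3) by auto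
qed

lemma cont_on_measurable:
  assumes "cont_on p S f" "openin (coord_space p) S"
  shows "f \<in> borel_measurable (restrict_space (coord_lebesgue p) S)"
proof (rule continuous_map_borel_measurable[OF assms(1)])
  show "space (restrict_space (coord_lebesgue p) S) = topspace (subtopology (coord_space p) S)"
    by (auto simp: space_restrict_space)
  fix U assume "openin (subtopology (coord_space p) S) U"
  then have "openin (coord_space p) U" "U \<subseteq> S"
    using openin_open_subtopology[OF assms(2)] by auto
  then show "U \<in> sets (restrict_space (coord_lebesgue p) S)"
    using sets.Int[OF openin_coord_sets[OF assms(2)] sets.top] openin_coord_sets
    by (subst sets_restrict_space_iff) auto
qed

lemma cont_on_line:
  assumes f: "cont_on p S f" and S: "openin (coord_space p) S" and line: "\<And>t. y(i := t) \<in> S" and i: "i < p"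
  shows "isCont (\<lambda>t. f (y(i := t))) t"
  unfolding isCont_def
proof (rule tendstoI)
  fix e :: real assume "e > 0"
  then obtain r where r: "r > 0" "\<And>z. z \<in> coord_box p (y(i := t)) r \<Longrightarrow> \<bar>f z - f (y(i := t))\<bar> < e"
    using f[unfolded cont_on_iff[OF S]] line[of t] by blast
  show "\<forall>\<^sub>F s in at t. dist (f (y(i := s))) (f (y(i := t))) < e"
    unfolding eventually_at
  proof (intro exI[of _ r] conjI ballI impI r(1))
    fix s assume s: "s \<noteq> t \<and> dist s t < r"
    have "y(i := s) \<in> extensional {..<p}" using line S unfolding openin_coord_space_iff by blast
    then have "y(i := s) \<in> coord_box p (y(i := t)) r"
      using s r(1) by (auto simp: mem_coord_box dist_real_def)
    from r(2)[OF this] show "dist (f (y(i := s))) (f (y(i := t))) < e" by (simp add: dist_real_def)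
  qed
qed

lemma compactin_bounded_image:
  fixes f :: "'b \<Rightarrow> real"
  assumes "compactin X K" "continuous_map (subtopology X S) euclideanreal f" "K \<subseteq> S"
  shows "\<exists>b. \<forall>x\<in>K. \<bar>f x\<bar> \<le> b"
proof -
  have "compactin (subtopology X S) K" using assms by (simp add: compactin_subtopology)
  from image_compactin[OF this assms(2)] have "compact (f ` K)" by simp
  then have "bounded (f ` K)" by (rule compact_imp_bounded)
  then show ?thesis by (auto simp: bounded_iff)
qed

lemma compactin_coord_subset_box:
  assumes "compactin (coord_space p) K"
  shows "\<exists>R>0. K \<subseteq> coord_box p (\<lambda>_. 0) R"
proof -
  have "\<exists>b. \<forall>y\<in>K. \<bar>y i\<bar> \<le> b" if "i < p" for i
    using compactin_bounded_image[OF assms cont_on_coord[OF that, of K]] by simp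
  then obtain b where b: "\<And>i y. i < p \<Longrightarrow> y \<in> K \<Longrightarrow> \<bar>y i\<bar> \<le> b i" by metis
  define R where "R = 1 + (\<Sum>i<p. \<bar>b i\<bar>)"
  have "\<bar>b i\<bar> \<le> (\<Sum>i<p. \<bar>b i\<bar>)" if "i < p" for i
    using that by (intro member_le_sum) auto
  then have "\<bar>y i\<bar> < R" if "i < p" "y \<in> K" for i y using b[OF that] that(1) unfolding R_def by fastforce
  moreover have "K \<subseteq> extensional {..<p}" using compactin_subset_topspace[OF assms] by simp
  moreover have "R > 0" unfolding R_def by (intro add_pos_nonneg sum_nonneg) auto
  ultimately show ?thesis by (intro exI[of _ R]) (auto simp: mem_coord_box)
qed

lemma openin_extensional: "openin (coord_space p) (extensional {..<p})"
  using openin_topspace[of "coord_space p"] by simp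

lemma compactin_closed_box: "compactin (coord_space p) (PiE {..<p} (\<lambda>_. {-R..R}))"
  unfolding coord_space_def by (subst compactin_PiE) auto

text \<open>By Fubini the integral over coordinate \<open>i\<close> may be taken first; on each line
  it is an increment of \<open>u\<close> between two points outside the cube.\<close>

lemma integral_partial_eq_0_box:
  assumes u: "has_partials p (extensional {..<p}) u D"
    and R: "R > 0" and vanish: "\<And>y. y \<in> extensional {..<p} \<Longrightarrow> y \<notin> coord_box p (\<lambda>_. 0) R \<Longrightarrow> u y = 0"
    and i: "i < p"
  shows "integrable (coord_lebesgue p) (D i) \<and> (\<integral>y. D i y \<partial>coord_lebesgue p) = 0"
proof -
  let ?E = "extensional {..<p}" and ?B = "coord_box p (\<lambda>_. 0) (R + 1)"
  note E = openin_extensional[of p]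
  \<comment> \<open>The margin 1 leaves room to move: outside the larger cube \<open>u\<close>
    vanishes on a whole piece of the coordinate line around \<open>y\<close>, and so does its
    derivative.\<close>
  have D0: "D i y = 0" if y: "y \<in> ?E" "y \<notin> ?B" for y
  proof -
    obtain j where j: "j < p" "\<bar>y j\<bar> \<ge> R + 1" using y by (auto simp: mem_coord_box not_less)
    have "\<forall>\<^sub>F t in nhds (y i). u (y(i := t)) = 0"
      unfolding eventually_nhds_metric
    proof (intro exI[of _ 1] conjI allI impI)
      fix t assume "dist t (y i) < 1"
      then have "\<bar>(y(i := t)) j\<bar> \<ge> R" using j R by (auto simp: dist_real_def)
      then have "y(i := t) \<notin> coord_box p (\<lambda>_. 0) R" using j(1) unfolding mem_coord_box by fastforce
      then show "u (y(i := t)) = 0" using y i by (intro vanish extensional_fun_upd_lt)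
    qed simp
    from DERIV_cong_ev[OF refl this refl] have "((\<lambda>t. u (y(i := t))) has_real_derivative 0) (at (y i))" by simp
    with has_partials_deriv[OF u i y(1)] show ?thesis by (rule DERIV_unique)
  qed
  have contD: "cont_on p ?E (D i)" by (rule has_partials_cont_deriv[OF u i])
  have "continuous_map (coord_space p) euclideanreal (D i)"
    using contD subtopology_topspace[of "coord_space p"] by simp
  then have meas: "D i \<in> borel_measurable (coord_lebesgue p)"
    by (rule continuous_map_borel_measurable) (auto intro: openin_coord_sets)
  obtain b where b: "\<And>y. y \<in> PiE {..<p} (\<lambda>_. {-(R+1)..R+1}) \<Longrightarrow> \<bar>D i y\<bar> \<le> b"
    using compactin_bounded_image[OF compactin_closed_box[of p "R+1"] contD] by (auto simp: PiE_def)
  have bound: "\<bar>D i y\<bar> \<le> \<bar>b\<bar> * indicator ?B y" if y: "y \<in> ?E" for y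
  proof (cases "y \<in> ?B")
    case True
    then have "y \<in> PiE {..<p} (\<lambda>_. {-(R+1)..R+1})"
      by (auto simp: mem_coord_box PiE_iff abs_less_iff less_imp_le)
    from b[OF this] True show ?thesis by simp
  qed (use D0[OF y] in simp)
  have int: "integrable (coord_lebesgue p) (D i)"
  proof (rule Bochner_Integration.integrable_bound)
    show "integrable (coord_lebesgue p) (\<lambda>y. \<bar>b\<bar> * indicator ?B y :: real)"
      using sets_coord_box emeasure_coord_box[of "R+1" p "\<lambda>_. 0"] R
      by (intro integrable_mult_right integrable_real_indicator) auto
    show "AE y in coord_lebesgue p. norm (D i y) \<le> norm (\<bar>b\<bar> * indicator ?B y :: real)"
      using bound by (intro AE_I2) auto
  qed (rule meas)
  let ?I = "{..<p} - {i}"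
  have insert: "{..<p} = insert i ?I" using i by auto
  have "(\<integral>y. D i y \<partial>coord_lebesgue p) = (\<integral>x. (\<integral>t. D i (x(i := t)) \<partial>lborel) \<partial>PiM ?I (\<lambda>_. lborel))"
    unfolding coord_lebesgue_def
    by (subst insert, rule lborel_family.product_integral_insert)
       (use int insert in \<open>auto simp: coord_lebesgue_def insert_absorb\<close>)
  also have "\<dots> = (\<integral>x. 0 \<partial>PiM ?I (\<lambda>_. lborel :: real measure))"
  proof (rule Bochner_Integration.integral_cong[OF refl])
    fix x assume "x \<in> space (PiM ?I (\<lambda>_. lborel :: real measure))"
    then have line: "x(i := t) \<in> ?E" for t
      using i by (auto simp: space_PiM PiE_def extensional_def)
    have g: "((\<lambda>t. u (x(i := t))) has_real_derivative D i (x(i := t))) (at t)" for t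
      using has_partials_deriv[OF u i line[of t]] by simp
    have "(\<integral>t. D i (x(i := t)) \<partial>lborel) = (\<integral>t. D i (x(i := t)) * indicator {-(R+1)..R+1} t \<partial>lborel)"
    proof (intro Bochner_Integration.integral_cong refl)
      fix t
      have "x(i := t) \<notin> ?B" if "t \<notin> {-(R+1)..R+1}"
        using that i by (auto simp: mem_coord_box abs_less_iff intro!: exI[of _ i])
      then show "D i (x(i := t)) = D i (x(i := t)) * indicator {-(R+1)..R+1} t"
        using D0[OF line, of t] by (auto simp: indicator_def simp del: atLeastAtMost_iff)
    qed
    also have "\<dots> = u (x(i := R+1)) - u (x(i := -(R+1)))"
      by (rule integral_FTC_Icc_real[where F = "\<lambda>t. u (x(i := t))"])
         (use R g cont_on_line[OF contD E line i] in simp_all)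
    also have "\<dots> = 0"
    proof -
      have "x(i := R+1) \<notin> coord_box p (\<lambda>_. 0) R" "x(i := -(R+1)) \<notin> coord_box p (\<lambda>_. 0) R"
        using i R by (auto simp: mem_coord_box intro!: exI[of _ i])
      then show ?thesis using vanish[OF line] by simp
    qed
    finally show "(\<integral>t. D i (x(i := t)) \<partial>lborel) = 0" .
  qed
  finally show ?thesis using int by simp
qed

lemma has_partials_vanish:
  assumes u: "has_partials p S u D" and U: "openin (coord_space p) U" "U \<subseteq> S"
    and 0: "\<And>y. y \<in> U \<Longrightarrow> u y = 0" and "i < p" "y \<in> U"
  shows "D i y = 0"
proof -
  have "has_partials p U u (\<lambda>_ _. 0)"
    using has_partials_cong[OF has_partials_const[of p U 0] U(1), of u] 0 by simp
  then show ?thesis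
    using DERIV_unique has_partials_deriv[OF u \<open>i < p\<close>, of y] has_partials_deriv \<open>i < p\<close> \<open>y \<in> U\<close> U(2) by blast
qed

lemma Hausdorff_coord_space: "Hausdorff_space (coord_space p)"
  unfolding coord_space_def by (simp add: Hausdorff_space_product_topology)

text \<open>\<open>S\<close> and the complement of \<open>K\<close> form an open cover, since a
  compact set in a Hausdorff space is closed. On the overlap \<open>u\<close> vanishes, and with it
  \<open>D\<close>.\<close>

lemma has_partials_extend_zero:
  assumes u: "has_partials p S u D" and S: "openin (coord_space p) S"
    and K: "compactin (coord_space p) K" "K \<subseteq> S" and 0: "\<And>y. y \<in> S - K \<Longrightarrow> u y = 0"
  shows "has_partials p (extensional {..<p}) (\<lambda>y. if y \<in> S then u y else 0) (\<lambda>i y. if y \<in> S then D i y else 0)"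
    (is "has_partials p ?E ?u ?D")
proof (rule has_partials_local[OF openin_extensional])
  fix y assume y: "y \<in> ?E"
  show "\<exists>U. openin (coord_space p) U \<and> y \<in> U \<and> U \<subseteq> ?E \<and> has_partials p U ?u ?D"
  proof (cases "y \<in> S")
    case True
    have "has_partials p S ?u ?D"
      by (rule has_partials_D_cong[OF has_partials_cong[OF u S]]) auto
    moreover have "S \<subseteq> ?E" using S openin_coord_space_iff by blast
    ultimately show ?thesis using S True by blast
  next
    case False
    have "closedin (coord_space p) K"
      by (rule compactin_imp_closedin[OF Hausdorff_coord_space K(1)])
    then have U: "openin (coord_space p) (?E - K)" by (simp add: closedin_def)
    have "D i z = 0" if "i < p" "z \<in> (?E - K) \<inter> S" for i z
      using that 0 by (intro has_partials_vanish[OF u openin_Int[OF U S]]) auto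
    then have "has_partials p (?E - K) ?u ?D"
      by (intro has_partials_D_cong[OF has_partials_cong[OF has_partials_const[of p _ 0] U]]) (use 0 in auto)
    then show ?thesis using U y False K(2) by (intro exI[of _ "?E - K"]) auto
  qed
qed

text \<open>Extended by zero, \<open>u\<close> leaves no boundary term at the edge of
  \<open>S\<close>, so the statement for the whole coordinate space applies.\<close>

lemma integral_partial_eq_0:
  assumes u: "has_partials p S u D" and S: "openin (coord_space p) S"
    and K: "compactin (coord_space p) K" "K \<subseteq> S" and 0: "\<And>y. y \<in> S - K \<Longrightarrow> u y = 0"
    and i: "i < p"
  shows "integrable (restrict_space (coord_lebesgue p) S) (D i)"
    and "(\<integral>y. D i y \<partial>restrict_space (coord_lebesgue p) S) = 0"
proof -
  obtain R where R: "R > 0" "K \<subseteq> coord_box p (\<lambda>_. 0) R" using compactin_coord_subset_box[OF K(1)] by blast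
  have *: "integrable (coord_lebesgue p) (\<lambda>y. if y \<in> S then D i y else 0) \<and>
      (\<integral>y. (if y \<in> S then D i y else 0) \<partial>coord_lebesgue p) = 0"
    by (rule integral_partial_eq_0_box[OF has_partials_extend_zero[OF u S K 0] R(1) _ i]) (use R 0 in auto)
  have eq: "(\<lambda>y. if y \<in> S then D i y else 0) = (\<lambda>y. indicator S y *\<^sub>R D i y)" by (auto simp: indicator_def)
  have "S \<inter> space (coord_lebesgue p) \<in> sets (coord_lebesgue p)"
    using sets.Int[OF openin_coord_sets[OF S] sets.top] by simp
  with * show "integrable (restrict_space (coord_lebesgue p) S) (D i)"
    "(\<integral>y. D i y \<partial>restrict_space (coord_lebesgue p) S) = 0"
    unfolding eq by (simp_all add: integrable_restrict_space integral_restrict_space)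
qed

section \<open>Positive definite matrices of continuously differentiable functions\<close>

definition C1_on :: "nat \<Rightarrow> (nat \<Rightarrow> real) set \<Rightarrow> ((nat \<Rightarrow> real) \<Rightarrow> real) \<Rightarrow> bool" where
  "C1_on p S f \<longleftrightarrow> (\<exists>D. has_partials p S f D)"

lemma C1_onI: "has_partials p S f D \<Longrightarrow> C1_on p S f"
  unfolding C1_on_def by (rule exI)

lemma C1_on_iff: "C1_on p S f \<longleftrightarrow> has_partials p S f (\<lambda>i. partial i f)"
proof
  assume "C1_on p S f"
  then obtain D where D: "has_partials p S f D" unfolding C1_on_def by (rule exE)
  show "has_partials p S f (\<lambda>i. partial i f)"
    by (rule has_partials_D_cong[OF D]) (simp add: has_partials_partial[OF D])
qed (simp add: C1_on_def exI[of "has_partials p S f"])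

lemma C1_on_Ck: "Ck_on p (Suc 0) S f \<longleftrightarrow> C1_on p S f"
  unfolding C1_on_iff using Ck_on_imp_has_partials[of p 0 S f] has_partials_imp_C1[of p S f] by auto

lemma C1_on_const: "C1_on p S (\<lambda>_. c)"
  by (rule C1_onI[OF has_partials_const])

lemma C1_on_add: "C1_on p S f \<Longrightarrow> C1_on p S g \<Longrightarrow> C1_on p S (\<lambda>y. f y + g y)"
  unfolding C1_on_def using has_partials_add by blast

lemma C1_on_mult: "C1_on p S f \<Longrightarrow> C1_on p S g \<Longrightarrow> C1_on p S (\<lambda>y. f y * g y)"
  unfolding C1_on_def using has_partials_mult by blast

lemma C1_on_sum: "finite A \<Longrightarrow> (\<And>a. a \<in> A \<Longrightarrow> C1_on p S (f a)) \<Longrightarrow> C1_on p S (\<lambda>y. \<Sum>a\<in>A. f a y)"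
  by (induction rule: finite_induct) (simp_all add: C1_on_const C1_on_add)

lemma C1_on_prod: "finite A \<Longrightarrow> (\<And>a. a \<in> A \<Longrightarrow> C1_on p S (f a)) \<Longrightarrow> C1_on p S (\<lambda>y. \<Prod>a\<in>A. f a y)"
  by (induction rule: finite_induct) (simp_all add: C1_on_const C1_on_mult)

lemma C1_on_compose:
  assumes "C1_on p S f" "\<And>y. y \<in> S \<Longrightarrow> f y \<in> T" "S \<subseteq> extensional {..<p}"
    "\<And>t. t \<in> T \<Longrightarrow> (g has_real_derivative g' t) (at t)" "continuous_on T g'"
  shows "C1_on p S (\<lambda>y. g (f y))"
proof -
  obtain D where "has_partials p S f D" using assms(1) unfolding C1_on_def by blast
  from has_partials_compose[OF this assms(2,3,4,5)] show ?thesis by (intro C1_onI) auto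
qed

lemma C1_on_cong: "C1_on p S f \<Longrightarrow> openin (coord_space p) S \<Longrightarrow> (\<And>y. y \<in> S \<Longrightarrow> f y = g y) \<Longrightarrow> C1_on p S g"
  unfolding C1_on_def using has_partials_cong by blast

lemma C1_on_inverse:
  assumes "C1_on p S f" "\<And>y. y \<in> S \<Longrightarrow> f y > 0" "S \<subseteq> extensional {..<p}"
  shows "C1_on p S (\<lambda>y. inverse (f y))"
  by (rule C1_on_compose[OF assms(1), of "{0<..}" inverse "\<lambda>t. - (inverse t * inverse t)"])
     (use assms in \<open>auto intro!: derivative_eq_intros continuous_intros simp: power2_eq_square\<close>)

lemma C1_on_sqrt:
  assumes "C1_on p S f" "\<And>y. y \<in> S \<Longrightarrow> f y > 0" "S \<subseteq> extensional {..<p}"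
  shows "C1_on p S (\<lambda>y. sqrt (f y))"
  by (rule C1_on_compose[OF assms(1), of "{0<..}" sqrt "\<lambda>t. inverse (sqrt t) / 2"])
     (use assms in \<open>auto intro!: derivative_eq_intros continuous_intros\<close>)

lemma C1_on_det:
  assumes A: "\<And>y. y \<in> S \<Longrightarrow> A y \<in> carrier_mat n n" and S: "openin (coord_space p) S"
    and C1: "\<And>i j. i < n \<Longrightarrow> j < n \<Longrightarrow> C1_on p S (\<lambda>y. A y $$ (i, j))"
  shows "C1_on p S (\<lambda>y. Determinant.det (A y))"
proof (rule C1_on_cong[OF _ S])
  show "C1_on p S (\<lambda>y. \<Sum>q\<in>{q. q permutes {0..<n}}. signof q * (\<Prod>i=0..<n. A y $$ (i, q i)))"
    by (intro C1_on_sum C1_on_mult C1_on_const C1_on_prod C1 finite_permutations)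
       (auto dest: permutes_in_image)
  show "(\<Sum>q\<in>{q. q permutes {0..<n}}. signof q * (\<Prod>i=0..<n. A y $$ (i, q i))) = Determinant.det (A y)"
    if "y \<in> S" for y using det_def'[OF A[OF that]] by simp
qed

definition pos_def_mat :: "nat \<Rightarrow> real mat \<Rightarrow> bool" where
  "pos_def_mat n G \<longleftrightarrow> G \<in> carrier_mat n n \<and> (\<forall>i<n. \<forall>j<n. G $$ (i, j) = G $$ (j, i)) \<and>
     (\<forall>v. (\<exists>i<n. v i \<noteq> 0) \<longrightarrow> (\<Sum>i<n. \<Sum>j<n. G $$ (i, j) * v i * v j) > 0)"

text \<open>A nonzero vector in the kernel would make the quadratic form vanish.\<close>

lemma pos_def_mat_det_neq_0:
  assumes "pos_def_mat n G"
  shows "Determinant.det G \<noteq> 0"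
proof
  assume "Determinant.det G = 0"
  moreover have G: "G \<in> carrier_mat n n" using assms by (simp add: pos_def_mat_def)
  ultimately obtain v where v: "v \<in> carrier_vec n" "v \<noteq> 0\<^sub>v n" "G *\<^sub>v v = 0\<^sub>v n"
    using det_0_iff_vec_prod_zero_field by blast
  have "\<exists>i<n. vec_index v i \<noteq> 0" using v(1,2) by (metis carrier_vecD eq_vecI index_zero_vec(1,2))
  then have "(\<Sum>i<n. \<Sum>j<n. G $$ (i, j) * vec_index v i * vec_index v j) > 0"
    using assms by (simp add: pos_def_mat_def)
  moreover have "(\<Sum>j<n. G $$ (i, j) * vec_index v i * vec_index v j) = 0" if "i < n" for i
  proof -
    have "vec_index (G *\<^sub>v v) i = (\<Sum>j<n. G $$ (i, j) * vec_index v j)"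
      using that G v(1) by (simp add: scalar_prod_def lessThan_atLeast0)
    then have "(\<Sum>j<n. G $$ (i, j) * vec_index v j) = 0" using v(3) that by simp
    then have "vec_index v i * (\<Sum>j<n. G $$ (i, j) * vec_index v j) = 0" by simp
    then show ?thesis by (simp add: sum_distrib_left mult_ac)
  qed
  ultimately show False by simp
qed

lemma pos_def_mat_det_pos:
  assumes G: "pos_def_mat n G"
  shows "Determinant.det G > 0"
proof (rule ccontr)
  \<comment> \<open>On the segment from \<open>G\<close> to the identity all matrices are positive definite, so \<open>det\<close> keeps its sign.\<close>
  define H where "H t = Matrix.mat n n (\<lambda>(i, j). t * (if i = j then 1 else 0) + (1 - t) * G $$ (i, j))" for t :: real
  have carrier: "H t \<in> carrier_mat n n" for t by (simp add: H_def)
  have entry: "continuous_on {0..1} (\<lambda>t. H t $$ (i, j))" if "i < n" "j < n" for i j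
    using that by (auto simp: H_def intro!: continuous_intros)
  have cont: "continuous_on {0..1} (\<lambda>t. Determinant.det (H t))"
    unfolding det_def'[OF carrier]
    by (intro continuous_on_sum continuous_on_mult continuous_on_const continuous_on_prod entry)
       (auto dest: permutes_in_image)
  assume "\<not> Determinant.det G > 0"
  moreover have "H 0 = G" using G by (intro eq_matI) (auto simp: H_def pos_def_mat_def)
  moreover have "H 1 = 1\<^sub>m n" by (intro eq_matI) (auto simp: H_def)
  ultimately obtain t where t: "0 \<le> t" "t \<le> 1" "Determinant.det (H t) = 0"
    using IVT'[OF _ _ _ cont, of 0] by auto
  have "pos_def_mat n (H t)"
    unfolding pos_def_mat_def
  proof (intro conjI carrier allI impI)
    show "H t $$ (i, j) = H t $$ (j, i)" if "i < n" "j < n" for i j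
      using G that by (simp add: H_def pos_def_mat_def)
    fix v :: "nat \<Rightarrow> real" assume v: "\<exists>i<n. v i \<noteq> 0"
    have "(\<Sum>i<n. \<Sum>j<n. H t $$ (i, j) * v i * v j) =
        (\<Sum>i<n. \<Sum>j<n. (if i = j then t * v i * v i else 0) + (1 - t) * (G $$ (i, j) * v i * v j))"
      by (intro sum.cong refl) (auto simp: H_def algebra_simps)
    also have "\<dots> = t * (\<Sum>i<n. v i * v i) + (1 - t) * (\<Sum>i<n. \<Sum>j<n. G $$ (i, j) * v i * v j)"
      by (simp add: sum.distrib sum_distrib_left mult_ac)
    also have "\<dots> > 0"
    proof -
      have a: "(\<Sum>i<n. v i * v i) > 0"
        using v by (auto intro!: sum_pos2 simp: zero_less_mult_iff linorder_neq_iff)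
      have b: "(\<Sum>i<n. \<Sum>j<n. G $$ (i, j) * v i * v j) > 0"
        using v G by (simp add: pos_def_mat_def)
      show ?thesis
      proof (cases "t = 0")
        case False
        then show ?thesis using t a b by (intro add_pos_nonneg mult_pos_pos mult_nonneg_nonneg) auto
      qed (use b in simp)
    qed
    finally show "(\<Sum>i<n. \<Sum>j<n. H t $$ (i, j) * v i * v j) > 0" .
  qed
  then show False using pos_def_mat_det_neq_0 t(3) by blast
qed

text \<open>The cofactor formula is the form that shows differentiability of the inverse; the two
  sum formulas are the contractions used for gradients.\<close>

lemma pos_def_mat_inverse:
  assumes G: "pos_def_mat n G"
  defines "B \<equiv> the (mat_inverse G)"
  shows "B \<in> carrier_mat n n" "G * B = 1\<^sub>m n" "B * G = 1\<^sub>m n"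
    and "i < n \<Longrightarrow> j < n \<Longrightarrow> B $$ (i, j) = inverse (Determinant.det G) * cofactor G j i"
    and "i < n \<Longrightarrow> j < n \<Longrightarrow> (\<Sum>k<n. G $$ (i, k) * B $$ (k, j)) = (if i = j then 1 else 0)"
    and "i < n \<Longrightarrow> j < n \<Longrightarrow> (\<Sum>k<n. B $$ (i, k) * G $$ (k, j)) = (if i = j then 1 else 0)"
proof -
  have C: "G \<in> carrier_mat n n" using G by (simp add: pos_def_mat_def)
  \<comment> \<open>Instantiating \<open>b\<close> makes both facts speak about the same record of
    the matrix ring.\<close>
  have "mat_inverse G \<noteq> None"
    using mat_inverse(1)[OF C, where b = "()"]
      det_non_zero_imp_unit[OF C pos_def_mat_det_neq_0[OF G], where b = "()"] by blast
  then have "mat_inverse G = Some B" by (auto simp: B_def)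
  then show B: "B \<in> carrier_mat n n" and GB: "G * B = 1\<^sub>m n" and BG: "B * G = 1\<^sub>m n"
    using mat_inverse(2)[OF C] by auto
  have "adj_mat G = B * G * adj_mat G"
    using adj_mat(1)[OF C] by (simp add: BG)
  also have "\<dots> = B * (G * adj_mat G)" using B C adj_mat(1)[OF C] by simp
  also have "\<dots> = Determinant.det G \<cdot>\<^sub>m B" using B mult_smult_distrib[OF B, of "1\<^sub>m n" n] by (simp add: adj_mat(2)[OF C])
  finally have adj: "adj_mat G = Determinant.det G \<cdot>\<^sub>m B" .
  show "B $$ (i, j) = inverse (Determinant.det G) * cofactor G j i" if "i < n" "j < n"
  proof -
    have "cofactor G j i = adj_mat G $$ (i, j)" using C that by (simp add: adj_mat_def)
    also have "\<dots> = Determinant.det G * B $$ (i, j)" unfolding adj using B that by simp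
    finally show ?thesis using pos_def_mat_det_neq_0[OF G] by simp
  qed
  have *: "(P * Q) $$ (i, j) = (\<Sum>k<n. P $$ (i, k) * Q $$ (k, j))"
    if "P \<in> carrier_mat n n" "Q \<in> carrier_mat n n" "i < n" "j < n" for P Q :: "real mat" and i j
    using that by (simp add: scalar_prod_def lessThan_atLeast0)
  show "(\<Sum>k<n. G $$ (i, k) * B $$ (k, j)) = (if i = j then 1 else 0)" if "i < n" "j < n"
    using *[OF C B that] GB that by simp
  show "(\<Sum>k<n. B $$ (i, k) * G $$ (k, j)) = (if i = j then 1 else 0)" if "i < n" "j < n"
    using *[OF B C that] BG that by simp
qed

text \<open>By Cramer's rule an entry is a cofactor over the determinant. Both are polynomials in
  the entries of the matrix, and the determinant stays positive.\<close>

lemma C1_on_mat_inverse: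
  assumes G: "\<And>y. y \<in> S \<Longrightarrow> pos_def_mat n (G y)" and S: "openin (coord_space p) S"
    and C1: "\<And>i j. i < n \<Longrightarrow> j < n \<Longrightarrow> C1_on p S (\<lambda>y. G y $$ (i, j))"
    and ij: "i < n" "j < n"
  shows "C1_on p S (\<lambda>y. the (mat_inverse (G y)) $$ (i, j))"
proof (rule C1_on_cong[OF _ S])
  have C: "G y \<in> carrier_mat n n" if "y \<in> S" for y using G[OF that] by (simp add: pos_def_mat_def)
  have SE: "S \<subseteq> extensional {..<p}" using S openin_coord_space_iff by blast
  have det: "C1_on p S (\<lambda>y. Determinant.det (G y))"
    by (rule C1_on_det[OF C S C1])
  have "C1_on p S (\<lambda>y. Determinant.det (mat_delete (G y) j i))"
  proof (rule C1_on_det[OF mat_delete_carrier[OF C] S])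
    fix a b assume ab: "a < n - 1" "b < n - 1"
    \<comment> \<open>Deleting row \<open>j\<close> and column \<open>i\<close> shifts the later
      indices by one.\<close>
    define a' where "a' = (if a < j then a else Suc a)"
    define b' where "b' = (if b < i then b else Suc b)"
    have "a' < n" "b' < n" using ab by (auto simp: a'_def b'_def)
    from C1[OF this] show "C1_on p S (\<lambda>y. mat_delete (G y) j i $$ (a, b))"
      by (rule C1_on_cong[OF _ S]) (use ab carrier_matD[OF C] in \<open>simp add: mat_delete_def a'_def b'_def\<close>)
  qed
  then have "C1_on p S (\<lambda>y. cofactor (G y) j i)"
    unfolding cofactor_def by (intro C1_on_mult C1_on_const)
  then show "C1_on p S (\<lambda>y. inverse (Determinant.det (G y)) * cofactor (G y) j i)"
    by (intro C1_on_mult C1_on_inverse[OF det _ SE] pos_def_mat_det_pos[OF G])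
qed (simp add: pos_def_mat_inverse(4)[OF G ij])

section \<open>Differentiation on a manifold\<close>

locale riemannian_mfd =
  fixes M :: "('a, 'm) riemannian_scheme"
  assumes mfd: "smooth_manifold M" and metr: "riemannian_metric M" and volm: "riemannian_volume M"
begin

abbreviation "p \<equiv> mdim M"
abbreviation "T \<equiv> mtop M"
abbreviation "contM \<equiv> continuous_map T euclideanreal"
abbreviation "grad_inner f h \<equiv> rinner M (gradient M f) (gradient M h)"
abbreviation "img c \<equiv> snd c ` fst c"

lemma chart_open: "c \<in> matlas M \<Longrightarrow> openin T (fst c)"
  and img_open: "c \<in> matlas M \<Longrightarrow> openin (coord_space p) (img c)"
  and chart_homeo: "c \<in> matlas M \<Longrightarrow>
    homeomorphic_map (subtopology T (fst c)) (subtopology (coord_space p) (img c)) (snd c)"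
  using mfd unfolding smooth_manifold_def is_chart_def by blast+

lemma chart_subset: "c \<in> matlas M \<Longrightarrow> fst c \<subseteq> points M"
  by (rule openin_subset[OF chart_open])

lemma img_ext: "c \<in> matlas M \<Longrightarrow> img c \<subseteq> extensional {..<p}"
  using openin_subset[OF img_open] by simp

lemma chart_topspace: "c \<in> matlas M \<Longrightarrow> topspace (subtopology T (fst c)) = fst c"
  by (rule topspace_subtopology_subset[OF chart_subset])

lemma img_topspace: "c \<in> matlas M \<Longrightarrow> topspace (subtopology (coord_space p) (img c)) = img c"
  by (rule topspace_subtopology_subset) (simp only: topspace_coord_space img_ext)

lemma chart_inj: "c \<in> matlas M \<Longrightarrow> inj_on (snd c) (fst c)"
  using homeomorphic_imp_injective_map[OF chart_homeo] chart_topspace by metis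

lemma chart_inv_left: "c \<in> matlas M \<Longrightarrow> x \<in> fst c \<Longrightarrow> chart_inv c (snd c x) = x"
  unfolding chart_inv_def by (rule inv_into_f_f[OF chart_inj])

lemma chart_inv_in: "y \<in> img c \<Longrightarrow> chart_inv c y \<in> fst c"
  unfolding chart_inv_def by (rule inv_into_into)

lemma chart_inv_right: "y \<in> img c \<Longrightarrow> snd c (chart_inv c y) = y"
  unfolding chart_inv_def by (rule f_inv_into_f)

lemma chart_cont: "c \<in> matlas M \<Longrightarrow>
    continuous_map (subtopology T (fst c)) (subtopology (coord_space p) (img c)) (snd c)"
  by (rule homeomorphic_imp_continuous_map[OF chart_homeo])

lemma chart_image_open:
  assumes c: "c \<in> matlas M" and U: "openin T U" "U \<subseteq> fst c"
  shows "openin (coord_space p) (snd c ` U)"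
proof -
  have "openin (subtopology T (fst c)) U" using U openin_open_subtopology[OF chart_open[OF c]] by simp
  then have "openin (subtopology (coord_space p) (img c)) (snd c ` U)"
    using homeomorphic_imp_open_map[OF chart_homeo[OF c]] by (simp add: open_map_def)
  then show ?thesis using openin_open_subtopology[OF img_open[OF c]] by simp
qed

lemma chart_inv_image: "c \<in> matlas M \<Longrightarrow> U \<subseteq> fst c \<Longrightarrow> chart_inv c ` snd c ` U = U"
  by (force simp: chart_inv_left image_iff subset_iff)

lemma chart_inv_image_open:
  assumes c: "c \<in> matlas M" and V: "openin (coord_space p) V" "V \<subseteq> img c"
  shows "openin T (chart_inv c ` V)"
proof -
  have "openin (subtopology (coord_space p) (img c)) V"
    using V openin_open_subtopology[OF img_open[OF c]] by simp
  from openin_continuous_map_preimage[OF chart_cont[OF c] this]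
  have "openin T {x \<in> fst c. snd c x \<in> V}"
    unfolding chart_topspace[OF c] openin_open_subtopology[OF chart_open[OF c]] by (rule conjunct1)
  also have "{x \<in> fst c. snd c x \<in> V} = chart_inv c ` V"
  proof (intro equalityI subsetI)
    fix x assume "x \<in> {x \<in> fst c. snd c x \<in> V}"
    then show "x \<in> chart_inv c ` V"
      by (intro rev_image_eqI[of "snd c x"]) (simp_all add: chart_inv_left[OF c])
  next
    fix x assume "x \<in> chart_inv c ` V"
    then obtain y where y: "y \<in> V" "x = chart_inv c y" by blast
    with V(2) have "y \<in> img c" by blast
    with y show "x \<in> {x \<in> fst c. snd c x \<in> V}" by (simp add: chart_inv_in chart_inv_right)
  qed
  finally show ?thesis .
qed

lemma chart_inv_cont:
  assumes c: "c \<in> matlas M"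
  shows "continuous_map (subtopology (coord_space p) (img c)) (subtopology T (fst c)) (chart_inv c)"
  unfolding continuous_map
proof (intro conjI allI impI)
  show "chart_inv c ` topspace (subtopology (coord_space p) (img c)) \<subseteq> topspace (subtopology T (fst c))"
    unfolding img_topspace[OF c] chart_topspace[OF c] by (rule image_subsetI, rule chart_inv_in)
  fix U assume "openin (subtopology T (fst c)) U"
  then have U: "openin T U" "U \<subseteq> fst c" using openin_open_subtopology[OF chart_open[OF c]] by auto
  have "{y \<in> img c. chart_inv c y \<in> U} = snd c ` U"
  proof (intro equalityI subsetI)
    fix y assume "y \<in> {y \<in> img c. chart_inv c y \<in> U}"
    then show "y \<in> snd c ` U" by (intro rev_image_eqI[of "chart_inv c y"]) (simp_all add: chart_inv_right)
  next
    fix y assume "y \<in> snd c ` U"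
    then obtain x where x: "x \<in> U" "y = snd c x" by blast
    with U(2) have "x \<in> fst c" by blast
    with x show "y \<in> {y \<in> img c. chart_inv c y \<in> U}" by (simp add: chart_inv_left[OF c])
  qed
  then show "openin (subtopology (coord_space p) (img c))
      {y \<in> topspace (subtopology (coord_space p) (img c)). chart_inv c y \<in> U}"
    unfolding img_topspace[OF c] using chart_image_open[OF c U] U(2)
    by (simp add: openin_open_subtopology[OF img_open[OF c]] image_mono)
qed

lemma continuous_chart_iff:
  assumes c: "c \<in> matlas M"
  shows "continuous_map (subtopology T (fst c)) euclideanreal f \<longleftrightarrow> cont_on p (img c) (\<lambda>y. f (chart_inv c y))"
proof
  assume "continuous_map (subtopology T (fst c)) euclideanreal f"
  from continuous_map_compose[OF chart_inv_cont[OF c] this]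
  show "cont_on p (img c) (\<lambda>y. f (chart_inv c y))" by (simp add: o_def)
next
  assume "cont_on p (img c) (\<lambda>y. f (chart_inv c y))"
  from continuous_map_compose[OF chart_cont[OF c] this]
  have "continuous_map (subtopology T (fst c)) euclideanreal (\<lambda>x. f (chart_inv c (snd c x)))"
    by (simp add: o_def)
  then show "continuous_map (subtopology T (fst c)) euclideanreal f"
    by (rule continuous_map_eq) (simp add: chart_topspace[OF c] chart_inv_left[OF c])
qed

lemma chart_ex: "x \<in> points M \<Longrightarrow> \<exists>c\<in>matlas M. x \<in> fst c"
  using mfd unfolding smooth_manifold_def by blast

lemma chart_at: "x \<in> points M \<Longrightarrow> chart_at M x \<in> matlas M \<and> x \<in> fst (chart_at M x)"
  unfolding chart_at_def using chart_ex someI_ex[of "\<lambda>c. c \<in> matlas M \<and> x \<in> fst c"] by blast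

lemma continuous_map_charts:
  assumes "\<And>c. c \<in> matlas M \<Longrightarrow> continuous_map (subtopology T (fst c)) euclideanreal f"
  shows "contM f"
  unfolding continuous_map_real_iff
proof (intro ballI allI impI)
  fix x and e :: real assume "x \<in> points M" and e: "e > 0"
  then obtain c where c: "c \<in> matlas M" "x \<in> fst c" using chart_ex by blast
  obtain U where "openin (subtopology T (fst c)) U" "x \<in> U" "\<forall>y\<in>U. \<bar>f y - f x\<bar> < e"
    using assms[OF c(1)] c e unfolding continuous_map_real_iff chart_topspace[OF c(1)] by blast
  then show "\<exists>U. openin T U \<and> x \<in> U \<and> (\<forall>y\<in>U. \<bar>f y - f x\<bar> < e)"
    using openin_open_subtopology[OF chart_open[OF c(1)]] by blast
qed

section \<open>Continuously differentiable functions and the change of charts\<close>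

definition C1M :: "('a \<Rightarrow> real) \<Rightarrow> bool" where
  "C1M f \<longleftrightarrow> (\<forall>c\<in>matlas M. C1_on p (img c) (\<lambda>y. f (chart_inv c y)))"

lemma C1M_iff: "Ck_manifold M 1 f \<longleftrightarrow> C1M f"
  unfolding Ck_manifold_def C1M_def One_nat_def C1_on_Ck ..

lemma coord_deriv_chart_inv:
  "y \<in> img c \<Longrightarrow> coord_deriv c i f (chart_inv c y) = partial i (\<lambda>y. f (chart_inv c y)) y"
  by (simp add: coord_deriv_def chart_inv_right)

lemma has_partials_chart:
  assumes "C1_on p (img c) (\<lambda>y. f (chart_inv c y))"
  shows "has_partials p (img c) (\<lambda>y. f (chart_inv c y)) (\<lambda>i y. coord_deriv c i f (chart_inv c y))"
  using assms unfolding C1_on_iff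
  by (rule has_partials_D_cong) (simp add: coord_deriv_chart_inv)

lemma coord_deriv_eqI:
  assumes "has_partials p S (\<lambda>y. f (chart_inv c y)) D" "snd c x \<in> S" "i < p"
  shows "coord_deriv c i f x = D i (snd c x)"
  unfolding coord_deriv_def by (rule has_partials_partial[OF assms(1,3,2)])

lemma C1M_chart: "C1M f \<Longrightarrow> c \<in> matlas M \<Longrightarrow>
  has_partials p (img c) (\<lambda>y. f (chart_inv c y)) (\<lambda>i y. coord_deriv c i f (chart_inv c y))"
  by (simp add: C1M_def has_partials_chart)

lemma C1M_continuous: "C1M f \<Longrightarrow> contM f"
  by (rule continuous_map_charts) (use has_partials_cont[OF C1M_chart] in \<open>simp add: continuous_chart_iff\<close>)

lemma transition_has_partials:
  assumes c: "c \<in> matlas M" and d: "d \<in> matlas M" and a: "a < p"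
  shows "has_partials p (snd c ` (fst c \<inter> fst d)) (\<lambda>y. snd d (chart_inv c y) a)
           (\<lambda>i y. coord_deriv c i (\<lambda>\<eta>. snd d \<eta> a) (chart_inv c y))"
proof -
  have "Ck_on p (Suc 0) (snd c ` (fst c \<inter> fst d)) (\<lambda>y. snd d (chart_inv c y) a)"
    using mfd c d a unfolding smooth_manifold_def by blast
  then have "has_partials p (snd c ` (fst c \<inter> fst d)) (\<lambda>y. snd d (chart_inv c y) a)
      (\<lambda>i. partial i (\<lambda>y. snd d (chart_inv c y) a))"
    by (rule Ck_on_imp_has_partials)
  then show ?thesis
    by (rule has_partials_D_cong) (auto simp: coord_deriv_def chart_inv_left[OF c])
qed

text \<open>In the chart \<open>c\<close> the function is its representation in \<open>d\<close>
  composed with the transition map, so this is the chain rule with the Jacobian of the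
  transition.\<close>

lemma has_partials_change_chart:
  assumes c: "c \<in> matlas M" and d: "d \<in> matlas M" and U: "openin T U" "U \<subseteq> fst c" "U \<subseteq> fst d"
    and f: "has_partials p (snd d ` U) (\<lambda>y. f (chart_inv d y)) D"
  shows "has_partials p (snd c ` U) (\<lambda>y. f (chart_inv c y))
    (\<lambda>i y. \<Sum>a<p. D a (snd d (chart_inv c y)) * coord_deriv c i (\<lambda>\<eta>. snd d \<eta> a) (chart_inv c y))"
proof (rule has_partials_cong)
  show op: "openin (coord_space p) (snd c ` U)" by (rule chart_image_open[OF c U(1,2)])
  show "has_partials p (snd c ` U) (\<lambda>y. f (chart_inv d (snd d (chart_inv c y))))
    (\<lambda>i y. \<Sum>a<p. D a (snd d (chart_inv c y)) * coord_deriv c i (\<lambda>\<eta>. snd d \<eta> a) (chart_inv c y))"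
  proof (rule has_partials_chain[OF f chart_image_open[OF d U(1,3)] op])
    show "has_partials p (snd c ` U) (\<lambda>y. snd d (chart_inv c y) a)
           (\<lambda>i y. coord_deriv c i (\<lambda>\<eta>. snd d \<eta> a) (chart_inv c y))" if "a < p" for a
      by (rule has_partials_subset[OF transition_has_partials[OF c d that]]) (use U in auto)
    show "snd d (chart_inv c y) \<in> snd d ` U" if "y \<in> snd c ` U" for y
      using that U(2) by (auto simp: chart_inv_left[OF c] subset_iff)
  qed
  show "f (chart_inv d (snd d (chart_inv c y))) = f (chart_inv c y)" if "y \<in> snd c ` U" for y
    using that U by (auto simp: chart_inv_left[OF c] chart_inv_left[OF d] subset_iff)
qed

lemma coord_deriv_change_chart:
  assumes c: "c \<in> matlas M" and d: "d \<in> matlas M" and x: "x \<in> fst c \<inter> fst d" and i: "i < p"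
    and f: "C1_on p (snd d ` (fst c \<inter> fst d)) (\<lambda>y. f (chart_inv d y))"
  shows "coord_deriv c i f x = (\<Sum>a<p. coord_deriv c i (\<lambda>\<eta>. snd d \<eta> a) x * coord_deriv d a f x)"
proof -
  have U: "openin T (fst c \<inter> fst d)" using c d chart_open by blast
  from f[unfolded C1_on_iff]
  have hp: "has_partials p (snd d ` (fst c \<inter> fst d)) (\<lambda>y. f (chart_inv d y))
      (\<lambda>i. partial i (\<lambda>y. f (chart_inv d y)))" .
  have "coord_deriv c i f x = (\<Sum>a<p. partial a (\<lambda>y. f (chart_inv d y)) (snd d (chart_inv c (snd c x))) *
      coord_deriv c i (\<lambda>\<eta>. snd d \<eta> a) (chart_inv c (snd c x)))"
    by (rule coord_deriv_eqI[OF has_partials_change_chart[OF c d U _ _ hp]]) (use x i in auto)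
  then show ?thesis using x by (simp add: chart_inv_left[OF c] coord_deriv_def[of d] mult.commute)
qed

text \<open>One chart around each point is enough because the transition maps are smooth. This
  serves functions that are built in a single chart, such as bump functions.\<close>

lemma C1M_localI:
  assumes "\<And>x. x \<in> points M \<Longrightarrow> \<exists>d U. d \<in> matlas M \<and> openin T U \<and> x \<in> U \<and> U \<subseteq> fst d \<and>
    C1_on p (snd d ` U) (\<lambda>y. f (chart_inv d y))"
  shows "C1M f"
  unfolding C1M_def
proof
  fix c assume c: "c \<in> matlas M"
  show "C1_on p (img c) (\<lambda>y. f (chart_inv c y))"
  proof (rule C1_onI, rule has_partials_local[OF img_open[OF c]])
    fix y assume y: "y \<in> img c"
    then have "chart_inv c y \<in> points M" using chart_inv_in[OF y] chart_subset[OF c] by blast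
    from assms[OF this] obtain d U where d: "d \<in> matlas M" and U: "openin T U" "chart_inv c y \<in> U" "U \<subseteq> fst d"
      and f: "C1_on p (snd d ` U) (\<lambda>y. f (chart_inv d y))"
      by blast
    let ?V = "U \<inter> fst c"
    have V: "openin T ?V" "?V \<subseteq> fst c" "?V \<subseteq> fst d" using U chart_open[OF c] by auto
    have "has_partials p (snd d ` ?V) (\<lambda>y. f (chart_inv d y)) (\<lambda>i. partial i (\<lambda>y. f (chart_inv d y)))"
      using f unfolding C1_on_iff by (rule has_partials_subset) auto
    from C1_onI[OF has_partials_change_chart[OF c d V this]]
    have "has_partials p (snd c ` ?V) (\<lambda>y. f (chart_inv c y)) (\<lambda>i. partial i (\<lambda>y. f (chart_inv c y)))"
      unfolding C1_on_iff .
    moreover have "y \<in> snd c ` ?V"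
      using y U(2) chart_inv_in[OF y] chart_inv_right[OF y] by (intro rev_image_eqI[of "chart_inv c y"]) auto
    ultimately show "\<exists>V. openin (coord_space p) V \<and> y \<in> V \<and> V \<subseteq> img c \<and>
        has_partials p V (\<lambda>y. f (chart_inv c y)) (\<lambda>i. partial i (\<lambda>y. f (chart_inv c y)))"
      using chart_image_open[OF c V(1,2)] by (intro exI[of _ "snd c ` ?V"]) auto
  qed
qed

lemma C1M_const: "C1M (\<lambda>_. k)"
  by (simp add: C1M_def C1_on_const)

lemma C1M_add: "C1M f \<Longrightarrow> C1M g \<Longrightarrow> C1M (\<lambda>x. f x + g x)"
  by (simp add: C1M_def C1_on_add)

lemma C1M_mult: "C1M f \<Longrightarrow> C1M g \<Longrightarrow> C1M (\<lambda>x. f x * g x)"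
  by (simp add: C1M_def C1_on_mult)

lemma C1M_sum: "finite A \<Longrightarrow> (\<And>a. a \<in> A \<Longrightarrow> C1M (f a)) \<Longrightarrow> C1M (\<lambda>x. \<Sum>a\<in>A. f a x)"
  by (simp add: C1M_def C1_on_sum)

lemma C1M_compose:
  assumes f: "C1M f" and fS: "\<And>x. x \<in> points M \<Longrightarrow> f x \<in> S"
    and g: "\<And>t. t \<in> S \<Longrightarrow> (g has_real_derivative g' t) (at t)" "continuous_on S g'"
  shows "C1M (\<lambda>x. g (f x))"
  unfolding C1M_def
proof
  fix c assume c: "c \<in> matlas M"
  show "C1_on p (img c) (\<lambda>y. g (f (chart_inv c y)))"
  proof (rule C1_on_compose[OF _ _ img_ext[OF c] g])
    show "C1_on p (img c) (\<lambda>y. f (chart_inv c y))" using f c by (simp add: C1M_def)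
    show "f (chart_inv c y) \<in> S" if "y \<in> img c" for y
      by (rule fS, rule subsetD[OF chart_subset[OF c]], rule chart_inv_in[OF that])
  qed
qed

lemma coord_deriv_mult:
  assumes "C1M f" "C1M g" "c \<in> matlas M" "x \<in> fst c" "i < p"
  shows "coord_deriv c i (\<lambda>x. f x * g x) x = coord_deriv c i f x * g x + f x * coord_deriv c i g x"
  using coord_deriv_eqI[OF has_partials_mult[OF C1M_chart[OF assms(1,3)] C1M_chart[OF assms(2,3)]], of x i] assms(4,5)
  by (simp add: chart_inv_left[OF assms(3)] mult.commute)

lemma coord_deriv_add:
  assumes "C1M f" "C1M g" "c \<in> matlas M" "x \<in> fst c" "i < p"
  shows "coord_deriv c i (\<lambda>x. f x + g x) x = coord_deriv c i f x + coord_deriv c i g x"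
  using coord_deriv_eqI[OF has_partials_add[OF C1M_chart[OF assms(1,3)] C1M_chart[OF assms(2,3)]], of x i] assms(4,5)
  by (simp add: chart_inv_left[OF assms(3)])

lemma coord_deriv_const: "x \<in> fst c \<Longrightarrow> i < p \<Longrightarrow> coord_deriv c i (\<lambda>_. k) x = 0"
  using coord_deriv_eqI[OF has_partials_const[of p "img c" k], of c x i] by simp

lemma coord_deriv_compose:
  assumes f: "C1M f" and fS: "\<And>x. x \<in> points M \<Longrightarrow> f x \<in> S"
    and g: "\<And>t. t \<in> S \<Longrightarrow> (g has_real_derivative g' t) (at t)" "continuous_on S g'"
    and c: "c \<in> matlas M" "x \<in> fst c" "i < p"
  shows "coord_deriv c i (\<lambda>x. g (f x)) x = g' (f x) * coord_deriv c i f x"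
proof -
  have "has_partials p (img c) (\<lambda>y. g (f (chart_inv c y)))
      (\<lambda>i y. g' (f (chart_inv c y)) * coord_deriv c i f (chart_inv c y))"
    by (rule has_partials_compose[OF C1M_chart[OF f c(1)] _ img_ext[OF c(1)] g])
       (rule fS, rule subsetD[OF chart_subset[OF c(1)]], rule chart_inv_in)
  from coord_deriv_eqI[OF this, of x i] c(2,3) show ?thesis by (simp add: chart_inv_left[OF c(1)])
qed

lemma coord_deriv_vanish:
  assumes f: "C1M f" and c: "c \<in> matlas M" and U: "openin T U" "x \<in> U" "x \<in> fst c"
    and 0: "\<And>\<eta>. \<eta> \<in> U \<Longrightarrow> f \<eta> = 0" and i: "i < p"
  shows "coord_deriv c i f x = 0"
proof -
  have V: "openin T (U \<inter> fst c)" using U chart_open[OF c] by blast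
  have "(\<lambda>i y. coord_deriv c i f (chart_inv c y)) i (snd c x) = 0"
    by (rule has_partials_vanish[OF C1M_chart[OF f c] chart_image_open[OF c V]])
       (use U 0 i in \<open>auto simp: chart_inv_left[OF c]\<close>)
  then show ?thesis using U by (simp add: chart_inv_left[OF c])
qed

end

section \<open>Gradient and Laplacian in charts\<close>

context riemannian_mfd
begin

lemma metric_pos_def: "c \<in> matlas M \<Longrightarrow> x \<in> fst c \<Longrightarrow> pos_def_mat p (metric M c x)"
  using metr unfolding riemannian_metric_def pos_def_mat_def by blast

lemma metric_C1:
  assumes "c \<in> matlas M" "i < p" "j < p"
  shows "C1_on p (img c) (\<lambda>y. metric M c (chart_inv c y) $$ (i, j))"
proof -
  have "Ck_on p (Suc 0) (img c) (\<lambda>y. metric M c (chart_inv c y) $$ (i, j))"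
    using metr assms unfolding riemannian_metric_def by blast
  then show ?thesis unfolding C1_on_Ck .
qed

lemma metric_change:
  assumes "c \<in> matlas M" "d \<in> matlas M" "x \<in> fst c \<inter> fst d" "i < p" "j < p"
  shows "metric M c x $$ (i, j) = (\<Sum>a<p. \<Sum>b<p. coord_deriv c i (\<lambda>\<eta>. snd d \<eta> a) x *
    coord_deriv c j (\<lambda>\<eta>. snd d \<eta> b) x * metric M d x $$ (a, b))"
  using metr assms unfolding riemannian_metric_def by blast

lemma vol_density_pos: "c \<in> matlas M \<Longrightarrow> x \<in> fst c \<Longrightarrow> vol_density M c x > 0"
  unfolding vol_density_def by (simp add: pos_def_mat_det_pos[OF metric_pos_def])

lemma vol_density_C1:
  assumes c: "c \<in> matlas M"
  shows "C1_on p (img c) (\<lambda>y. vol_density M c (chart_inv c y))"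
  unfolding vol_density_def
proof (rule C1_on_sqrt[OF C1_on_det[OF _ img_open[OF c] metric_C1[OF c]] _ img_ext[OF c]])
  fix y assume "y \<in> img c"
  from metric_pos_def[OF c chart_inv_in[OF this]]
  show "metric M c (chart_inv c y) \<in> carrier_mat p p" "0 < Determinant.det (metric M c (chart_inv c y))"
    by (simp_all add: pos_def_mat_def pos_def_mat_det_pos)
qed

text \<open>Lowering the index of the gradient gives back the differential. Together with the
  uniqueness statement below, this lets the gradient be handled as the solution of a linear system
  instead of through an inverse matrix.\<close>

lemma metric_gradient:
  assumes c: "c \<in> matlas M" "x \<in> fst c" and i: "i < p"
  shows "(\<Sum>k<p. metric M c x $$ (i, k) * gradient M h c x k) = coord_deriv c i h x"
proof -
  let ?G = "metric M c x" and ?B = "the (mat_inverse (metric M c x))" and ?h = "\<lambda>j. coord_deriv c j h x"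
  have "(\<Sum>k<p. ?G $$ (i, k) * gradient M h c x k) = (\<Sum>k<p. \<Sum>j<p. ?G $$ (i, k) * ?B $$ (k, j) * ?h j)"
    by (simp add: gradient_def sum_distrib_left mult.assoc)
  also have "\<dots> = (\<Sum>j<p. (\<Sum>k<p. ?G $$ (i, k) * ?B $$ (k, j)) * ?h j)"
    by (subst sum.swap) (simp add: sum_distrib_right)
  also have "\<dots> = (\<Sum>j<p. (if i = j then 1 else 0) * ?h j)"
    using pos_def_mat_inverse(5)[OF metric_pos_def[OF c] i] by (intro sum.cong refl) simp
  also have "\<dots> = ?h i" using i by (simp add: if_distrib[of "\<lambda>x. x * _"] cong: if_cong)
  finally show ?thesis .
qed

lemma gradient_unique:
  assumes c: "c \<in> matlas M" "x \<in> fst c" and i: "i < p"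
    and W: "\<And>i. i < p \<Longrightarrow> (\<Sum>k<p. metric M c x $$ (i, k) * W k) = coord_deriv c i h x"
  shows "gradient M h c x i = W i"
proof -
  let ?G = "metric M c x" and ?B = "the (mat_inverse (metric M c x))"
  have "gradient M h c x i = (\<Sum>j<p. ?B $$ (i, j) * (\<Sum>k<p. ?G $$ (j, k) * W k))"
    unfolding gradient_def by (intro sum.cong refl) (simp add: W)
  also have "\<dots> = (\<Sum>j<p. \<Sum>k<p. ?B $$ (i, j) * ?G $$ (j, k) * W k)"
    by (simp add: sum_distrib_left mult.assoc)
  also have "\<dots> = (\<Sum>k<p. (\<Sum>j<p. ?B $$ (i, j) * ?G $$ (j, k)) * W k)"
    by (subst sum.swap) (simp add: sum_distrib_right)
  also have "\<dots> = (\<Sum>k<p. (if i = k then 1 else 0) * W k)"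
    using pos_def_mat_inverse(6)[OF metric_pos_def[OF c] i] by (intro sum.cong refl) simp
  also have "\<dots> = W i" using i by (simp add: if_distrib[of "\<lambda>x. x * _"] cong: if_cong)
  finally show ?thesis .
qed

text \<open>The chain rule applied to the coordinate functions of \<open>d\<close> themselves: the
  Jacobians of the two transitions are inverse to each other.\<close>

lemma transition_inverse:
  assumes c: "c \<in> matlas M" and d: "d \<in> matlas M" and x: "x \<in> fst c \<inter> fst d" and ab: "a < p" "b < p"
  shows "(\<Sum>i<p. coord_deriv d b (\<lambda>\<eta>. snd c \<eta> i) x * coord_deriv c i (\<lambda>\<eta>. snd d \<eta> a) x) =
    (if b = a then 1 else 0)"
proof -
  have eq: "snd c ` (fst d \<inter> fst c) = snd c ` (fst c \<inter> fst d)" by (simp add: Int_commute)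
  have "coord_deriv d b (\<lambda>\<eta>. snd d \<eta> a) x =
    (\<Sum>i<p. coord_deriv d b (\<lambda>\<eta>. snd c \<eta> i) x * coord_deriv c i (\<lambda>\<eta>. snd d \<eta> a) x)"
    by (rule coord_deriv_change_chart[OF d c])
       (use x ab in \<open>auto simp: eq intro: C1_onI[OF transition_has_partials[OF c d]]\<close>)
  moreover have "coord_deriv d b (\<lambda>\<eta>. snd d \<eta> a) x = (if b = a then 1 else 0)"
  proof -
    have "has_partials p (img d) (\<lambda>y. snd d (chart_inv d y) a) (\<lambda>i y. if i = a then 1 else 0)"
      by (rule has_partials_cong[OF has_partials_coord[OF ab(1)] img_open[OF d]]) (simp only: chart_inv_right)
    from coord_deriv_eqI[OF this, of x b] x ab show ?thesis by simp
  qed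
  ultimately show ?thesis by simp
qed

lemma coord_deriv_C1M_change:
  assumes c: "c \<in> matlas M" and d: "d \<in> matlas M" and x: "x \<in> fst c \<inter> fst d" and i: "i < p" and f: "C1M f"
  shows "coord_deriv c i f x = (\<Sum>a<p. coord_deriv c i (\<lambda>\<eta>. snd d \<eta> a) x * coord_deriv d a f x)"
proof (rule coord_deriv_change_chart[OF c d x i])
  show "C1_on p (snd d ` (fst c \<inter> fst d)) (\<lambda>y. f (chart_inv d y))"
    by (rule C1_onI, rule has_partials_subset[OF C1M_chart[OF f d]]) auto
qed

text \<open>Uniqueness reduces the claim to a linear system for the transformed components
  \<open>W\<close>. Contracted with the Jacobian it becomes the system in the chart
  \<open>c\<close>, and the Jacobian is invertible.\<close>

lemma gradient_change:
  assumes c: "c \<in> matlas M" and d: "d \<in> matlas M" and x: "x \<in> fst c \<inter> fst d" and a: "a < p" and h: "C1M h"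
  shows "gradient M h d x a = (\<Sum>i<p. coord_deriv c i (\<lambda>\<eta>. snd d \<eta> a) x * gradient M h c x i)"
proof -
  \<comment> \<open>\<open>J\<close> is the Jacobian of the transition from \<open>c\<close> to
    \<open>d\<close> and \<open>K\<close> its inverse; \<open>V\<close> is the gradient in
    \<open>c\<close> and \<open>G\<close> the metric in \<open>d\<close>.\<close>
  define J where "J a i = coord_deriv c i (\<lambda>\<eta>. snd d \<eta> a) x" for a i
  define K where "K i b = coord_deriv d b (\<lambda>\<eta>. snd c \<eta> i) x" for i b
  define V where "V i = gradient M h c x i" for i
  define G where "G a b = metric M d x $$ (a, b)" for a b
  define W where "W a = (\<Sum>i<p. J a i * V i)" for a
  have "gradient M h d x a = W a"
  proof (rule gradient_unique[OF d _ a])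
    fix b assume b: "b < p"
    have *: "(\<Sum>a<p. J a i * (\<Sum>k<p. G a k * W k)) = (\<Sum>a<p. J a i * coord_deriv d a h x)" if i: "i < p" for i
    proof -
      have "(\<Sum>a<p. J a i * (\<Sum>k<p. G a k * W k)) = (\<Sum>a<p. \<Sum>k<p. \<Sum>j<p. J a i * J k j * G a k * V j)"
        by (simp add: W_def sum_distrib_left mult_ac)
      also have "\<dots> = (\<Sum>a<p. \<Sum>j<p. \<Sum>k<p. J a i * J k j * G a k * V j)"
        by (intro sum.cong refl sum.swap)
      also have "\<dots> = (\<Sum>j<p. \<Sum>a<p. \<Sum>k<p. J a i * J k j * G a k * V j)"
        by (rule sum.swap)
      also have "\<dots> = (\<Sum>j<p. metric M c x $$ (i, j) * V j)"
        unfolding J_def G_def using metric_change[OF c d x i] by (intro sum.cong refl) (simp add: sum_distrib_right)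
      also have "\<dots> = coord_deriv c i h x"
        unfolding V_def using x by (intro metric_gradient[OF c _ i]) auto
      also have "\<dots> = (\<Sum>a<p. J a i * coord_deriv d a h x)"
        unfolding J_def by (rule coord_deriv_C1M_change[OF c d x i h])
      finally show ?thesis .
    qed
    have inv: "(\<Sum>i<p. K i b * (\<Sum>a<p. J a i * u a)) = u b" for u
    proof -
      have "(\<Sum>i<p. K i b * (\<Sum>a<p. J a i * u a)) = (\<Sum>i<p. \<Sum>a<p. K i b * J a i * u a)"
        by (simp add: sum_distrib_left mult_ac)
      also have "\<dots> = (\<Sum>a<p. (\<Sum>i<p. K i b * J a i) * u a)"
        by (subst sum.swap) (simp add: sum_distrib_right)
      also have "\<dots> = (\<Sum>a<p. (if b = a then 1 else 0) * u a)"
        unfolding K_def J_def using transition_inverse[OF c d x _ b] by (intro sum.cong refl) simp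
      also have "\<dots> = u b" using b by (simp add: if_distrib[of "\<lambda>x. x * _"] cong: if_cong)
      finally show ?thesis .
    qed
    have "(\<Sum>k<p. G b k * W k) = (\<Sum>i<p. K i b * (\<Sum>a<p. J a i * (\<Sum>k<p. G a k * W k)))"
      by (rule inv[symmetric])
    also have "\<dots> = (\<Sum>i<p. K i b * (\<Sum>a<p. J a i * coord_deriv d a h x))"
      by (intro sum.cong refl) (simp add: *)
    also have "\<dots> = coord_deriv d b h x" by (rule inv)
    finally show "(\<Sum>k<p. metric M d x $$ (b, k) * W k) = coord_deriv d b h x" by (simp add: G_def)
  qed (use x in auto)
  then show ?thesis by (simp add: W_def J_def V_def)
qed

text \<open>Lowering one of the two gradients in the chart at \<open>x\<close> leaves a differential
  paired with a vector. The Jacobian that transforms the vector to \<open>c\<close> is then absorbed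
  by the differential.\<close>

lemma rinner_chart:
  assumes c: "c \<in> matlas M" and x: "x \<in> fst c" and f: "C1M f" and h: "C1M h"
  shows "grad_inner f h x = (\<Sum>i<p. coord_deriv c i f x * gradient M h c x i)"
proof -
  define d where "d = chart_at M x"
  have d: "d \<in> matlas M" and xd: "x \<in> fst d"
    using chart_at[of x] chart_subset[OF c] x unfolding d_def by auto
  have sym: "metric M d x $$ (i, j) = metric M d x $$ (j, i)" if "i < p" "j < p" for i j
    using metric_pos_def[OF d xd] that by (simp add: pos_def_mat_def)
  have "grad_inner f h x =
      (\<Sum>i<p. \<Sum>j<p. metric M d x $$ (i, j) * gradient M f d x i * gradient M h d x j)"
    by (simp add: rinner_def d_def[symmetric] Let_def)
  also have "\<dots> = (\<Sum>j<p. (\<Sum>i<p. metric M d x $$ (j, i) * gradient M f d x i) * gradient M h d x j)"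
    by (subst sum.swap) (simp add: sum_distrib_right sym)
  also have "\<dots> = (\<Sum>j<p. coord_deriv d j f x * gradient M h d x j)"
    by (intro sum.cong refl) (simp add: metric_gradient[OF d xd])
  also have "\<dots> = (\<Sum>j<p. \<Sum>i<p. coord_deriv d j f x * coord_deriv c i (\<lambda>\<eta>. snd d \<eta> j) x * gradient M h c x i)"
    using x xd by (intro sum.cong refl) (simp add: gradient_change[OF c d _ _ h] sum_distrib_left mult_ac)
  also have "\<dots> = (\<Sum>i<p. \<Sum>j<p. coord_deriv d j f x * coord_deriv c i (\<lambda>\<eta>. snd d \<eta> j) x * gradient M h c x i)"
    by (rule sum.swap)
  also have "\<dots> = (\<Sum>i<p. coord_deriv c i f x * gradient M h c x i)"
    using x xd by (intro sum.cong refl) (simp add: coord_deriv_C1M_change[OF c d _ _ f] sum_distrib_left sum_distrib_right mult_ac)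
  finally show ?thesis .
qed

lemma metric_inverse_C1:
  assumes c: "c \<in> matlas M" and ij: "i < p" "j < p"
  shows "C1_on p (img c) (\<lambda>y. the (mat_inverse (metric M c (chart_inv c y))) $$ (i, j))"
  by (rule C1_on_mat_inverse[OF metric_pos_def[OF c chart_inv_in] img_open[OF c] metric_C1[OF c] ij])

lemma C1_on_cont: "C1_on q S f \<Longrightarrow> cont_on q S f"
  unfolding C1_on_iff by (rule has_partials_cont)

lemma gradient_cont:
  assumes c: "c \<in> matlas M" and i: "i < p" and h: "C1M h"
  shows "cont_on p (img c) (\<lambda>y. gradient M h c (chart_inv c y) i)"
  unfolding gradient_def
  by (intro continuous_map_sum continuous_map_real_mult C1_on_cont[OF metric_inverse_C1[OF c i]]
      has_partials_cont_deriv[OF C1M_chart[OF h c]]) auto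

lemma rinner_continuous:
  assumes f: "C1M f" and h: "C1M h"
  shows "contM (grad_inner f h)"
proof (rule continuous_map_charts)
  fix c assume c: "c \<in> matlas M"
  have "cont_on p (img c) (\<lambda>y. \<Sum>i<p. coord_deriv c i f (chart_inv c y) * gradient M h c (chart_inv c y) i)"
    by (intro continuous_map_sum continuous_map_real_mult gradient_cont[OF c _ h]
        has_partials_cont_deriv[OF C1M_chart[OF f c]]) auto
  then show "continuous_map (subtopology T (fst c)) euclideanreal (grad_inner f h)"
    unfolding continuous_chart_iff[OF c]
    by (rule cont_on_cong) (simp only: rinner_chart[OF c chart_inv_in f h])
qed

definition C2M :: "('a \<Rightarrow> real) \<Rightarrow> bool" where
  "C2M h \<longleftrightarrow> Ck_manifold M 2 h"

lemma C2M_imp_C1M: 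
  assumes "C2M h" shows "C1M h"
  unfolding C1M_def
proof
  fix c assume "c \<in> matlas M"
  then have "Ck_on p (Suc (Suc 0)) (img c) (\<lambda>y. h (chart_inv c y))"
    using assms unfolding C2M_def Ck_manifold_def by (simp only: numeral_2_eq_2)
  then show "C1_on p (img c) (\<lambda>y. h (chart_inv c y))"
    unfolding C1_on_iff by (rule Ck_on_imp_has_partials)
qed

lemma gradient_C1:
  assumes c: "c \<in> matlas M" and i: "i < p" and h: "C2M h"
  shows "C1_on p (img c) (\<lambda>y. gradient M h c (chart_inv c y) i)"
  unfolding gradient_def
proof (rule C1_on_sum, simp, rule C1_on_mult[OF metric_inverse_C1[OF c i]])
  fix j assume j: "j \<in> {..<p}"
  then show "j < p" by simp
  have "Ck_on p (Suc (Suc 0)) (img c) (\<lambda>y. h (chart_inv c y))"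
    using h c unfolding C2M_def Ck_manifold_def by (simp only: numeral_2_eq_2)
  then have "Ck_on p (Suc 0) (img c) (partial j (\<lambda>y. h (chart_inv c y)))"
    using j unfolding Ck_on.simps(2)[of p "Suc 0"] by simp
  then have "C1_on p (img c) (partial j (\<lambda>y. h (chart_inv c y)))" unfolding C1_on_Ck .
  then show "C1_on p (img c) (\<lambda>y. coord_deriv c j h (chart_inv c y))"
    by (rule C1_on_cong[OF _ img_open[OF c]]) (simp only: coord_deriv_chart_inv)
qed

text \<open>The Laplacian in a prescribed chart; \<open>laplacian\<close> is this expression in the
  chart chosen at the point. Until chart independence is established, only the version with a fixed
  chart is known to be continuous.\<close>

definition chart_laplacian :: "'a chart \<Rightarrow> ('a \<Rightarrow> real) \<Rightarrow> 'a \<Rightarrow> real" where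
  "chart_laplacian c h x =
    (\<Sum>i<p. coord_deriv c i (\<lambda>\<eta>. vol_density M c \<eta> * gradient M h c \<eta> i) x) / vol_density M c x"

lemma laplacian_chart_at: "laplacian M h x = chart_laplacian (chart_at M x) h x"
  by (simp add: laplacian_def divergence_def chart_laplacian_def Let_def)

lemma flux_has_partials:
  assumes c: "c \<in> matlas M" and i: "i < p" and h: "C2M h"
  shows "has_partials p (img c) (\<lambda>y. vol_density M c (chart_inv c y) * gradient M h c (chart_inv c y) i)
    (\<lambda>j y. coord_deriv c j (\<lambda>\<eta>. vol_density M c \<eta> * gradient M h c \<eta> i) (chart_inv c y))"
  by (rule has_partials_chart[OF C1_on_mult[OF vol_density_C1[OF c] gradient_C1[OF c i h]]])

lemma chart_laplacian_cont:
  assumes c: "c \<in> matlas M" and h: "C2M h"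
  shows "cont_on p (img c) (\<lambda>y. chart_laplacian c h (chart_inv c y))"
  unfolding chart_laplacian_def
proof (intro continuous_map_real_divide continuous_map_sum C1_on_cont[OF vol_density_C1[OF c]])
  show "vol_density M c (chart_inv c y) \<noteq> 0" if "y \<in> topspace (subtopology (coord_space p) (img c))" for y
    using that vol_density_pos[OF c chart_inv_in[of y]] unfolding img_topspace[OF c] by simp
qed (auto intro: has_partials_cont_deriv[OF flux_has_partials[OF c _ h]])

end

section \<open>The Riemannian volume and bump functions\<close>

context riemannian_mfd
begin

lemma sets_rvolume: "sets (rvolume M) = sigma_sets (points M) {U. openin T U}"
  using volm unfolding riemannian_volume_def by blast

lemma space_rvolume [simp]: "space (rvolume M) = points M"
proof
  show "space (rvolume M) \<subseteq> points M"
  proof (rule sigma_sets_into_sp)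
    show "{U. openin T U} \<subseteq> Pow (points M)" by (auto dest: openin_subset)
    show "space (rvolume M) \<in> sigma_sets (points M) {U. openin T U}"
      using sets.top[of "rvolume M"] by (simp only: sets_rvolume)
  qed
  have "points M \<in> sets (rvolume M)" unfolding sets_rvolume by (rule sigma_sets_top)
  then show "points M \<subseteq> space (rvolume M)" by (rule sets.sets_into_space)
qed

lemma open_rvolume: "openin T U \<Longrightarrow> U \<in> sets (rvolume M)"
  unfolding sets_rvolume by (rule sigma_sets.Basic) simp

lemma emeasure_rvolume_chart:
  assumes "c \<in> matlas M" "A \<in> sets (rvolume M)" "A \<subseteq> fst c"
  shows "emeasure (rvolume M) A =
    (\<integral>\<^sup>+ y. ennreal (vol_density M c (chart_inv c y)) * indicator (snd c ` A) y \<partial>coord_lebesgue p)"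
  using volm assms unfolding riemannian_volume_def by blast

lemma continuous_map_rvolume_measurable:
  "contM f \<Longrightarrow> f \<in> borel_measurable (rvolume M)"
  by (erule continuous_map_borel_measurable) (auto intro: open_rvolume)

abbreviation "img_lebesgue c \<equiv> restrict_space (coord_lebesgue p) (img c)"

lemma space_img_lebesgue: "c \<in> matlas M \<Longrightarrow> space (img_lebesgue c) = img c"
  unfolding space_restrict_space space_coord_lebesgue using img_ext by (rule Int_absorb2)

lemma chart_inv_measurable:
  assumes c: "c \<in> matlas M"
  shows "chart_inv c \<in> measurable (img_lebesgue c) (rvolume M)"
proof (rule measurable_sigma_sets[OF sets_rvolume])
  show "{U. openin T U} \<subseteq> Pow (points M)" by (auto dest: openin_subset)
  show "chart_inv c \<in> space (img_lebesgue c) \<rightarrow> points M"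
    unfolding space_img_lebesgue[OF c]
    by (rule Pi_I, rule subsetD[OF chart_subset[OF c]], rule chart_inv_in)
  fix U assume "U \<in> {U. openin T U}"
  then have U: "openin T (U \<inter> fst c)" using chart_open[OF c] by auto
  have "openin (subtopology T (fst c)) (U \<inter> fst c)"
    using U by (simp add: openin_open_subtopology[OF chart_open[OF c]])
  from openin_continuous_map_preimage[OF chart_inv_cont[OF c] this]
  have op: "openin (coord_space p) {y \<in> img c. chart_inv c y \<in> U \<inter> fst c}"
    unfolding img_topspace[OF c] openin_open_subtopology[OF img_open[OF c]] by (rule conjunct1)
  have eq: "chart_inv c -` U \<inter> space (img_lebesgue c) = {y \<in> img c. chart_inv c y \<in> U \<inter> fst c}"
    unfolding space_img_lebesgue[OF c] using chart_inv_in[of _ c] by (intro equalityI subsetI) simp_all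
  show "chart_inv c -` U \<inter> space (img_lebesgue c) \<in> sets (img_lebesgue c)"
    unfolding eq sets_restrict_space
    by (rule image_eqI[OF _ openin_coord_sets[OF op]]) (rule Int_absorb1[symmetric], rule Collect_restrict)
qed

lemma chart_inv_measurable_restrict:
  assumes c: "c \<in> matlas M"
  shows "chart_inv c \<in> measurable (density (img_lebesgue c) g) (restrict_space (rvolume M) (fst c))"
proof (rule measurable_restrict_space2)
  show "chart_inv c \<in> space (density (img_lebesgue c) g) \<rightarrow> fst c"
    unfolding space_density space_img_lebesgue[OF c] by (rule Pi_I, rule chart_inv_in)
  show "chart_inv c \<in> measurable (density (img_lebesgue c) g) (rvolume M)"
    using chart_inv_measurable[OF c] by (simp only: measurable_density_eq1)
qed

lemma vol_density_measurable:
  "c \<in> matlas M \<Longrightarrow> (\<lambda>y. vol_density M c (chart_inv c y)) \<in> borel_measurable (img_lebesgue c)"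
  by (rule cont_on_measurable[OF C1_on_cont[OF vol_density_C1] img_open])

text \<open>The defining property of the volume, stated for sets inside a chart, says that it is an
  image measure under the inverse chart. In this form integrals can be transformed.\<close>

lemma restrict_rvolume:
  assumes c: "c \<in> matlas M"
  shows "restrict_space (rvolume M) (fst c) =
    distr (density (img_lebesgue c) (\<lambda>y. ennreal (vol_density M c (chart_inv c y))))
      (restrict_space (rvolume M) (fst c)) (chart_inv c)"
    (is "?R = distr ?D ?R _")
proof (rule measure_eqI)
  note vol_density_measurable[OF c, measurable]
  have fc: "fst c \<in> sets (rvolume M)" by (rule open_rvolume[OF chart_open[OF c]])
  have fc': "fst c \<inter> space (rvolume M) \<in> sets (rvolume M)" using fc by (rule sets.Int[OF _ sets.top])
  have img: "img c \<inter> space (coord_lebesgue p) \<in> sets (coord_lebesgue p)"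
    by (rule sets.Int[OF openin_coord_sets[OF img_open[OF c]] sets.top])
  note meas = chart_inv_measurable_restrict[OF c]
  fix A assume "A \<in> sets ?R"
  then have A: "A \<in> sets (rvolume M)" "A \<subseteq> fst c"
    unfolding sets_restrict_space_iff[OF fc'] by auto
  have pre: "chart_inv c -` A \<inter> img c = snd c ` A"
  proof (intro equalityI subsetI)
    fix y assume "y \<in> chart_inv c -` A \<inter> img c"
    then show "y \<in> snd c ` A" by (intro rev_image_eqI[of "chart_inv c y"]) (simp_all add: chart_inv_right)
  next
    fix y assume "y \<in> snd c ` A"
    then obtain x where x: "x \<in> A" "y = snd c x" by blast
    with A(2) have "x \<in> fst c" by blast
    with x show "y \<in> chart_inv c -` A \<inter> img c" by (simp add: chart_inv_left[OF c])
  qed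
  have preM: "snd c ` A \<in> sets (img_lebesgue c)"
    using measurable_sets[OF chart_inv_measurable[OF c] A(1)] by (simp only: space_img_lebesgue[OF c] pre)
  have "emeasure (distr ?D ?R (chart_inv c)) A = emeasure ?D (snd c ` A)"
    using \<open>A \<in> sets ?R\<close> by (simp only: emeasure_distr[OF meas] space_density space_img_lebesgue[OF c] pre)
  also have "\<dots> = (\<integral>\<^sup>+y. ennreal (vol_density M c (chart_inv c y)) * indicator (snd c ` A) y \<partial>img_lebesgue c)"
    using preM by (intro emeasure_density) measurable
  also have "\<dots> = (\<integral>\<^sup>+y. ennreal (vol_density M c (chart_inv c y)) * indicator (snd c ` A) y * indicator (img c) y
      \<partial>coord_lebesgue p)"
    by (rule nn_integral_restrict_space[OF img])
  also have "\<dots> = (\<integral>\<^sup>+y. ennreal (vol_density M c (chart_inv c y)) * indicator (snd c ` A) y \<partial>coord_lebesgue p)"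
    using A(2) by (intro nn_integral_cong) (auto simp: indicator_def)
  also have "\<dots> = emeasure ?R A"
    using emeasure_rvolume_chart[OF c A] emeasure_restrict_space[OF fc' A(2)] by simp
  finally show "emeasure ?R A = emeasure (distr ?D ?R (chart_inv c)) A" by (rule sym)
qed simp

lemma integral_chart:
  fixes u :: "'a \<Rightarrow> real"
  assumes c: "c \<in> matlas M" and u: "u \<in> borel_measurable (rvolume M)"
    and 0: "\<And>x. x \<in> points M - fst c \<Longrightarrow> u x = 0"
  shows "(\<integral>x. u x \<partial>rvolume M) = (\<integral>y. vol_density M c (chart_inv c y) * u (chart_inv c y) \<partial>img_lebesgue c)"
proof -
  let ?R = "restrict_space (rvolume M) (fst c)"
  let ?D = "density (img_lebesgue c) (\<lambda>y. ennreal (vol_density M c (chart_inv c y)))"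
  have fc': "fst c \<inter> space (rvolume M) \<in> sets (rvolume M)"
    by (rule sets.Int[OF open_rvolume[OF chart_open[OF c]] sets.top])
  note meas = chart_inv_measurable_restrict[OF c]
  have "(\<integral>x. u x \<partial>rvolume M) = (\<integral>x. indicator (fst c) x *\<^sub>R u x \<partial>rvolume M)"
    using 0 by (intro Bochner_Integration.integral_cong refl) (auto simp: indicator_def)
  also have "\<dots> = (\<integral>x. u x \<partial>?R)"
    by (rule integral_restrict_space[OF fc', symmetric])
  also have "\<dots> = (\<integral>x. u x \<partial>distr ?D ?R (chart_inv c))"
    using restrict_rvolume[OF c] by simp
  also have "\<dots> = (\<integral>y. u (chart_inv c y) \<partial>?D)"
    by (rule integral_distr[OF meas measurable_restrict_space1[OF u]])
  also have "\<dots> = (\<integral>y. vol_density M c (chart_inv c y) * u (chart_inv c y) \<partial>img_lebesgue c)"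
  proof (subst integral_density)
    show "(\<lambda>y. u (chart_inv c y)) \<in> borel_measurable (img_lebesgue c)"
      using measurable_compose[OF chart_inv_measurable[OF c] u] .
    show "AE y in img_lebesgue c. 0 \<le> vol_density M c (chart_inv c y)"
      using vol_density_pos[OF c chart_inv_in] by (intro AE_I2) (simp add: space_img_lebesgue[OF c] less_imp_le)
  qed (simp_all add: vol_density_measurable[OF c])
  finally show ?thesis .
qed

section \<open>Positivity and local finiteness of the volume, and integrability\<close>

lemma vol_density_local_bounds:
  assumes c: "c \<in> matlas M" and y: "y \<in> img c" and V: "openin (coord_space p) V" "y \<in> V"
  obtains r l b where "r > 0" "coord_box p y r \<subseteq> img c \<inter> V" "l > 0"
    "\<forall>z\<in>coord_box p y r. l \<le> vol_density M c (chart_inv c z) \<and> vol_density M c (chart_inv c z) \<le> b"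
proof -
  let ?v = "\<lambda>y. vol_density M c (chart_inv c y)"
  have pos: "?v y > 0" by (rule vol_density_pos[OF c chart_inv_in[OF y]])
  have "\<exists>r>0. coord_box p y r \<subseteq> img c \<and> (\<forall>z\<in>coord_box p y r. \<bar>?v z - ?v y\<bar> < ?v y / 2)"
    by (rule C1_on_cont[OF vol_density_C1[OF c], unfolded cont_on_iff[OF img_open[OF c]],
        THEN bspec, OF y, THEN spec, THEN mp, OF half_gt_zero[OF pos]])
  then obtain r where r: "r > 0" "coord_box p y r \<subseteq> img c"
    and rv: "\<forall>z\<in>coord_box p y r. \<bar>?v z - ?v y\<bar> < ?v y / 2"
    by (elim exE conjE) (rule that)
  obtain s where s: "s > 0" "coord_box p y s \<subseteq> V" using V unfolding openin_coord_space_iff by blast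
  show thesis
  proof (rule that[of "min r s" "?v y / 2" "2 * ?v y"])
    show "coord_box p y (min r s) \<subseteq> img c \<inter> V"
      by (intro Int_greatest subset_trans[OF coord_box_mono[OF min.cobounded1] r(2)]
          subset_trans[OF coord_box_mono[OF min.cobounded2] s(2)])
    show "\<forall>z\<in>coord_box p y (min r s). ?v y / 2 \<le> ?v z \<and> ?v z \<le> 2 * ?v y"
    proof
      fix z assume "z \<in> coord_box p y (min r s)"
      then have "\<bar>?v z - ?v y\<bar> < ?v y / 2" by (rule rv[THEN bspec, OF subsetD[OF coord_box_mono[OF min.cobounded1]]])
      then show "?v y / 2 \<le> ?v z \<and> ?v z \<le> 2 * ?v y" using pos by linarith
    qed
  qed (use pos r(1) s(1) in simp_all)
qed

text \<open>A small cube in a chart already has positive volume. Both later uses refute that a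
  function which is nonzero on a nonempty open set vanishes almost everywhere.\<close>

lemma emeasure_open_pos:
  assumes U: "openin T U" and x: "x \<in> U"
  shows "emeasure (rvolume M) U > 0"
proof -
  obtain c where c: "c \<in> matlas M" "x \<in> fst c" using chart_ex x openin_subset[OF U] by blast
  let ?V = "U \<inter> fst c"
  have V: "openin T ?V" "?V \<subseteq> fst c" using U chart_open[OF c(1)] by auto
  note W = chart_image_open[OF c(1) V]
  have y: "snd c x \<in> img c" "snd c x \<in> snd c ` ?V" using c x by auto
  obtain r l b where r: "r > 0" "coord_box p (snd c x) r \<subseteq> img c \<inter> snd c ` ?V" "l > 0"
    and l: "\<forall>z\<in>coord_box p (snd c x) r. l \<le> vol_density M c (chart_inv c z) \<and> vol_density M c (chart_inv c z) \<le> b"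
    by (rule vol_density_local_bounds[OF c(1) y(1) W y(2)]) (rule that)
  let ?B = "coord_box p (snd c x) r"
  have "0 < ennreal l * emeasure (coord_lebesgue p) ?B"
    using r by (simp add: emeasure_coord_box ennreal_zero_less_mult_iff)
  also have "\<dots> = (\<integral>\<^sup>+ y. ennreal l * indicator ?B y \<partial>coord_lebesgue p)"
    by (rule nn_integral_cmult_indicator[OF sets_coord_box, symmetric])
  also have "\<dots> \<le> (\<integral>\<^sup>+ y. ennreal (vol_density M c (chart_inv c y)) * indicator (snd c ` ?V) y \<partial>coord_lebesgue p)"
  proof (rule nn_integral_mono)
    fix y show "ennreal l * indicator ?B y \<le> ennreal (vol_density M c (chart_inv c y)) * indicator (snd c ` ?V) y"
    proof (cases "y \<in> ?B")
      case True
      then have "y \<in> snd c ` ?V" using r(2) by blast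
      then show ?thesis using True bspec[OF l True] by (simp add: ennreal_leI)
    qed simp
  qed
  also have "\<dots> = emeasure (rvolume M) ?V"
    by (rule emeasure_rvolume_chart[OF c(1) open_rvolume[OF V(1)] V(2), symmetric])
  also have "\<dots> \<le> emeasure (rvolume M) U"
    by (rule emeasure_mono[OF _ open_rvolume[OF U]]) simp
  finally show ?thesis .
qed

lemma emeasure_locally_finite:
  assumes "x \<in> points M"
  obtains N where "openin T N" "x \<in> N" "emeasure (rvolume M) N < \<infinity>"
proof -
  obtain c where c: "c \<in> matlas M" "x \<in> fst c" using chart_ex assms by blast
  then have y: "snd c x \<in> img c" by simp
  obtain r l b where r: "r > 0" "coord_box p (snd c x) r \<subseteq> img c \<inter> img c" "l > 0"
    and l: "\<forall>z\<in>coord_box p (snd c x) r. l \<le> vol_density M c (chart_inv c z) \<and> vol_density M c (chart_inv c z) \<le> b"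
    by (rule vol_density_local_bounds[OF c(1) y img_open[OF c(1)] y]) (rule that)
  let ?B = "coord_box p (snd c x) r" let ?N = "chart_inv c ` ?B"
  have B: "?B \<subseteq> img c" using r by blast
  have N: "openin T ?N" by (rule chart_inv_image_open[OF c(1) openin_coord_box B])
  have sub: "?N \<subseteq> fst c" by (rule image_subsetI, rule chart_inv_in) (use B in blast)
  have img: "snd c ` ?N = ?B"
    unfolding image_image using B by (simp add: chart_inv_right subset_iff cong: image_cong_simp)
  have "x = chart_inv c (snd c x)" using c by (simp add: chart_inv_left)
  moreover have "snd c x \<in> ?B" using y img_ext[OF c(1)] r(1) by (intro coord_box_self) auto
  ultimately have "x \<in> ?N" by (rule image_eqI)
  have "emeasure (rvolume M) ?N = (\<integral>\<^sup>+ y. ennreal (vol_density M c (chart_inv c y)) * indicator ?B y \<partial>coord_lebesgue p)"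
    unfolding emeasure_rvolume_chart[OF c(1) open_rvolume[OF N] sub] img ..
  also have "\<dots> \<le> (\<integral>\<^sup>+ y. ennreal b * indicator ?B y \<partial>coord_lebesgue p)"
    using l by (intro nn_integral_mono) (auto simp: indicator_def intro!: ennreal_leI)
  also have "\<dots> = ennreal b * emeasure (coord_lebesgue p) ?B"
    by (rule nn_integral_cmult_indicator[OF sets_coord_box])
  also have "\<dots> < \<infinity>" using r(1) by (simp add: emeasure_coord_box ennreal_mult_less_top)
  finally show thesis using that N \<open>x \<in> ?N\<close> by blast
qed

lemma Hausdorff_M: "Hausdorff_space T"
  using mfd unfolding smooth_manifold_def by blast

lemma compact_closed: "compactin T K \<Longrightarrow> closedin T K"
  by (rule compactin_imp_closedin[OF Hausdorff_M])

text \<open>Measurable because closed; of finite volume by local finiteness and a finite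
  subcover.\<close>

lemma compact_rvolume:
  assumes K: "compactin T K"
  shows "K \<in> sets (rvolume M)" "emeasure (rvolume M) K < \<infinity>"
proof -
  have "points M - K \<in> sets (rvolume M)"
    using compact_closed[OF K] by (intro open_rvolume) (simp add: closedin_def)
  from sets.compl_sets[OF this] show "K \<in> sets (rvolume M)"
    using compactin_subset_topspace[OF K] by (simp add: double_diff)
  let ?\<U> = "{N. openin T N \<and> emeasure (rvolume M) N < \<infinity>}"
  have "K \<subseteq> \<Union>?\<U>"
  proof
    fix x assume "x \<in> K"
    then have "x \<in> points M" using compactin_subset_topspace[OF K] by blast
    then obtain N where "openin T N" "x \<in> N" "emeasure (rvolume M) N < \<infinity>"
      by (rule emeasure_locally_finite)
    then show "x \<in> \<Union>?\<U>" by blast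
  qed
  then have "\<exists>F. finite F \<and> F \<subseteq> ?\<U> \<and> K \<subseteq> \<Union>F"
    by (intro compactinD[OF K]) simp_all
  then obtain F where F: "finite F" "F \<subseteq> ?\<U>" "K \<subseteq> \<Union>F" by blast
  have Fs: "N \<in> sets (rvolume M)" if "N \<in> F" for N using F(2) that by (intro open_rvolume) blast
  have "emeasure (rvolume M) K \<le> emeasure (rvolume M) (\<Union>F)"
    using F Fs by (intro emeasure_mono sets.finite_Union) auto
  also have "\<dots> \<le> (\<Sum>N\<in>F. emeasure (rvolume M) N)"
    using emeasure_subadditive_finite[of F "\<lambda>x. x" "rvolume M"] F(1) Fs by auto
  also have "\<dots> < \<infinity>" using F by (auto simp: ennreal_sum_less_top)
  finally show "emeasure (rvolume M) K < \<infinity>" .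
qed

text \<open>The volume may be infinite, so integrability in Green's formula and in the Stein
  estimate comes from here. This is why integrands are repeatedly shown to be continuous and to
  vanish off a compact set.\<close>

lemma integrable_compact_support:
  assumes u: "contM u" and K: "compactin T K"
    and 0: "\<And>x. x \<in> points M - K \<Longrightarrow> u x = 0"
  shows "integrable (rvolume M) u"
proof -
  obtain b where b: "\<And>x. x \<in> K \<Longrightarrow> \<bar>u x\<bar> \<le> b"
    using compactin_bounded_image[OF K, of "points M" u] u compactin_subset_topspace[OF K]
    by (auto simp: subtopology_topspace)
  show ?thesis
  proof (rule Bochner_Integration.integrable_bound)
    show "integrable (rvolume M) (\<lambda>x. \<bar>b\<bar> * indicator K x :: real)"
      using compact_rvolume[OF K] by (intro integrable_mult_right integrable_real_indicator) auto
    show "u \<in> borel_measurable (rvolume M)" by (rule continuous_map_rvolume_measurable[OF u])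
    show "AE x in rvolume M. norm (u x) \<le> norm (\<bar>b\<bar> * indicator K x :: real)"
      using b 0 by (intro AE_I2) (fastforce simp: indicator_def)
  qed
qed

end

section \<open>Continuously differentiable bump functions\<close>

lemma DERIV_pos_part_square: "((\<lambda>t::real. (max 0 t)\<^sup>2) has_real_derivative 2 * max 0 t) (at t)"
proof -
  consider "t > 0" | "t < 0" | "t = 0" by linarith
  then show ?thesis
  proof cases
    case 1
    have "((\<lambda>t::real. t\<^sup>2) has_real_derivative 2 * max 0 t) (at t)"
      using 1 by (auto intro!: derivative_eq_intros)
    then show ?thesis
      by (rule has_field_derivative_transform_within_open[of _ _ _ "{0<..}"]) (use 1 in auto)
  next
    case 2
    have "((\<lambda>t::real. 0) has_real_derivative 2 * max 0 t) (at t)"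
      using 2 by (auto intro!: derivative_eq_intros)
    then show ?thesis
      by (rule has_field_derivative_transform_within_open[of _ _ _ "{..<0}"]) (use 2 in auto)
  next
    case 3
    \<comment> \<open>At the corner of \<open>max 0\<close> the square still has derivative 0, since
      the difference quotient is at most \<open>\<bar>h\<bar>\<close>.\<close>
    have "((\<lambda>h::real. (max 0 h)\<^sup>2 / h) \<longlongrightarrow> 0) (at 0)"
    proof (rule Lim_null_comparison)
      show "\<forall>\<^sub>F h in at 0. norm ((max 0 h)\<^sup>2 / h) \<le> \<bar>h::real\<bar>"
        by (intro always_eventually allI) (auto simp: max_def power2_eq_square abs_mult)
      show "((\<lambda>h::real. \<bar>h\<bar>) \<longlongrightarrow> 0) (at 0)" by (intro tendsto_rabs_zero tendsto_ident_at)
    qed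
    then show ?thesis using 3 by (simp add: has_field_derivative_iff)
  qed
qed

text \<open>A step from 0 to 1 that is only \<open>C\<^sup>1\<close>, which suffices here and has an elementary derivative.\<close>

definition plateau :: "real \<Rightarrow> real" where
  "plateau t = 1 - (max 0 (1 - (max 0 t)\<^sup>2))\<^sup>2"

lemma plateau_le_0: "t \<le> 0 \<Longrightarrow> plateau t = 0"
  and plateau_ge_1: "t \<ge> 1 \<Longrightarrow> plateau t = 1"
  and plateau_range: "0 \<le> plateau t" "plateau t \<le> 1"
proof -
  show "t \<le> 0 \<Longrightarrow> plateau t = 0" by (simp add: plateau_def)
  show "plateau t = 1" if "t \<ge> 1"
  proof -
    have "1 \<le> (max 0 t)\<^sup>2" using that by (intro one_le_power) simp
    then show ?thesis by (simp add: plateau_def)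
  qed
  have "max 0 (1 - (max 0 t)\<^sup>2) \<le> 1" by simp
  then have "(max 0 (1 - (max 0 t)\<^sup>2))\<^sup>2 \<le> 1\<^sup>2" by (intro power_mono) auto
  then show "0 \<le> plateau t" "plateau t \<le> 1" by (simp_all add: plateau_def)
qed

lemma DERIV_plateau:
  "(plateau has_real_derivative 4 * max 0 (1 - (max 0 t)\<^sup>2) * max 0 t) (at t)"
proof -
  have "((\<lambda>t. 1 - (max 0 (1 - (max 0 t)\<^sup>2))\<^sup>2) has_real_derivative
      0 - 2 * max 0 (1 - (max 0 t)\<^sup>2) * (0 - 2 * max 0 t)) (at t)"
    by (intro DERIV_diff DERIV_const DERIV_chain2[OF DERIV_pos_part_square] DERIV_pos_part_square)
  then show ?thesis by (simp add: plateau_def[abs_def] mult.assoc)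
qed

text \<open>In each coordinate the argument of \<open>plateau\<close> is at least 1 up to distance
  \<open>r\<close> from the centre and at most 0 from distance \<open>sqrt 2 * r\<close> on, in
  particular from \<open>2 * r\<close> on. Squaring the distance avoids an absolute value, which
  would not be differentiable at the centre.\<close>

definition box_bump :: "nat \<Rightarrow> (nat \<Rightarrow> real) \<Rightarrow> real \<Rightarrow> (nat \<Rightarrow> real) \<Rightarrow> real" where
  "box_bump p a r y = (\<Prod>i<p. plateau (2 - ((y i - a i) / r)\<^sup>2))"

lemma box_bump_C1: "C1_on p (extensional {..<p}) (box_bump p a r)"
  unfolding box_bump_def
proof (rule C1_on_prod)
  fix i assume "i \<in> {..<p}"
  then have "i < p" by simp
  have "C1_on p (extensional {..<p}) (\<lambda>y. y i)" by (rule C1_onI[OF has_partials_coord[OF \<open>i < p\<close>]])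
  then show "C1_on p (extensional {..<p}) (\<lambda>y. plateau (2 - ((y i - a i) / r)\<^sup>2))"
  proof (rule C1_on_compose[where T = UNIV and g = "\<lambda>t. plateau (2 - ((t - a i) / r)\<^sup>2)" and
        g' = "\<lambda>t. 4 * max 0 (1 - (max 0 (2 - ((t - a i) / r)\<^sup>2))\<^sup>2) * max 0 (2 - ((t - a i) / r)\<^sup>2) *
          (0 - 2 * ((t - a i) / r) * (1 / r))"])
    fix t
    have "((\<lambda>t. 2 - ((t - a i) / r)\<^sup>2) has_real_derivative (0 - 2 * ((t - a i) / r) * (1 / r))) (at t)"
      unfolding divide_inverse by (auto intro!: derivative_eq_intros)
    from DERIV_chain2[OF DERIV_plateau this]
    show "((\<lambda>t. plateau (2 - ((t - a i) / r)\<^sup>2)) has_real_derivative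
      4 * max 0 (1 - (max 0 (2 - ((t - a i) / r)\<^sup>2))\<^sup>2) * max 0 (2 - ((t - a i) / r)\<^sup>2) *
          (0 - 2 * ((t - a i) / r) * (1 / r))) (at t)" .
  next
    show "continuous_on UNIV (\<lambda>t. 4 * max 0 (1 - (max 0 (2 - ((t - a i) / r)\<^sup>2))\<^sup>2) *
        max 0 (2 - ((t - a i) / r)\<^sup>2) * (0 - 2 * ((t - a i) / r) * (1 / r)))"
      unfolding divide_inverse by (intro continuous_intros)
  qed simp_all
qed simp

lemma box_bump_eq_1:
  assumes "r > 0" "y \<in> coord_box p a r"
  shows "box_bump p a r y = 1"
  unfolding box_bump_def
proof (rule prod.neutral, rule ballI)
  fix i assume "i \<in> {..<p}"
  then have "\<bar>(y i - a i) / r\<bar> \<le> 1" using assms by (simp add: mem_coord_box less_imp_le)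
  then have "((y i - a i) / r)\<^sup>2 \<le> 1" by (simp add: abs_square_le_1)
  then show "plateau (2 - ((y i - a i) / r)\<^sup>2) = 1" by (intro plateau_ge_1) simp
qed

lemma box_bump_eq_0:
  assumes "r > 0" "i < p" "\<bar>y i - a i\<bar> \<ge> 2 * r"
  shows "box_bump p a r y = 0"
proof -
  have "\<bar>(y i - a i) / r\<bar> \<ge> 2" using assms by (simp add: field_simps)
  then have "2\<^sup>2 \<le> ((y i - a i) / r)\<^sup>2" unfolding abs_le_square_iff[symmetric] by simp
  then have "plateau (2 - ((y i - a i) / r)\<^sup>2) = 0" by (intro plateau_le_0) simp
  then show ?thesis unfolding box_bump_def using assms(2) by (intro prod_zero) auto
qed

lemma box_bump_range: "0 \<le> box_bump p a r y \<and> box_bump p a r y \<le> 1"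
  unfolding box_bump_def by (auto intro!: prod_nonneg prod_le_1 simp: plateau_range)

context riemannian_mfd
begin

text \<open>The open set \<open>W\<close> on which the bump is 1 serves two purposes: it gives a
  nonzero contribution near \<open>x0\<close> when the Laplacians of two charts are compared, and
  such sets cover the support in Green's formula.\<close>

lemma bump_exists:
  assumes c: "c \<in> matlas M" and U: "openin T U" "U \<subseteq> fst c" "x0 \<in> U"
  obtains b W K where "C1M b" "openin T W" "x0 \<in> W" "\<forall>x\<in>W. b x = 1"
    "compactin T K" "K \<subseteq> U" "\<forall>x\<in>points M - K. b x = 0" "\<forall>x. 0 \<le> b x \<and> b x \<le> 1"
proof -
  let ?a = "snd c x0"
  obtain s where s: "s > 0" "coord_box p ?a s \<subseteq> snd c ` U"
    using chart_image_open[OF c U(1,2)] U(3) unfolding openin_coord_space_iff by blast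
  \<comment> \<open>A third of \<open>s\<close>: the bump lives in the closed cube of radius
    \<open>2 * r\<close>, which must fit into the open cube of radius \<open>s\<close>.\<close>
  define r where "r = s / 3"
  have r: "r > 0" using s by (simp add: r_def)
  define L where "L = PiE {..<p} (\<lambda>i. {?a i - 2 * r..?a i + 2 * r})"
  have L: "compactin (coord_space p) L"
    unfolding coord_space_def L_def by (subst compactin_PiE) auto
  have Lsub: "L \<subseteq> coord_box p ?a s"
  proof
    fix y assume y: "y \<in> L"
    have "\<bar>y i - ?a i\<bar> < s" if "i < p" for i
    proof -
      have "y i \<in> {?a i - 2 * r..?a i + 2 * r}" using y that by (auto simp: L_def PiE_iff)
      then show ?thesis using s(1) unfolding r_def by (auto simp: abs_less_iff)
    qed
    then show "y \<in> coord_box p ?a s" using y by (simp add: mem_coord_box L_def PiE_iff)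
  qed
  have LU: "L \<subseteq> snd c ` U" using Lsub s(2) by blast
  then have Limg: "L \<subseteq> img c" using U(2) by blast
  define K where "K = chart_inv c ` L"
  have "compactin (subtopology T (fst c)) K"
    unfolding K_def by (rule image_compactin[OF _ chart_inv_cont[OF c]]) (simp add: compactin_subtopology L Limg)
  then have K: "compactin T K" "K \<subseteq> fst c" by (simp_all add: compactin_subtopology)
  have "K \<subseteq> chart_inv c ` snd c ` U" unfolding K_def using LU by (rule image_mono)
  then have KU: "K \<subseteq> U" by (simp only: chart_inv_image[OF c U(2)])
  define W where "W = chart_inv c ` coord_box p ?a r"
  have boxr: "coord_box p ?a r \<subseteq> img c"
    by (rule subset_trans[OF coord_box_mono subset_trans[OF s(2) image_mono[OF U(2)]]])
       (use s(1) in \<open>simp add: r_def\<close>)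
  have W: "openin T W" unfolding W_def by (rule chart_inv_image_open[OF c openin_coord_box boxr])
  have "?a \<in> img c" using U by blast
  then have a: "?a \<in> coord_box p ?a r" by (intro coord_box_self subsetD[OF img_ext[OF c]] r)
  have "x0 \<in> fst c" using U by blast
  from chart_inv_left[OF c this] a have xW: "x0 \<in> W"
    unfolding W_def by (intro image_eqI[of x0 "chart_inv c" ?a]) simp_all
  define b where "b x = (if x \<in> fst c then box_bump p ?a r (snd c x) else 0)" for x
  have b1: "b x = 1" if x: "x \<in> W" for x
  proof -
    obtain y where y: "y \<in> coord_box p ?a r" "x = chart_inv c y" using x unfolding W_def by (rule imageE)
    have yi: "y \<in> img c" using y boxr by blast
    have "b x = box_bump p ?a r y" unfolding b_def y(2) by (simp only: chart_inv_in[OF yi] chart_inv_right[OF yi] if_True)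
    also have "\<dots> = 1" by (rule box_bump_eq_1[OF r y(1)])
    finally show ?thesis .
  qed
  have b0: "b x = 0" if "x \<in> points M - K" for x
  proof (cases "x \<in> fst c")
    case True
    have "snd c x \<notin> L"
    proof
      assume "snd c x \<in> L"
      then have "chart_inv c (snd c x) \<in> K" unfolding K_def by (rule imageI)
      then show False using that True by (simp add: chart_inv_left[OF c])
    qed
    moreover have "snd c x \<in> extensional {..<p}"
      by (rule subsetD[OF img_ext[OF c]], rule imageI, rule True)
    ultimately have "\<exists>i\<in>{..<p}. snd c x i \<notin> {?a i - 2 * r..?a i + 2 * r}"
      unfolding L_def PiE_iff by simp
    then obtain i where i: "i < p" "snd c x i \<notin> {?a i - 2 * r..?a i + 2 * r}" by auto
    then have "\<bar>snd c x i - ?a i\<bar> \<ge> 2 * r" by (auto simp: abs_if)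
    from box_bump_eq_0[where a = ?a and y = "snd c x", OF r i(1) this] show ?thesis by (simp add: b_def)
  qed (simp add: b_def)
  \<comment> \<open>Around points of the chart the bump is a C^1 function of the coordinates; around
    any other point it vanishes on the complement of the closed set \<open>K\<close>.\<close>
  have C1: "C1M b"
  proof (rule C1M_localI)
    fix x assume x: "x \<in> points M"
    show "\<exists>d U. d \<in> matlas M \<and> openin T U \<and> x \<in> U \<and> U \<subseteq> fst d \<and> C1_on p (snd d ` U) (\<lambda>y. b (chart_inv d y))"
    proof (cases "x \<in> fst c")
      case True
      have "C1_on p (img c) (box_bump p ?a r)"
        using box_bump_C1[of p ?a r] unfolding C1_on_iff by (rule has_partials_subset[OF _ img_ext[OF c]])
      then have "C1_on p (img c) (\<lambda>y. b (chart_inv c y))"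
        by (rule C1_on_cong[OF _ img_open[OF c]]) (simp only: b_def chart_inv_in chart_inv_right if_True)
      then show ?thesis using c True chart_open[OF c] by (intro exI[of _ c] exI[of _ "fst c"]) auto
    next
      case False
      obtain d where d: "d \<in> matlas M" "x \<in> fst d" using chart_ex[OF x] by blast
      have op: "openin T (fst d - K)" by (rule openin_diff[OF chart_open[OF d(1)] compact_closed[OF K(1)]])
      have sub: "fst d - K \<subseteq> fst d" by blast
      have "C1_on p (snd d ` (fst d - K)) (\<lambda>y. b (chart_inv d y))"
      proof (rule C1_on_cong[OF C1_on_const[of p _ 0] chart_image_open[OF d(1) op sub]])
        fix y assume "y \<in> snd d ` (fst d - K)"
        then obtain \<eta> where "\<eta> \<in> fst d - K" "y = snd d \<eta>" by blast
        then show "0 = b (chart_inv d y)" using b0[of \<eta>] chart_subset[OF d(1)] by (auto simp: chart_inv_left[OF d(1)])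
      qed
      then show ?thesis using d op False K(2) by (intro exI[of _ d] exI[of _ "fst d - K"]) auto
    qed
  qed
  have range: "0 \<le> b x \<and> b x \<le> 1" for x by (simp add: b_def box_bump_range)
  have "\<forall>x\<in>W. b x = 1" "\<forall>x\<in>points M - K. b x = 0" "\<forall>x. 0 \<le> b x \<and> b x \<le> 1"
    by (rule ballI, rule b1, assumption) (rule ballI, rule b0, assumption, rule allI, rule range)
  with C1 W xW K(1) KU show thesis by (intro that)
qed

end

section \<open>Green's formula\<close>

context riemannian_mfd
begin

lemma rinner_mult:
  assumes "x \<in> points M" "C1M f" "C1M g" "C1M h"
  shows "grad_inner (\<lambda>x. f x * g x) h x =
    g x * grad_inner f h x + f x * grad_inner g h x"
proof -
  obtain c where c: "c \<in> matlas M" "x \<in> fst c" using chart_ex assms(1) by blast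
  show ?thesis
    using assms by (simp add: rinner_chart[OF c] C1M_mult coord_deriv_mult[OF _ _ c] sum_distrib_left
        distrib_right distrib_left sum.distrib mult_ac)
qed

lemma rinner_add:
  assumes "x \<in> points M" "C1M f" "C1M g" "C1M h"
  shows "grad_inner (\<lambda>x. f x + g x) h x =
    grad_inner f h x + grad_inner g h x"
proof -
  obtain c where c: "c \<in> matlas M" "x \<in> fst c" using chart_ex assms(1) by blast
  show ?thesis
    using assms by (simp add: rinner_chart[OF c] C1M_add coord_deriv_add[OF _ _ c] distrib_right sum.distrib)
qed

lemma rinner_compose:
  assumes x: "x \<in> points M" and f: "C1M f" and h: "C1M h"
    and fS: "\<And>x. x \<in> points M \<Longrightarrow> f x \<in> S"
    and g: "\<And>t. t \<in> S \<Longrightarrow> (g has_real_derivative g' t) (at t)" "continuous_on S g'"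
  shows "grad_inner (\<lambda>x. g (f x)) h x = g' (f x) * grad_inner f h x"
proof -
  obtain c where c: "c \<in> matlas M" "x \<in> fst c" using chart_ex x by blast
  have "C1M (\<lambda>x. g (f x))" by (rule C1M_compose[OF f fS g])
  moreover have "coord_deriv c i (\<lambda>x. g (f x)) x = g' (f x) * coord_deriv c i f x" if "i < p" for i
    by (rule coord_deriv_compose[OF f fS g c that])
  ultimately show ?thesis
    by (simp add: rinner_chart[OF c] f h sum_distrib_left mult_ac)
qed

lemma rinner_commute:
  assumes "x \<in> points M"
  shows "rinner M V W x = rinner M W V x"
proof -
  define d where "d = chart_at M x"
  have d: "d \<in> matlas M" "x \<in> fst d" using chart_at[OF assms] unfolding d_def by auto
  have sym: "metric M d x $$ (i, j) = metric M d x $$ (j, i)" if "i < p" "j < p" for i j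
    using metric_pos_def[OF d] that by (simp add: pos_def_mat_def)
  show ?thesis
    unfolding rinner_def d_def[symmetric] Let_def
    by (subst sum.swap, intro sum.cong refl) (use sym in \<open>simp add: mult_ac\<close>)
qed

lemma rinner_vanish:
  assumes f: "C1M f" and h: "C1M h" and U: "openin T U" "x \<in> U" and 0: "\<And>\<eta>. \<eta> \<in> U \<Longrightarrow> f \<eta> = 0"
  shows "grad_inner f h x = 0"
proof -
  have "x \<in> points M" using U openin_subset by blast
  then obtain c where c: "c \<in> matlas M" "x \<in> fst c" using chart_ex by blast
  have "coord_deriv c i f x = 0" if "i < p" for i
    by (rule coord_deriv_vanish[OF f c(1) U c(2) 0 that])
  then show ?thesis by (simp add: rinner_chart[OF c f h])
qed

lemma rinner_vanish_off_compact:
  assumes f: "C1M f" and h: "C1M h" and K: "compactin T K" and 0: "\<And>x. x \<in> points M - K \<Longrightarrow> f x = 0"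
    and x: "x \<in> points M - K"
  shows "grad_inner f h x = 0"
proof (rule rinner_vanish[OF f h _ x 0])
  show "openin T (points M - K)" using compact_closed[OF K] by (simp add: closedin_def)
qed

text \<open>The continuous counterpart of extending partial derivatives by zero, with the same cover
  by \<open>U\<close> and the complement of \<open>K\<close>.\<close>

lemma continuous_extend_zero:
  assumes f: "continuous_map (subtopology T U) euclideanreal f" and U: "openin T U"
    and K: "compactin T K" "K \<subseteq> U" and 0: "\<And>x. x \<in> U - K \<Longrightarrow> f x = 0"
  shows "contM (\<lambda>x. if x \<in> U then f x else 0)"
  unfolding continuous_map_real_iff
proof (intro ballI allI impI)
  fix x and e :: real assume x: "x \<in> points M" and e: "e > 0"
  show "\<exists>V. openin T V \<and> x \<in> V \<and>
    (\<forall>y\<in>V. \<bar>(if y \<in> U then f y else 0) - (if x \<in> U then f x else 0)\<bar> < e)"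
  proof (cases "x \<in> U")
    case True
    have top: "topspace (subtopology T U) = U" using U by (rule topspace_subtopology_subset[OF openin_subset])
    from f[unfolded continuous_map_real_iff top, THEN bspec, OF True, THEN spec, THEN mp, OF e]
    obtain V where V: "openin (subtopology T U) V" "x \<in> V" "\<forall>y\<in>V. \<bar>f y - f x\<bar> < e" by blast
    then have "openin T V" "V \<subseteq> U" by (simp_all add: openin_open_subtopology[OF U])
    then show ?thesis using V True by (intro exI[of _ V]) auto
  next
    case False
    have "openin T (points M - K)" using compact_closed[OF K(1)] by (simp add: closedin_def)
    then show ?thesis using x False K(2) 0 e by (intro exI[of _ "points M - K"]) auto
  qed
qed

text \<open>Multiplied by the volume density, the sum of the two integrands is the coordinate
  divergence of \<open>w\<close> times the density times the gradient of \<open>h\<close>, and a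
  partial derivative of a compactly supported function integrates to zero. \<open>L\<close> is set
  to 0 outside the chart, where \<open>chart_laplacian c h\<close> carries no information.\<close>

lemma local_green:
  assumes c: "c \<in> matlas M" and w: "C1M w" and K: "compactin T K" "K \<subseteq> fst c"
    and 0: "\<And>x. x \<in> points M - K \<Longrightarrow> w x = 0" and h: "C2M h"
  defines "L \<equiv> (\<lambda>x. if x \<in> fst c then w x * chart_laplacian c h x else 0)"
  shows "integrable (rvolume M) L"
    and "(\<integral>x. L x \<partial>rvolume M) = - (\<integral>x. grad_inner w h x \<partial>rvolume M)"
proof -
  let ?r = "grad_inner w h"
  let ?v = "\<lambda>y. vol_density M c (chart_inv c y)"
  let ?g = "\<lambda>i x. vol_density M c x * gradient M h c x i"
  note h1 = C2M_imp_C1M[OF h]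
  have L0: "L x = 0" if "x \<in> points M - K" for x using 0[OF that] by (simp add: L_def)
  have r0: "?r x = 0" if "x \<in> points M - K" for x
    by (rule rinner_vanish_off_compact[OF w h1 K(1) 0 that])
  have Lc: "contM L"
    unfolding L_def
  proof (rule continuous_extend_zero[OF _ chart_open[OF c] K])
    show "continuous_map (subtopology T (fst c)) euclideanreal (\<lambda>x. w x * chart_laplacian c h x)"
    proof (rule continuous_map_real_mult[OF continuous_map_from_subtopology[OF C1M_continuous[OF w]]])
      show "continuous_map (subtopology T (fst c)) euclideanreal (chart_laplacian c h)"
        unfolding continuous_chart_iff[OF c] by (rule chart_laplacian_cont[OF c h])
    qed
    show "w x * chart_laplacian c h x = 0" if "x \<in> fst c - K" for x
      using 0[of x] that chart_subset[OF c] by auto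
  qed
  show Li: "integrable (rvolume M) L" by (rule integrable_compact_support[OF Lc K(1) L0])
  have rc: "contM ?r" by (rule rinner_continuous[OF w h1])
  have ri: "integrable (rvolume M) ?r" by (rule integrable_compact_support[OF rc K(1) r0])
  have Kc: "compactin (coord_space p) (snd c ` K)" "snd c ` K \<subseteq> img c"
  proof -
    have "compactin (subtopology (coord_space p) (img c)) (snd c ` K)"
      by (rule image_compactin[OF _ chart_cont[OF c]]) (simp add: compactin_subtopology K)
    then show "compactin (coord_space p) (snd c ` K)" "snd c ` K \<subseteq> img c" by (simp_all add: compactin_subtopology)
  qed
  \<comment> \<open>Product rule: \<open>i\<close> is the component of the field and
    \<open>j\<close> the direction of differentiation, so the divergence collects the terms
    \<open>?D i i\<close>.\<close>
  let ?D = "\<lambda>i j y. coord_deriv c j w (chart_inv c y) * ?g i (chart_inv c y) +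
      coord_deriv c j (?g i) (chart_inv c y) * w (chart_inv c y)"
  have hp: "has_partials p (img c) (\<lambda>y. w (chart_inv c y) * ?g i (chart_inv c y)) (?D i)" if "i < p" for i
    by (rule has_partials_mult[OF C1M_chart[OF w c] flux_has_partials[OF c that h]])
  have u0: "w (chart_inv c y) * ?g i (chart_inv c y) = 0" if "y \<in> img c - snd c ` K" for y i
  proof -
    have "chart_inv c y \<notin> K"
    proof
      assume "chart_inv c y \<in> K"
      then have "snd c (chart_inv c y) \<in> snd c ` K" by (rule imageI)
      then show False using that by (simp add: chart_inv_right)
    qed
    moreover have "chart_inv c y \<in> points M"
      by (rule subsetD[OF chart_subset[OF c]], rule chart_inv_in) (use that in blast)
    ultimately show ?thesis using 0 by simp
  qed
  have int: "integrable (img_lebesgue c) (?D i i)" "(\<integral>y. ?D i i y \<partial>img_lebesgue c) = 0" if "i < p" for i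
    by (rule integral_partial_eq_0[OF hp[OF that] img_open[OF c] Kc u0 that], assumption)+
  have sum: "(\<Sum>i<p. ?D i i y) = ?v y * (L (chart_inv c y) + ?r (chart_inv c y))" if y: "y \<in> img c" for y
  proof -
    let ?x = "chart_inv c y"
    have x: "?x \<in> fst c" by (rule chart_inv_in[OF y])
    have "?v y \<noteq> 0" using vol_density_pos[OF c x] by simp
    then have "?v y * chart_laplacian c h ?x = (\<Sum>i<p. coord_deriv c i (?g i) ?x)"
      by (simp add: chart_laplacian_def)
    then have "?v y * L ?x = (\<Sum>i<p. coord_deriv c i (?g i) ?x * w ?x)"
      using x by (simp add: L_def sum_distrib_left sum_distrib_right[symmetric])
    moreover have "?v y * ?r ?x = (\<Sum>i<p. coord_deriv c i w ?x * ?g i ?x)"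
      by (simp add: rinner_chart[OF c x w h1] sum_distrib_left mult_ac)
    ultimately show ?thesis by (simp add: sum.distrib distrib_left)
  qed
  have "(\<integral>x. L x + ?r x \<partial>rvolume M) = (\<integral>y. ?v y * (L (chart_inv c y) + ?r (chart_inv c y)) \<partial>img_lebesgue c)"
  proof (rule integral_chart[OF c])
    show "(\<lambda>x. L x + ?r x) \<in> borel_measurable (rvolume M)"
      by (intro borel_measurable_add continuous_map_rvolume_measurable Lc rc)
    show "L x + ?r x = 0" if "x \<in> points M - fst c" for x
    proof -
      have "x \<in> points M - K" using that K(2) by blast
      from L0[OF this] r0[OF this] show ?thesis by simp
    qed
  qed
  also have "\<dots> = (\<integral>y. (\<Sum>i<p. ?D i i y) \<partial>img_lebesgue c)"
    by (rule Bochner_Integration.integral_cong[OF refl]) (simp only: space_img_lebesgue[OF c] sum)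
  also have "\<dots> = (\<Sum>i<p. \<integral>y. ?D i i y \<partial>img_lebesgue c)"
    by (rule Bochner_Integration.integral_sum) (rule int, simp)
  also have "\<dots> = 0" by (rule sum.neutral, rule ballI, rule int) simp
  finally show "(\<integral>x. L x \<partial>rvolume M) = - (\<integral>x. ?r x \<partial>rvolume M)"
    unfolding Bochner_Integration.integral_add[OF Li ri] by (rule eq_neg_iff_add_eq_0[THEN iffD2])
qed

text \<open>If the difference were positive at \<open>x0\<close>, a bump supported where it is
  positive would give it a positive integral. But the integrals of both Laplacians against the bump
  equal minus the integral of the same inner product, which does not see the chart. Exchanging the
  charts later gives equality.\<close>

lemma chart_laplacian_le:
  assumes c: "c \<in> matlas M" and d: "d \<in> matlas M" and x: "x0 \<in> fst c \<inter> fst d" and h: "C2M h"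
  shows "chart_laplacian c h x0 \<le> chart_laplacian d h x0"
proof (rule ccontr)
  let ?f = "\<lambda>x. chart_laplacian c h x - chart_laplacian d h x"
  let ?U0 = "fst c \<inter> fst d"
  assume "\<not> chart_laplacian c h x0 \<le> chart_laplacian d h x0"
  then have pos: "?f x0 > 0" by simp
  have U0: "openin T ?U0" using chart_open c d by blast
  have cont: "continuous_map (subtopology T ?U0) euclideanreal (chart_laplacian e h)"
    if e: "e \<in> matlas M" "?U0 \<subseteq> fst e" for e
    by (rule continuous_map_from_subtopology_mono[OF _ e(2)])
       (unfold continuous_chart_iff[OF e(1)], rule chart_laplacian_cont[OF e(1) h])
  have "continuous_map (subtopology T ?U0) euclideanreal ?f"
    by (intro continuous_map_diff cont c d) auto
  moreover have top: "topspace (subtopology T ?U0) = ?U0"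
    using U0 by (rule topspace_subtopology_subset[OF openin_subset])
  ultimately have "openin (subtopology T ?U0) {x \<in> ?U0. ?f x \<in> {0<..}}"
    using openin_continuous_map_preimage[of _ euclideanreal ?f "{0<..}"] by fastforce
  then have "openin T {x \<in> ?U0. ?f x \<in> {0<..}}" by (simp add: openin_open_subtopology[OF U0])
  then obtain U where U: "openin T U" "U \<subseteq> fst c" "U \<subseteq> fst d" "x0 \<in> U" and Upos: "\<And>x. x \<in> U \<Longrightarrow> ?f x > 0"
    using that[of "{x \<in> ?U0. ?f x \<in> {0<..}}"] x pos by auto
  obtain b W K where b: "C1M b" and W: "openin T W" "x0 \<in> W" and W1: "\<forall>x\<in>W. b x = 1"
    and K: "compactin T K" "K \<subseteq> U" and bK: "\<forall>x\<in>points M - K. b x = 0"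
    and range: "\<forall>x. 0 \<le> b x \<and> b x \<le> 1"
    by (rule bump_exists[OF c U(1,2,4)]) (rule that)
  have b0: "b x = 0" if "x \<in> points M - K" for x by (rule bK[THEN bspec, OF that])
  define L where "L e x = (if x \<in> fst e then b x * chart_laplacian e h x else 0)" for e :: "'a chart" and x
  have Kc: "K \<subseteq> fst c" and Kd: "K \<subseteq> fst d" using K U by blast+
  note gc = local_green[OF c b K(1) Kc b0 h, folded L_def]
  note gd = local_green[OF d b K(1) Kd b0 h, folded L_def]
  let ?g = "\<lambda>x. L c x - L d x"
  have g: "?g x = (if x \<in> U then b x * ?f x else 0)" if "x \<in> points M" for x
    using b0[of x] that U(2,3) K(2) by (auto simp: L_def algebra_simps)
  have nonneg: "0 \<le> ?g x" if "x \<in> points M" for x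
    using g[OF that] range[THEN spec, of x] Upos[of x] by (cases "x \<in> U") (simp_all add: mult_nonneg_nonneg less_imp_le)
  have int: "integrable (rvolume M) ?g" by (rule Bochner_Integration.integrable_diff[OF gc(1) gd(1)])
  have "(\<integral>x. ?g x \<partial>rvolume M) = 0"
    using Bochner_Integration.integral_diff[OF gc(1) gd(1)] gc(2) gd(2) by simp
  moreover have "AE x in rvolume M. 0 \<le> ?g x" by (rule AE_I2, rule nonneg) simp
  ultimately have ae: "AE x in rvolume M. ?g x = 0"
    using integral_nonneg_eq_0_iff_AE[OF int] by simp
  \<comment> \<open>Where the bump is 1, the point lies in \<open>K\<close> and hence in
    \<open>U\<close>, where the difference is positive.\<close>
  have g_W: "?g x \<noteq> 0" if x: "x \<in> W" for x
  proof -
    have pt: "x \<in> points M" using x openin_subset[OF W(1)] by blast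
    have "x \<in> K" using b0[of x] W1[THEN bspec, OF x] pt by auto
    with K(2) have "x \<in> U" by blast
    with g[OF pt] W1[THEN bspec, OF x] Upos[of x] show ?thesis by simp
  qed
  from ae have "AE x in rvolume M. x \<notin> W"
    by (rule eventually_mono) (use g_W in blast)
  then have "W \<in> null_sets (rvolume M)" using AE_iff_null_sets[OF open_rvolume[OF W(1)]] by simp
  then show False using emeasure_open_pos[OF W(1,2)] by auto
qed

lemma laplacian_chart:
  assumes c: "c \<in> matlas M" and x: "x \<in> fst c" and h: "C2M h"
  shows "laplacian M h x = chart_laplacian c h x"
proof -
  have d: "chart_at M x \<in> matlas M" "x \<in> fst (chart_at M x)"
    using chart_at[of x] chart_subset[OF c] x by auto
  show ?thesis unfolding laplacian_chart_at
    by (rule antisym; rule chart_laplacian_le) (use c d x h in auto)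
qed

lemma laplacian_continuous:
  assumes h: "C2M h"
  shows "contM (laplacian M h)"
proof (rule continuous_map_charts)
  fix c assume c: "c \<in> matlas M"
  show "continuous_map (subtopology T (fst c)) euclideanreal (laplacian M h)"
    unfolding continuous_chart_iff[OF c]
    by (rule cont_on_cong[OF chart_laplacian_cont[OF c h]]) (simp only: laplacian_chart[OF c chart_inv_in h])
qed

section \<open>Green's formula for arbitrary compact supports\<close>

definition chart_bump :: "('a \<Rightarrow> real) \<Rightarrow> bool" where
  "chart_bump b \<longleftrightarrow> C1M b \<and> (\<exists>c\<in>matlas M. \<exists>K. compactin T K \<and> K \<subseteq> fst c \<and> (\<forall>x\<in>points M - K. b x = 0))"

text \<open>Each bump function removes the part \<open>w b\<close>, which lives in one chart. The
  remainder \<open>w (1 - b)\<close> vanishes where \<open>b\<close> is 1, so the other bump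
  functions still cover it. This does the work of a partition of unity without normalising a
  sum.\<close>

lemma green_covered:
  assumes "finite F" "\<forall>b\<in>F. chart_bump b" "C1M w" "compactin T K" "\<And>x. x \<in> points M - K \<Longrightarrow> w x = 0"
    "\<And>x. x \<in> points M \<Longrightarrow> w x \<noteq> 0 \<Longrightarrow> \<exists>b\<in>F. b x = 1" and h: "C2M h"
  shows "(\<integral>x. w x * laplacian M h x \<partial>rvolume M) =
    - (\<integral>x. grad_inner w h x \<partial>rvolume M)"
  using assms(1-6)
proof (induction F arbitrary: w rule: finite_induct)
  case empty
  have w0: "w x = 0" if "x \<in> points M" for x using empty.prems(5)[OF that] by auto
  have "grad_inner w h x = 0" if "x \<in> points M" for x
    by (rule rinner_vanish[OF empty.prems(2) C2M_imp_C1M[OF h] openin_topspace that w0])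
  then have "(\<integral>x. grad_inner w h x \<partial>rvolume M) = (\<integral>x. 0 \<partial>rvolume M)"
    by (intro Bochner_Integration.integral_cong refl) simp
  moreover have "(\<integral>x. w x * laplacian M h x \<partial>rvolume M) = (\<integral>x. 0 \<partial>rvolume M)"
    using w0 by (intro Bochner_Integration.integral_cong refl) simp
  ultimately show ?case by simp
next
  case (insert b F)
  note h1 = C2M_imp_C1M[OF h]
  have "chart_bump b" using insert.prems(1) by simp
  then obtain c K' where b: "C1M b" and c: "c \<in> matlas M" and K': "compactin T K'" "K' \<subseteq> fst c"
    and b0: "\<And>x. x \<in> points M - K' \<Longrightarrow> b x = 0"
    unfolding chart_bump_def by blast
  \<comment> \<open>The factor \<open>-1\<close> in place of a difference lets closure under sums
    and products apply.\<close>
  let ?w1 = "\<lambda>x. w x * b x" and ?w2 = "\<lambda>x. w x * (1 + (-1) * b x)"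
  let ?r = "\<lambda>w. grad_inner w h"
  have C1: "C1M ?w1" "C1M ?w2"
    by (intro C1M_mult C1M_add C1M_const insert.prems(2) b)+
  have 1: "?w1 x = 0" if "x \<in> points M - K'" for x using b0[OF that] by simp
  have v1: "?w1 x = 0" if "x \<in> points M - K" for x using insert.prems(4)[OF that] by simp
  have 2: "?w2 x = 0" if "x \<in> points M - K" for x using insert.prems(4)[OF that] by simp
  have g1: "(\<integral>x. ?w1 x * laplacian M h x \<partial>rvolume M) = - (\<integral>x. ?r ?w1 x \<partial>rvolume M)"
  proof -
    have "(\<integral>x. ?w1 x * laplacian M h x \<partial>rvolume M) =
        (\<integral>x. (if x \<in> fst c then ?w1 x * chart_laplacian c h x else 0) \<partial>rvolume M)"
    proof (rule Bochner_Integration.integral_cong[OF refl])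
      fix x assume "x \<in> space (rvolume M)"
      then show "?w1 x * laplacian M h x = (if x \<in> fst c then ?w1 x * chart_laplacian c h x else 0)"
        using 1[of x] K'(2) laplacian_chart[OF c _ h, of x] by (cases "x \<in> fst c") auto
    qed
    also have "\<dots> = - (\<integral>x. ?r ?w1 x \<partial>rvolume M)"
      by (rule local_green(2)[OF c C1(1) K' 1 h])
    finally show ?thesis .
  qed
  have g2: "(\<integral>x. ?w2 x * laplacian M h x \<partial>rvolume M) = - (\<integral>x. ?r ?w2 x \<partial>rvolume M)"
  proof (rule insert.IH)
    fix x assume x: "x \<in> points M" and "?w2 x \<noteq> 0"
    then have "w x \<noteq> 0" "b x \<noteq> 1" by auto
    then show "\<exists>b\<in>F. b x = 1" using insert.prems(5)[OF x] by auto
  qed (use insert.prems(1,3) C1(2) 2 in auto)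
  have int: "integrable (rvolume M) (\<lambda>x. v x * laplacian M h x)" "integrable (rvolume M) (?r v)"
    if v: "C1M v" "\<And>x. x \<in> points M - K \<Longrightarrow> v x = 0" for v
  proof -
    show "integrable (rvolume M) (\<lambda>x. v x * laplacian M h x)"
      using v by (intro integrable_compact_support[OF _ insert.prems(3)] continuous_map_real_mult
          C1M_continuous laplacian_continuous[OF h]) auto
    show "integrable (rvolume M) (?r v)"
      by (rule integrable_compact_support[OF rinner_continuous[OF v(1) h1] insert.prems(3)
            rinner_vanish_off_compact[OF v(1) h1 insert.prems(3) v(2)]])
  qed
  have w_eq: "(\<lambda>x. ?w1 x + ?w2 x) = w" by (rule ext) (simp add: algebra_simps)
  have "(\<integral>x. w x * laplacian M h x \<partial>rvolume M) =
      (\<integral>x. ?w1 x * laplacian M h x + ?w2 x * laplacian M h x \<partial>rvolume M)"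
    by (intro Bochner_Integration.integral_cong refl) (simp add: algebra_simps)
  also have "\<dots> = (\<integral>x. ?w1 x * laplacian M h x \<partial>rvolume M) + (\<integral>x. ?w2 x * laplacian M h x \<partial>rvolume M)"
    by (rule Bochner_Integration.integral_add[OF int(1)[OF C1(1) v1] int(1)[OF C1(2) 2]])
  also have "\<dots> = - ((\<integral>x. ?r ?w1 x \<partial>rvolume M) + (\<integral>x. ?r ?w2 x \<partial>rvolume M))"
    unfolding g1 g2 by simp
  also have "(\<integral>x. ?r ?w1 x \<partial>rvolume M) + (\<integral>x. ?r ?w2 x \<partial>rvolume M) = (\<integral>x. ?r ?w1 x + ?r ?w2 x \<partial>rvolume M)"
    by (rule Bochner_Integration.integral_add[OF int(2)[OF C1(1) v1] int(2)[OF C1(2) 2], symmetric])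
  also have "\<dots> = (\<integral>x. ?r (\<lambda>x. ?w1 x + ?w2 x) x \<partial>rvolume M)"
    by (intro Bochner_Integration.integral_cong refl) (simp only: rinner_add[OF _ C1 h1] space_rvolume)
  finally show ?case unfolding w_eq .
qed

text \<open>Compactness yields finitely many open sets that cover \<open>K\<close> and on each of
  which some bump function equals 1.\<close>

lemma green:
  assumes w: "C1M w" and K: "compactin T K" and 0: "\<And>x. x \<in> points M - K \<Longrightarrow> w x = 0" and h: "C2M h"
  shows "(\<integral>x. w x * laplacian M h x \<partial>rvolume M) =
    - (\<integral>x. grad_inner w h x \<partial>rvolume M)"
proof -
  let ?P = "\<lambda>b W. chart_bump b \<and> openin T W \<and> (\<forall>x\<in>W. b x = 1)"
  let ?\<U> = "{W. \<exists>b. ?P b W}"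
  have "K \<subseteq> \<Union>?\<U>"
  proof
    fix x assume "x \<in> K"
    then have "x \<in> points M" using compactin_subset_topspace[OF K] by blast
    then obtain c where c: "c \<in> matlas M" "x \<in> fst c" using chart_ex by blast
    obtain b W K' where b: "C1M b" and W: "openin T W" "x \<in> W" "\<forall>\<eta>\<in>W. b \<eta> = 1"
      and K': "compactin T K'" "K' \<subseteq> fst c" "\<forall>\<eta>\<in>points M - K'. b \<eta> = 0"
      by (rule bump_exists[OF c(1) chart_open[OF c(1)] order_refl c(2)]) (rule that)
    have "chart_bump b" unfolding chart_bump_def using b c(1) K' by blast
    with W show "x \<in> \<Union>?\<U>" by blast
  qed
  then have "\<exists>G. finite G \<and> G \<subseteq> ?\<U> \<and> K \<subseteq> \<Union>G"
    by (intro compactinD[OF K]) blast+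
  then obtain G where G: "finite G" "G \<subseteq> ?\<U>" "K \<subseteq> \<Union>G"
    by (elim exE conjE) (rule that)
  define \<beta> where "\<beta> W = (SOME b. ?P b W)" for W
  have \<beta>: "?P (\<beta> W) W" if "W \<in> G" for W
    unfolding \<beta>_def using G(2) that by (intro someI_ex[of "\<lambda>b. ?P b W"]) blast
  show ?thesis
  proof (rule green_covered[of "\<beta> ` G", OF _ _ w K 0 _ h])
    show "\<exists>b\<in>\<beta> ` G. b x = 1" if x: "x \<in> points M" "w x \<noteq> 0" for x
    proof -
      have "x \<in> K" using 0[of x] x by auto
      then obtain W where "W \<in> G" "x \<in> W" using G(3) by blast
      then show ?thesis using \<beta>[of W] by blast
    qed
  qed (use G(1) \<beta> in auto)
qed

end

section \<open>Stein's equation for the normal law\<close>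

lemma DERIV_normal_density:
  assumes "\<sigma> > 0"
  shows "(normal_density 0 \<sigma> has_real_derivative - x / \<sigma>\<^sup>2 * normal_density 0 \<sigma> x) (at x)"
  unfolding normal_density_def using assms
  by (auto intro!: derivative_eq_intros simp: field_simps power2_eq_square)

lemma normal_density_tendsto_0:
  assumes "\<sigma> > 0"
  shows "(normal_density 0 \<sigma> \<longlongrightarrow> 0) at_top"
proof -
  have "filterlim (\<lambda>x::real. x\<^sup>2 / (2 * \<sigma>\<^sup>2)) at_top at_top"
    using assms by (intro filterlim_at_top_mult_tendsto_pos[where c = "1 / (2 * \<sigma>\<^sup>2)"
        and f = "\<lambda>_. 1 / (2 * \<sigma>\<^sup>2)" and g = "\<lambda>x::real. x\<^sup>2", simplified]
        filterlim_pow_at_top filterlim_ident) auto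
  then have "((\<lambda>x. exp (- (x\<^sup>2 / (2 * \<sigma>\<^sup>2)))) \<longlongrightarrow> 0) at_top"
    by (intro filterlim_compose[OF exp_at_bot] filterlim_compose[OF filterlim_uminus_at_bot_at_top])
  then have "((\<lambda>x. 1 / sqrt (2 * pi * \<sigma>\<^sup>2) * exp (- (x\<^sup>2 / (2 * \<sigma>\<^sup>2)))) \<longlongrightarrow> 0) at_top"
    by (rule tendsto_mult_right_zero)
  then show ?thesis by (simp add: normal_density_def[abs_def])
qed

definition normal_tail :: "real \<Rightarrow> real \<Rightarrow> real" where
  "normal_tail \<sigma> x = (\<integral>y. normal_density 0 \<sigma> y * indicator {x..} y \<partial>lborel)"

lemma integrable_normal_density_indicator:
  assumes "\<sigma> > 0" "A \<in> sets borel"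
  shows "integrable lborel (\<lambda>y. normal_density 0 \<sigma> y * indicator A y)"
  using assms by (intro integrable_real_mult_indicator) auto

text \<open>Comparison at infinity: \<open>F\<close> decreases to 0 at the rate \<open>G\<close>,
  which dominates the density, so the tail mass is at most the total drop of
  \<open>F\<close>.\<close>

lemma normal_tail_le:
  assumes \<sigma>: "\<sigma> > 0"
    and deriv: "\<And>y. x \<le> y \<Longrightarrow> (F has_real_derivative - G y) (at y)"
    and G: "\<And>y. x \<le> y \<Longrightarrow> normal_density 0 \<sigma> y \<le> G y"
    and F: "(F \<longlongrightarrow> 0) at_top" and [measurable]: "G \<in> borel_measurable borel"
  shows "normal_tail \<sigma> x \<le> F x"
proof -
  have G0: "0 \<le> G y" if "x \<le> y" for y
    using G[OF that] normal_density_nonneg[of 0 \<sigma> y] by linarith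
  have "ennreal (normal_tail \<sigma> x) = (\<integral>\<^sup>+y. ennreal (normal_density 0 \<sigma> y * indicator {x..} y) \<partial>lborel)"
    unfolding normal_tail_def
    by (intro nn_integral_eq_integral[symmetric] integrable_normal_density_indicator \<sigma>) auto
  also have "\<dots> \<le> (\<integral>\<^sup>+y. ennreal (G y) * indicator {x..} y \<partial>lborel)"
    using G by (intro nn_integral_mono) (auto simp: indicator_def intro!: ennreal_leI)
  also have "\<dots> = ennreal (0 - (- F x))"
    using deriv G0 tendsto_minus[OF F]
    by (intro nn_integral_FTC_atLeast) (auto intro!: derivative_eq_intros)
  finally have "ennreal (normal_tail \<sigma> x) \<le> ennreal (F x)" by simp
  moreover have "0 \<le> F x"
  proof (rule tendsto_upperbound[OF F])
    show "\<forall>\<^sub>F y in at_top. F y \<le> F x"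
    proof (rule eventually_at_top_linorderI)
      fix y assume "x \<le> y"
      then show "F y \<le> F x"
      proof (rule DERIV_nonpos_imp_nonincreasing)
        fix z assume "x \<le> z"
        then show "\<exists>d. (F has_real_derivative d) (at z) \<and> d \<le> 0"
          using deriv[of z] G0[of z] by (intro exI[of _ "- G z"]) auto
      qed
    qed
  qed simp
  ultimately show ?thesis by simp
qed

lemma normal_tail_bounds:
  assumes \<sigma>: "\<sigma> > 0" and x: "x \<ge> 0"
  shows "x * normal_tail \<sigma> x \<le> \<sigma>\<^sup>2 * normal_density 0 \<sigma> x"
    and "normal_tail \<sigma> x \<le> 2 * \<sigma> * normal_density 0 \<sigma> x"
proof -
  let ?n = "normal_density 0 \<sigma>"
  show "x * normal_tail \<sigma> x \<le> \<sigma>\<^sup>2 * ?n x"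
  proof (cases "x = 0")
    case False
    with x have "x > 0" by simp
    \<comment> \<open>On the tail \<open>y / x\<close> is at least 1, and \<open>y * ?n y\<close>
      has the primitive \<open>- \<sigma>\<^sup>2 * ?n y\<close>.\<close>
    have "normal_tail \<sigma> x \<le> (\<sigma>\<^sup>2 / x) * ?n x"
    proof (rule normal_tail_le[where G = "\<lambda>y. y / x * ?n y" and F = "\<lambda>y. (\<sigma>\<^sup>2 / x) * ?n y", OF \<sigma>])
      fix y assume "x \<le> y"
      show "((\<lambda>y. (\<sigma>\<^sup>2 / x) * ?n y) has_real_derivative - (y / x * ?n y)) (at y)"
        using \<sigma> \<open>x > 0\<close> by (auto intro!: derivative_eq_intros DERIV_normal_density simp: field_simps)
      have "1 * ?n y \<le> y / x * ?n y"
        using \<open>x \<le> y\<close> \<open>x > 0\<close> by (intro mult_right_mono) auto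
      then show "?n y \<le> y / x * ?n y" by simp
    next
      show "((\<lambda>y. (\<sigma>\<^sup>2 / x) * ?n y) \<longlongrightarrow> 0) at_top"
        by (rule tendsto_mult_right_zero[OF normal_density_tendsto_0[OF \<sigma>]])
    qed simp
    with \<open>x > 0\<close> show ?thesis by (simp add: field_simps)
  qed (simp add: \<sigma> less_imp_le)
  \<comment> \<open>The factor \<open>r y = 2 \<sigma>\<^sup>2 / (\<sigma> + y)\<close> satisfies \<open>y r / \<sigma>\<^sup>2 - r' \<ge> 1\<close>, that is \<open>- (r n)' \<ge> n\<close>.\<close>
  have "normal_tail \<sigma> x \<le> 2 * \<sigma>\<^sup>2 / (\<sigma> + x) * ?n x"
  proof (rule normal_tail_le[where G = "\<lambda>y. (2 * y / (\<sigma> + y) + 2 * \<sigma>\<^sup>2 / (\<sigma> + y)\<^sup>2) * ?n y"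
        and F = "\<lambda>y. 2 * \<sigma>\<^sup>2 / (\<sigma> + y) * ?n y", OF \<sigma>])
    fix y assume "x \<le> y"
    with x have y: "y \<ge> 0" by simp
    have p: "\<sigma> + y > 0" using \<sigma> y by simp
    have "((\<lambda>y. 2 * \<sigma>\<^sup>2 / (\<sigma> + y)) has_real_derivative - (2 * \<sigma>\<^sup>2) / (\<sigma> + y)\<^sup>2) (at y)"
      using p by (auto intro!: derivative_eq_intros simp: power2_eq_square)
    from DERIV_mult[OF this DERIV_normal_density[OF \<sigma>]]
    have "((\<lambda>y. 2 * \<sigma>\<^sup>2 / (\<sigma> + y) * ?n y) has_real_derivative
        - (2 * \<sigma>\<^sup>2) / (\<sigma> + y)\<^sup>2 * ?n y + - y / \<sigma>\<^sup>2 * ?n y * (2 * \<sigma>\<^sup>2 / (\<sigma> + y))) (at y)" .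
    moreover have "- (2 * \<sigma>\<^sup>2) / (\<sigma> + y)\<^sup>2 * ?n y + - y / \<sigma>\<^sup>2 * ?n y * (2 * \<sigma>\<^sup>2 / (\<sigma> + y))
        = - ((2 * y / (\<sigma> + y) + 2 * \<sigma>\<^sup>2 / (\<sigma> + y)\<^sup>2) * ?n y)"
      using \<sigma> by (simp add: algebra_simps)
    ultimately show "((\<lambda>y. 2 * \<sigma>\<^sup>2 / (\<sigma> + y) * ?n y) has_real_derivative
        - ((2 * y / (\<sigma> + y) + 2 * \<sigma>\<^sup>2 / (\<sigma> + y)\<^sup>2) * ?n y)) (at y)" by simp
    have "2 * y / (\<sigma> + y) + 2 * \<sigma>\<^sup>2 / (\<sigma> + y)\<^sup>2 = (2 * y * (\<sigma> + y) + 2 * \<sigma>\<^sup>2) / (\<sigma> + y)\<^sup>2"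
      using p by (simp add: add_divide_distrib power2_eq_square)
    also have "\<dots> \<ge> 1"
    proof -
      have "0 \<le> \<sigma>\<^sup>2 + y\<^sup>2" by simp
      then have "(\<sigma> + y)\<^sup>2 \<le> 2 * y * (\<sigma> + y) + 2 * \<sigma>\<^sup>2"
        by (simp add: power2_eq_square algebra_simps)
      then show ?thesis using p by (simp add: le_divide_eq_1_pos)
    qed
    finally show "?n y \<le> (2 * y / (\<sigma> + y) + 2 * \<sigma>\<^sup>2 / (\<sigma> + y)\<^sup>2) * ?n y"
      using mult_right_mono[of 1 _ "?n y"] by simp
  next
    have "((\<lambda>y. 2 * \<sigma>\<^sup>2 / (\<sigma> + y)) \<longlongrightarrow> 0) at_top"
      by (intro tendsto_divide_0[OF tendsto_const] filterlim_at_top_imp_at_infinity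
          filterlim_tendsto_add_at_top[OF tendsto_const] filterlim_ident)
    from tendsto_mult[OF this normal_density_tendsto_0[OF \<sigma>]]
    show "((\<lambda>y. 2 * \<sigma>\<^sup>2 / (\<sigma> + y) * ?n y) \<longlongrightarrow> 0) at_top" by simp
  qed measurable
  also have "\<dots> \<le> 2 * \<sigma> * ?n x"
    using \<sigma> x by (intro mult_right_mono) (auto simp: field_simps power2_eq_square)
  finally show "normal_tail \<sigma> x \<le> 2 * \<sigma> * ?n x" .
qed

text \<open>Reflection at 0, the density being even.\<close>

lemma normal_tail_lower:
  "(\<integral>y. normal_density 0 \<sigma> y * indicator {..x} y \<partial>lborel) = normal_tail \<sigma> (- x)"
proof -
  have "(\<integral>y. normal_density 0 \<sigma> y * indicator {..x} y \<partial>lborel) =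
      (\<integral>y. normal_density 0 \<sigma> (- y) * indicator {..x} (- y) \<partial>lborel)"
    using lborel_integral_real_affine[of "-1" "\<lambda>y. normal_density 0 \<sigma> y * indicator {..x} y" 0]
    by simp
  also have "\<dots> = normal_tail \<sigma> (- x)"
    unfolding normal_tail_def
    by (intro Bochner_Integration.integral_cong refl) (auto simp: normal_density_def indicator_def)
  finally show ?thesis .
qed

text \<open>Multiplied by the density \<open>n\<close>, the equation reads
  \<open>(\<sigma>\<^sup>2 n f)' = n k\<close>, whence \<open>f = I / (\<sigma>\<^sup>2 n)\<close>
  with \<open>I\<close> the integral of \<open>n k\<close> up to \<open>x\<close>. Tail bounds
  control \<open>I\<close>, and the equation itself bounds \<open>f'\<close> through
  \<open>k\<close> and \<open>x f\<close>.\<close>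

lemma stein_solution:
  fixes k :: "real \<Rightarrow> real"
  assumes \<sigma>: "\<sigma> > 0" and cont: "continuous_on UNIV k" and B: "\<And>x. \<bar>k x\<bar> \<le> B"
    and centered: "(\<integral>y. normal_density 0 \<sigma> y * k y \<partial>lborel) = 0"
  obtains f f' :: "real \<Rightarrow> real"
  where "\<And>x. (f has_real_derivative f' x) (at x)" "continuous_on UNIV f'"
    "\<And>x. \<sigma>\<^sup>2 * f' x - x * f x = k x" "\<And>x. \<bar>f x\<bar> \<le> 2 * B / \<sigma>" "\<And>x. \<bar>f' x\<bar> \<le> 2 * B / \<sigma>\<^sup>2"
proof -
  let ?n = "normal_density 0 \<sigma>"
  let ?g = "\<lambda>y. ?n y * k y"
  define I where "I x = (\<integral>y. ?g y * indicator {..x} y \<partial>lborel)" for x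
  have [measurable]: "k \<in> borel_measurable borel"
    using cont by (rule borel_measurable_continuous_onI)
  have B0: "0 \<le> B" using B[of 0] by linarith
  have int: "integrable lborel ?g"
    by (rule Bochner_Integration.integrable_bound[OF integrable_mult_right[of B, OF integrable_normal_density[OF \<sigma>, of 0]]])
       (use B B0 in \<open>auto simp: abs_mult mult.commute intro!: mult_mono\<close>)
  have intA: "integrable lborel (\<lambda>y. ?g y * indicator A y)" if "A \<in> sets borel" for A
    using that int by (intro integrable_real_mult_indicator) auto
  have cn: "continuous_on UNIV ?n"
    by (intro DERIV_continuous_on) (auto intro: DERIV_normal_density[OF \<sigma>] has_field_derivative_at_within)
  have cg: "continuous_on UNIV ?g"
    by (intro continuous_intros cont cn)
  have bound: "\<bar>\<integral>y. ?g y * indicator A y \<partial>lborel\<bar> \<le> B * (\<integral>y. ?n y * indicator A y \<partial>lborel)"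
    if "A \<in> sets borel" for A
  proof -
    have "\<bar>\<integral>y. ?g y * indicator A y \<partial>lborel\<bar> \<le> (\<integral>y. \<bar>?g y * indicator A y\<bar> \<partial>lborel)"
      by (rule integral_abs_bound)
    also have "\<dots> \<le> (\<integral>y. B * (?n y * indicator A y) \<partial>lborel)"
      using B B0 by (intro integral_mono integrable_abs intA that integrable_mult_right
          integrable_normal_density_indicator \<sigma>)
        (auto simp: abs_mult indicator_def mult.commute intro!: mult_mono)
    finally show ?thesis by simp
  qed
  \<comment> \<open>For positive \<open>x\<close> the centring of \<open>k\<close> turns the
    integral over the lower half-line into minus the one over the upper half-line, so the thin tail
    is the one estimated in either case.\<close>
  have I_le: "\<bar>I x\<bar> \<le> B * normal_tail \<sigma> \<bar>x\<bar>" for x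
  proof (cases "x \<le> 0")
    case True
    then show ?thesis
      using bound[of "{..x}"] by (simp add: I_def normal_tail_lower)
  next
    case False
    have "I x + (\<integral>y. ?g y * indicator {x<..} y \<partial>lborel) = (\<integral>y. ?g y * indicator {..x} y + ?g y * indicator {x<..} y \<partial>lborel)"
      unfolding I_def by (intro Bochner_Integration.integral_add[symmetric] intA) auto
    also have "\<dots> = (\<integral>y. ?g y \<partial>lborel)"
      by (intro Bochner_Integration.integral_cong refl) (auto simp: indicator_def)
    finally have "\<bar>I x\<bar> = \<bar>\<integral>y. ?g y * indicator {x<..} y \<partial>lborel\<bar>"
      using centered by simp
    also have "\<dots> \<le> B * (\<integral>y. ?n y * indicator {x<..} y \<partial>lborel)"
      by (rule bound) simp
    also have "\<dots> \<le> B * normal_tail \<sigma> x"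
      unfolding normal_tail_def
      by (intro mult_left_mono integral_mono integrable_normal_density_indicator \<sigma> B0) 
        (auto simp: indicator_def)
    finally show ?thesis using False by simp
  qed
  \<comment> \<open>Differentiability is local: the integral is split at \<open>x - 1\<close>, and
    the fundamental theorem applies on a compact interval.\<close>
  have I_deriv: "(I has_real_derivative ?g x) (at x)" for x
  proof -
    have *: "((\<lambda>u. I (x - 1) + integral {x - 1..u} ?g) has_real_derivative 0 + ?g x) (at x within {x - 1..x + 1})"
      by (intro DERIV_add DERIV_const integral_has_real_derivative)
         (auto intro: continuous_on_subset[OF cg])
    have eq: "I u = I (x - 1) + integral {x - 1..u} ?g" if "x - 1 < u" for u
    proof -
      have "I u = (\<integral>y. ?g y * indicator {..x - 1} y + ?g y * indicator {x - 1<..u} y \<partial>lborel)"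
        unfolding I_def using that
        by (intro Bochner_Integration.integral_cong refl) (auto simp: indicator_def)
      also have "\<dots> = I (x - 1) + (\<integral>y. ?g y * indicator {x - 1<..u} y \<partial>lborel)"
        unfolding I_def by (intro Bochner_Integration.integral_add intA) auto
      also have "(\<integral>y. ?g y * indicator {x - 1<..u} y \<partial>lborel) = (\<integral>y. ?g y * indicator {x - 1..u} y \<partial>lborel)"
        by (intro integral_cong_AE AE_I[where N = "{x - 1}"]) (auto simp: indicator_def)
      also have "\<dots> = integral {x - 1..u} ?g"
        using set_borel_integral_eq_integral(2)[of "{x - 1..u}" ?g] intA[of "{x - 1..u}"]
        by (simp add: set_integrable_def set_lebesgue_integral_def mult.commute)
      finally show ?thesis .
    qed
    have "((\<lambda>u. I (x - 1) + integral {x - 1..u} ?g) has_real_derivative ?g x) (at x)"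
      using * at_within_Icc_at[of "x - 1" x "x + 1"] by simp
    then show ?thesis
      by (rule has_field_derivative_transform_within_open[where S = "{x - 1<..}"]) (auto simp: eq)
  qed
  define f where "f x = I x / (\<sigma>\<^sup>2 * ?n x)" for x
  define f' where "f' x = (k x + x * f x) / \<sigma>\<^sup>2" for x
  have n0: "?n x > 0" for x using \<sigma> by (rule normal_density_pos)
  have deriv: "(f has_real_derivative f' x) (at x)" for x
  proof -
    have "((\<lambda>x. I x / (\<sigma>\<^sup>2 * ?n x)) has_real_derivative
        (?g x * (\<sigma>\<^sup>2 * ?n x) - I x * (\<sigma>\<^sup>2 * (- x / \<sigma>\<^sup>2 * ?n x))) / ((\<sigma>\<^sup>2 * ?n x) * (\<sigma>\<^sup>2 * ?n x))) (at x)"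
      using \<sigma> n0[of x] by (intro DERIV_divide I_deriv DERIV_cmult DERIV_normal_density) auto
    moreover have "(?g x * (\<sigma>\<^sup>2 * ?n x) - I x * (\<sigma>\<^sup>2 * (- x / \<sigma>\<^sup>2 * ?n x))) / ((\<sigma>\<^sup>2 * ?n x) * (\<sigma>\<^sup>2 * ?n x)) = f' x"
    proof -
      define N where "N = ?n x"
      have "N \<noteq> 0" unfolding N_def using n0[of x] by simp
      then show ?thesis using \<sigma> unfolding f'_def f_def N_def[symmetric]
        by (simp add: add_divide_distrib power2_eq_square mult_ac)
    qed
    ultimately show ?thesis by (simp add: f_def[abs_def])
  qed
  \<comment> \<open>The uniform tail bound controls \<open>f\<close>; the tail bound with the factor
    \<open>x\<close> controls \<open>x f\<close>, whose growth would otherwise spoil the bound of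
    \<open>f'\<close>.\<close>
  have fb: "\<bar>f x\<bar> \<le> 2 * B / \<sigma>" and xfb: "\<bar>x * f x\<bar> \<le> B" for x
  proof -
    have p: "\<sigma>\<^sup>2 * ?n x > 0" using \<sigma> n0 by simp
    have sym: "?n \<bar>x\<bar> = ?n x" by (simp add: normal_density_def)
    have "\<bar>I x\<bar> \<le> B * (2 * \<sigma> * ?n x)"
      using I_le[of x] mult_left_mono[OF normal_tail_bounds(2)[OF \<sigma>, of "\<bar>x\<bar>"] B0] by (simp add: sym)
    then show "\<bar>f x\<bar> \<le> 2 * B / \<sigma>"
      using p \<sigma> by (simp add: f_def pos_divide_le_eq abs_of_pos[OF p] power2_eq_square mult_ac)
    have "\<bar>x\<bar> * \<bar>I x\<bar> \<le> \<bar>x\<bar> * (B * normal_tail \<sigma> \<bar>x\<bar>)"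
      by (rule mult_left_mono[OF I_le]) simp
    also have "\<dots> \<le> B * (\<sigma>\<^sup>2 * ?n x)"
      using mult_left_mono[OF normal_tail_bounds(1)[OF \<sigma>, of "\<bar>x\<bar>"] B0] by (simp add: sym mult_ac)
    finally show "\<bar>x * f x\<bar> \<le> B"
      using p by (simp add: f_def abs_mult pos_divide_le_eq abs_of_pos[OF p])
  qed
  show ?thesis
  proof
    show "(f has_real_derivative f' x) (at x)" for x by (rule deriv)
    have "continuous_on UNIV f"
      using deriv by (intro DERIV_continuous_on[of UNIV f f']) (auto intro: has_field_derivative_at_within)
    then show "continuous_on UNIV f'"
      unfolding f'_def using \<sigma> by (intro continuous_intros cont) auto
    show "\<sigma>\<^sup>2 * f' x - x * f x = k x" for x using \<sigma> by (simp add: f'_def)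
    show "\<bar>f x\<bar> \<le> 2 * B / \<sigma>" for x by (rule fb)
    show "\<bar>f' x\<bar> \<le> 2 * B / \<sigma>\<^sup>2" for x
    proof -
      have "\<bar>k x + x * f x\<bar> \<le> 2 * B" using xfb[of x] B[of x] by linarith
      then show ?thesis using \<sigma> by (simp add: f'_def abs_mult divide_right_mono)
    qed
  qed
qed

section \<open>The Stein estimate\<close>

context riemannian_mfd
begin

lemma rinner_nonneg:
  assumes "x \<in> points M"
  shows "0 \<le> rinner M V V x"
proof -
  define d where "d = chart_at M x"
  have d: "d \<in> matlas M" "x \<in> fst d" using chart_at[OF assms] unfolding d_def by auto
  have eq: "rinner M V V x = (\<Sum>i<p. \<Sum>j<p. metric M d x $$ (i, j) * V d x i * V d x j)"
    unfolding rinner_def d_def[symmetric] Let_def ..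
  show ?thesis
  proof (cases "\<exists>i<p. V d x i \<noteq> 0")
    case True
    then have "0 < (\<Sum>i<p. \<Sum>j<p. metric M d x $$ (i, j) * V d x i * V d x j)"
      using metric_pos_def[OF d] unfolding pos_def_mat_def by (elim conjE allE[of _ "V d x"]) simp
    then show ?thesis unfolding eq by simp
  next
    case False
    then show ?thesis unfolding eq by (intro sum_nonneg) simp
  qed
qed

text \<open>In use, \<open>\<rho>\<close> is the posterior density, \<open>S\<close> the inner
  product of the gradients of its logarithm and of \<open>\<psi>\<close>, \<open>e\<close> the
  estimate and \<open>s\<close> the square root of the sample size. Asking only for
  \<open>R \<rho> x = \<rho> x * S x\<close> keeps logarithms out of the computation.\<close>

lemma stein_estimate:
  fixes \<phi> \<rho> \<psi> S :: "'a \<Rightarrow> real" and f f' k :: "real \<Rightarrow> real"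
  defines "R g \<equiv> grad_inner g \<psi>"
  assumes \<phi>: "C1M \<phi>" "\<And>x. x \<in> points M \<Longrightarrow> 0 \<le> \<phi> x"
    and K: "compactin T K" "\<And>x. x \<in> points M - K \<Longrightarrow> \<phi> x = 0"
    and \<rho>: "C1M \<rho>" "\<And>x. x \<in> points M \<Longrightarrow> 0 \<le> \<rho> x"
    and S: "contM S" "\<And>x. x \<in> points M \<Longrightarrow> R \<rho> x = \<rho> x * S x"
    and \<psi>: "C2M \<psi>" and s: "s > 0"
    and f: "\<And>x. (f has_real_derivative f' x) (at x)" "continuous_on UNIV f'"
    and stein: "\<And>x. \<sigma>\<^sup>2 * f' x - x * f x = k x" and Bf: "\<And>x. \<bar>f x\<bar> \<le> B" and Bf': "\<And>x. \<bar>f' x\<bar> \<le> B'"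
    and a2: "\<And>x. x \<in> points M \<Longrightarrow> \<phi> x \<noteq> 0 \<Longrightarrow> \<bar>\<psi> x - e + (laplacian M \<psi> x + S x) / s\<^sup>2\<bar> \<le> a2"
    and a3: "\<And>x. x \<in> points M \<Longrightarrow> \<phi> x \<noteq> 0 \<Longrightarrow> \<bar>\<sigma>\<^sup>2 - R \<psi> x\<bar> \<le> a3"
  shows "\<bar>\<integral>x. \<rho> x * (\<phi> x * k (s * (\<psi> x - e))) \<partial>rvolume M\<bar> \<le>
    (B' * a3 + s * B * a2) * (\<integral>x. \<rho> x * \<phi> x \<partial>rvolume M) +
    B / s * (\<integral>x. \<rho> x * \<bar>R \<phi> x\<bar> \<partial>rvolume M)"
proof -
  note \<psi>1 = C2M_imp_C1M[OF \<psi>]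
  define Z where "Z x = s * (\<psi> x - e)" for x
  define Y where "Y x = laplacian M \<psi> x + S x" for x
  define Q where "Q x = \<psi> x - e + Y x / s\<^sup>2" for x
  \<comment> \<open>\<open>X\<close> is the expansion of the Green integrand and has integral 0.
    \<open>G\<close> subtracts it after division by \<open>s\<close>, so that
    \<open>f' (Z x)\<close> is left with the coefficient
    \<open>\<sigma>\<^sup>2 - R \<psi> x\<close>.\<close>
  define X where "X x = \<rho> x * (\<phi> x * f (Z x) * Y x + f (Z x) * R \<phi> x + \<phi> x * (f' (Z x) * s * R \<psi> x))" for x
  define G where "G x = \<rho> x * (\<phi> x * k (Z x)) - X x / s" for x
  have Rc: "contM (R g)" if "C1M g" for g
    unfolding R_def by (rule rinner_continuous[OF that \<psi>1])
  have R0: "R \<phi> x = 0" if "x \<in> points M - K" for x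
    unfolding R_def by (rule rinner_vanish_off_compact[OF \<phi>(1) \<psi>1 K that])
  have Zc: "contM Z"
    unfolding Z_def by (intro continuous_map_real_mult continuous_map_diff C1M_continuous[OF \<psi>1]) auto
  have fc: "continuous_on UNIV f"
    by (rule DERIV_continuous_on) (rule has_field_derivative_at_within[OF f(1)])
  have fZ: "contM (\<lambda>x. f (Z x))" "contM (\<lambda>x. f' (Z x))"
    by (rule continuous_map_compose_real[OF Zc fc subset_UNIV], rule continuous_map_compose_real[OF Zc f(2) subset_UNIV])
  have "contM (\<lambda>x. \<sigma>\<^sup>2 * f' (Z x) - Z x * f (Z x))"
    by (intro continuous_map_diff continuous_map_real_mult fZ Zc) auto
  then have kZ: "contM (\<lambda>x. k (Z x))" by (simp only: stein)
  have Yc: "contM Y"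
    unfolding Y_def by (intro continuous_map_add laplacian_continuous[OF \<psi>] S(1))
  note \<phi>c = C1M_continuous[OF \<phi>(1)] and \<rho>c = C1M_continuous[OF \<rho>(1)]
  have Xc: "contM X"
    unfolding X_def
    by (intro continuous_map_real_mult continuous_map_add \<rho>c \<phi>c fZ Yc Rc[OF \<phi>(1)] Rc[OF \<psi>1]) auto
  have X0: "X x = 0" if "x \<in> points M - K" for x using R0[OF that] K(2)[OF that] by (simp add: X_def)
  have Xi: "integrable (rvolume M) X" by (rule integrable_compact_support[OF Xc K(1) X0])
  have Gi0: "integrable (rvolume M) (\<lambda>x. \<rho> x * (\<phi> x * k (Z x)))"
    by (rule integrable_compact_support[OF _ K(1)]) (use K(2) in \<open>auto intro!: continuous_map_real_mult \<rho>c \<phi>c kZ\<close>)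
  have Gi: "integrable (rvolume M) G"
    unfolding G_def by (intro Bochner_Integration.integrable_diff Gi0 integrable_divide_zero Xi)
  have \<phi>i: "integrable (rvolume M) (\<lambda>x. \<rho> x * \<phi> x)"
    by (rule integrable_compact_support[OF _ K(1)]) (use K(2) in \<open>auto intro!: continuous_map_real_mult \<rho>c \<phi>c\<close>)
  have R\<phi>i: "integrable (rvolume M) (\<lambda>x. \<rho> x * \<bar>R \<phi> x\<bar>)"
    by (rule integrable_compact_support[OF _ K(1)])
       (use R0 in \<open>auto intro!: continuous_map_real_mult continuous_map_real_abs \<rho>c Rc[OF \<phi>(1)]\<close>)
  text \<open>Green's formula for \<open>w = \<phi> f(Z) \<rho>\<close> against \<open>\<psi>\<close>.\<close>
  have X_int: "(\<integral>x. X x \<partial>rvolume M) = 0"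
  proof -
    define F where "F x = f (s * (\<psi> x - e))" for x
    define w where "w x = \<phi> x * F x * \<rho> x" for x
    have F': "((\<lambda>t. f (s * (t - e))) has_real_derivative f' (s * (t - e)) * s) (at t)" for t
      by (rule DERIV_chain2[OF f(1)]) (auto intro!: derivative_eq_intros)
    have F'c: "continuous_on UNIV (\<lambda>t. f' (s * (t - e)) * s)"
      by (intro continuous_intros continuous_on_compose2[OF f(2)]) auto
    have F1: "C1M F" unfolding F_def by (rule C1M_compose[OF \<psi>1 _ F' F'c]) simp
    have RF: "R F x = f' (Z x) * s * R \<psi> x" if "x \<in> points M" for x
      unfolding R_def F_def Z_def by (rule rinner_compose[OF that \<psi>1 \<psi>1 _ F' F'c]) simp
    have \<phi>F: "C1M (\<lambda>x. \<phi> x * F x)" by (rule C1M_mult[OF \<phi>(1) F1])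
    have w1: "C1M w" unfolding w_def by (rule C1M_mult[OF \<phi>F \<rho>(1)])
    have w0: "w x = 0" if "x \<in> points M - K" for x using K(2)[OF that] by (simp add: w_def)
    have Rw: "w x * laplacian M \<psi> x + R w x = X x" if x: "x \<in> points M" for x
    proof -
      have "R w x = \<rho> x * R (\<lambda>x. \<phi> x * F x) x + \<phi> x * F x * R \<rho> x"
        unfolding R_def w_def by (rule rinner_mult[OF x \<phi>F \<rho>(1) \<psi>1])
      also have "R (\<lambda>x. \<phi> x * F x) x = F x * R \<phi> x + \<phi> x * R F x"
        unfolding R_def by (rule rinner_mult[OF x \<phi>(1) F1 \<psi>1])
      finally have Rw: "R w x = \<rho> x * (F x * R \<phi> x + \<phi> x * (f' (Z x) * s * R \<psi> x)) +
          \<phi> x * F x * (\<rho> x * S x)"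
        by (simp only: RF[OF x] S(2)[OF x])
      have "F x = f (Z x)" by (simp add: F_def Z_def)
      then show ?thesis unfolding Rw by (simp add: w_def X_def Y_def algebra_simps)
    qed
    have i1: "integrable (rvolume M) (\<lambda>x. w x * laplacian M \<psi> x)"
      by (rule integrable_compact_support[OF _ K(1)])
         (use w0 in \<open>auto intro!: continuous_map_real_mult C1M_continuous[OF w1] laplacian_continuous[OF \<psi>]\<close>)
    have i2: "integrable (rvolume M) (R w)"
      by (rule integrable_compact_support[OF Rc[OF w1] K(1)])
         (unfold R_def, rule rinner_vanish_off_compact[OF w1 \<psi>1 K(1) w0])
    have "(\<integral>x. X x \<partial>rvolume M) = (\<integral>x. w x * laplacian M \<psi> x + R w x \<partial>rvolume M)"
      by (rule Bochner_Integration.integral_cong[OF refl]) (simp only: space_rvolume Rw)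
    also have "\<dots> = (\<integral>x. w x * laplacian M \<psi> x \<partial>rvolume M) + (\<integral>x. R w x \<partial>rvolume M)"
      by (rule Bochner_Integration.integral_add[OF i1 i2])
    also have "\<dots> = 0" using green[OF w1 K(1) w0 \<psi>] by (simp add: R_def)
    finally show ?thesis .
  qed
  \<comment> \<open>Stein's equation replaces \<open>k\<close>. The term \<open>Z f\<close> combines
    with the Laplacian and \<open>S\<close> into \<open>s * Q x\<close>, and \<open>Q x\<close> is
    what \<open>a2\<close> bounds.\<close>
  have G_eq: "G x = \<rho> x * (\<phi> x * (f' (Z x) * (\<sigma>\<^sup>2 - R \<psi> x)) - \<phi> x * (s * (f (Z x) * Q x)) - f (Z x) * R \<phi> x / s)"
    for x
  proof -
    have "s * Q x = Z x + Y x / s" using s by (simp add: Q_def Z_def power2_eq_square distrib_left)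
    then have "f (Z x) * (s * Q x) = f (Z x) * (Z x + Y x / s)" by (rule arg_cong)
    then have 1: "s * (f (Z x) * Q x) = Z x * f (Z x) + f (Z x) * Y x / s" by (simp add: algebra_simps)
    have 2: "X x / s = \<rho> x * (\<phi> x * (f (Z x) * Y x / s) + f (Z x) * R \<phi> x / s + \<phi> x * (f' (Z x) * R \<psi> x))"
      using s by (simp add: X_def divide_simps)
    show ?thesis unfolding G_def 1 2 stein[symmetric] by (simp add: algebra_simps)
  qed
  have G_le: "\<bar>G x\<bar> \<le> (B' * a3 + s * B * a2) * (\<rho> x * \<phi> x) + B / s * (\<rho> x * \<bar>R \<phi> x\<bar>)"
    if x: "x \<in> points M" for x
  proof -
    have t3: "\<bar>f (Z x) * R \<phi> x / s\<bar> \<le> B / s * \<bar>R \<phi> x\<bar>"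
    proof -
      have "\<bar>f (Z x)\<bar> * \<bar>R \<phi> x\<bar> \<le> B * \<bar>R \<phi> x\<bar>" using Bf by (intro mult_right_mono) auto
      then show ?thesis using s by (simp add: abs_mult divide_right_mono)
    qed
    \<comment> \<open>The bounds \<open>a2\<close> and \<open>a3\<close> are available only where
      the cutoff is nonzero; elsewhere both terms vanish.\<close>
    have t12: "\<bar>\<phi> x * (f' (Z x) * (\<sigma>\<^sup>2 - R \<psi> x))\<bar> \<le> \<phi> x * (B' * a3) \<and>
        \<bar>\<phi> x * (s * (f (Z x) * Q x))\<bar> \<le> \<phi> x * (s * B * a2)"
    proof (cases "\<phi> x = 0")
      case False
      have "\<bar>f' (Z x)\<bar> * \<bar>\<sigma>\<^sup>2 - R \<psi> x\<bar> \<le> B' * a3"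
        using Bf'[of "Z x"] a3[OF x False] by (intro mult_mono) auto
      moreover have "\<bar>f (Z x)\<bar> * \<bar>Q x\<bar> \<le> B * a2"
        using Bf[of "Z x"] a2[OF x False] unfolding Q_def Y_def by (intro mult_mono) auto
      then have "s * (\<bar>f (Z x)\<bar> * \<bar>Q x\<bar>) \<le> s * (B * a2)" using s by (intro mult_left_mono) auto
      ultimately show ?thesis using \<phi>(2)[OF x] s by (simp add: abs_mult mult_left_mono mult.assoc)
    qed simp
    have "\<bar>\<phi> x * (f' (Z x) * (\<sigma>\<^sup>2 - R \<psi> x)) - \<phi> x * (s * (f (Z x) * Q x)) - f (Z x) * R \<phi> x / s\<bar>
        \<le> \<phi> x * (B' * a3) + \<phi> x * (s * B * a2) + B / s * \<bar>R \<phi> x\<bar>"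
      using t12 t3 by linarith
    then have "\<rho> x * \<bar>\<phi> x * (f' (Z x) * (\<sigma>\<^sup>2 - R \<psi> x)) - \<phi> x * (s * (f (Z x) * Q x)) - f (Z x) * R \<phi> x / s\<bar>
        \<le> \<rho> x * (\<phi> x * (B' * a3) + \<phi> x * (s * B * a2) + B / s * \<bar>R \<phi> x\<bar>)"
      by (rule mult_left_mono[OF _ \<rho>(2)[OF x]])
    then have "\<bar>G x\<bar> \<le> \<rho> x * (\<phi> x * (B' * a3) + \<phi> x * (s * B * a2) + B / s * \<bar>R \<phi> x\<bar>)"
      unfolding G_eq abs_mult[of "\<rho> x"] abs_of_nonneg[OF \<rho>(2)[OF x]] .
    then show ?thesis by (simp add: algebra_simps)
  qed
  have "(\<integral>x. \<rho> x * (\<phi> x * k (s * (\<psi> x - e))) \<partial>rvolume M) = (\<integral>x. G x + X x / s \<partial>rvolume M)"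
    by (simp add: G_def Z_def)
  also have "\<dots> = (\<integral>x. G x \<partial>rvolume M)"
    using Bochner_Integration.integral_add[OF Gi integrable_divide_zero[of s, OF Xi]] X_int by simp
  also have "\<bar>\<dots>\<bar> \<le> (\<integral>x. \<bar>G x\<bar> \<partial>rvolume M)" by (rule integral_abs_bound)
  also have "\<dots> \<le> (\<integral>x. (B' * a3 + s * B * a2) * (\<rho> x * \<phi> x) + B / s * (\<rho> x * \<bar>R \<phi> x\<bar>) \<partial>rvolume M)"
    using G_le by (intro integral_mono integrable_abs Gi Bochner_Integration.integrable_add integrable_mult_right \<phi>i R\<phi>i) simp
  also have "\<dots> = (B' * a3 + s * B * a2) * (\<integral>x. \<rho> x * \<phi> x \<partial>rvolume M) + B / s * (\<integral>x. \<rho> x * \<bar>R \<phi> x\<bar> \<partial>rvolume M)"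
    by (subst Bochner_Integration.integral_add) (simp_all add: \<phi>i R\<phi>i integrable_mult_right)
  finally show ?thesis .
qed

end

section \<open>The posterior\<close>

lemma supp_superset: "{x \<in> points M. f x \<noteq> 0} \<subseteq> supp M f"
  unfolding supp_def by (rule closure_of_subset) blast

text \<open>The sample is fixed, so this is the deterministic half of the result: Stein's equation
  is solved for each test function, and the solution is fed to
  \<open>stein_estimate\<close>.\<close>

lemma posterior_d_BL_le:
  fixes M :: "('a, 'x) bayes_model" and est :: "(nat \<Rightarrow> 'x) \<Rightarrow> real"
  assumes mfd: "smooth_manifold M" and metr: "riemannian_metric M" and volm: "riemannian_volume M"
    and prior_pos: "\<And>x. x \<in> points M \<Longrightarrow> prior_density M x > 0"
    and prior_C1: "Ck_manifold M 1 (prior_density M)"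
    and lik: "Ck_manifold M 1 (sample_loglik M n \<omega>)" and ex: "posterior_exists M n \<omega>"
    and n: "n \<ge> 1" and \<sigma>: "\<sigma> > 0" and \<psi>: "Ck_manifold M 2 \<psi>"
    and range: "\<And>x. x \<in> points M \<Longrightarrow> \<phi> x \<in> {0..1}"
    and \<phi>: "Ck_manifold M 1 \<phi>" and supp: "compactin (mtop M) (supp M \<phi>)"
    and a0: "A0 M n \<phi> \<omega> \<noteq> 1"
  shows "d_BL (distr (posterior M n \<omega>) borel (\<lambda>x. sqrt (real n) * (\<psi> x - est \<omega>))) (normal_law \<sigma>) \<le>
    4 * (A0 M n \<phi> \<omega> + A1 M n \<phi> \<psi> \<omega> / (\<sigma> * (sqrt (real n) * (1 - A0 M n \<phi> \<omega>))) +
      sqrt (real n) * A2 M n \<phi> \<psi> est \<omega> / \<sigma> + A3 M \<phi> \<psi> \<sigma> / \<sigma>\<^sup>2)"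
proof -
  interpret riemannian_mfd M using mfd metr volm by unfold_locales
  let ?q = "prior_density M" and ?l = "sample_loglik M n \<omega>" and ?V = "rvolume M" and ?P = "posterior M n \<omega>"
  define e where "e = est \<omega>"
  define s where "s = sqrt (real n)"
  have s: "s > 0" and s2: "s\<^sup>2 = real n" using n by (simp_all add: s_def)
  have q1: "C1M ?q" and l1: "C1M ?l" and \<phi>1: "C1M \<phi>" and \<psi>2: "C2M \<psi>"
    using prior_C1 lik \<phi> \<psi> by (simp_all only: C1M_iff C2M_def)
  note \<psi>1 = C2M_imp_C1M[OF \<psi>2]
  have E1: "C1M (\<lambda>x. exp (?l x))"
    by (rule C1M_compose[OF l1, of UNIV exp exp]) (auto intro: continuous_on_exp continuous_on_id)
  note meas = continuous_map_rvolume_measurable[OF C1M_continuous]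
  have [measurable]: "?q \<in> borel_measurable ?V" "(\<lambda>x. exp (?l x)) \<in> borel_measurable ?V"
    "\<phi> \<in> borel_measurable ?V" "\<psi> \<in> borel_measurable ?V"
    by (rule meas, fact)+
  define N where "N = (\<integral>x. exp (?l x) \<partial>prior M)"
  have q0: "AE x in ?V. 0 \<le> ?q x" using prior_pos by (intro AE_I2) (simp add: less_imp_le)
  have q0': "AE x in ?V. 0 \<le> ?q x * exp (?l x)" using prior_pos by (intro AE_I2) (simp add: less_imp_le)
  have N_eq: "N = (\<integral>x. ?q x * exp (?l x) \<partial>?V)"
    unfolding N_def prior_def using q0 by (subst integral_density) simp_all
  have qi: "integrable ?V (\<lambda>x. ?q x * exp (?l x))"
    using ex q0 unfolding posterior_exists_def prior_def by (subst (asm) integrable_density) simp_all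
  \<comment> \<open>For \<open>N = 0\<close> the posterior would be the zero measure, since division
    by zero gives 0. But the integrand is strictly positive and the nonempty manifold has positive
    volume.\<close>
  have "N \<noteq> 0"
  proof
    assume "N = 0"
    then have "AE x in ?V. ?q x * exp (?l x) = 0"
      using integral_nonneg_eq_0_iff_AE[OF qi] q0' N_eq by simp
    then have "AE x in ?V. x \<notin> points M"
      by (rule eventually_mono) (use prior_pos in fastforce)
    then have "points M \<in> null_sets ?V"
      using AE_iff_null_sets[OF open_rvolume[OF openin_topspace]] by simp
    then have "emeasure ?V (points M) = 0" by (rule null_setsD1)
    moreover obtain x where "x \<in> points M" using mfd unfolding smooth_manifold_def by blast
    then have "emeasure ?V (points M) > 0" by (rule emeasure_open_pos[OF openin_topspace])
    ultimately show False by simp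
  qed
  moreover have "N \<ge> 0" unfolding N_def by (intro Bochner_Integration.integral_nonneg) simp
  ultimately have N: "N > 0" by simp
  \<comment> \<open>The posterior density with respect to the volume, written as a product so that
    the product rule applies to it.\<close>
  define \<rho> where "\<rho> x = exp (?l x) * ?q x * (1 / N)" for x
  have \<rho>1: "C1M \<rho>" unfolding \<rho>_def by (intro C1M_mult E1 q1 C1M_const)
  have \<rho>0: "0 \<le> \<rho> x" if "x \<in> points M" for x using prior_pos[OF that] N by (simp add: \<rho>_def)
  have [measurable]: "\<rho> \<in> borel_measurable ?V" by (rule meas[OF \<rho>1])
  have P_eq: "?P = density ?V (\<lambda>x. ennreal (\<rho> x))"
  proof -
    have "?P = density ?V (\<lambda>x. ennreal (?q x) * ennreal (exp (?l x) / N))"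
      unfolding posterior_def N_def[symmetric] unfolding prior_def by (rule density_density_eq) measurable
    also have "\<dots> = density ?V (\<lambda>x. ennreal (\<rho> x))"
      by (rule density_cong)
         (use prior_pos N in \<open>auto intro!: AE_I2 simp: \<rho>_def ennreal_mult'[symmetric] less_imp_le mult_ac\<close>)
    finally show ?thesis .
  qed
  have P_int: "(\<integral>x. u x \<partial>?P) = (\<integral>x. \<rho> x * u x \<partial>?V)" if "u \<in> borel_measurable ?V" for u :: "'a \<Rightarrow> real"
    unfolding P_eq using that \<rho>0 by (subst integral_density) (auto intro!: AE_I2)
  have "(\<integral>x. \<rho> x \<partial>?V) = 1"
    using N N_eq by (simp add: \<rho>_def mult.commute[of "exp _"])
  moreover have "integrable ?V \<rho>"
    unfolding \<rho>_def using integrable_mult_left[of "1 / N", OF qi] by (simp add: mult.commute[of "exp _"])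
  ultimately have "(\<integral>\<^sup>+x. ennreal (\<rho> x) \<partial>?V) = 1"
    using \<rho>0 by (subst nn_integral_eq_integral) (auto intro!: AE_I2)
  moreover have "emeasure ?P (space ?P) = (\<integral>\<^sup>+x. ennreal (\<rho> x) * indicator (space ?V) x \<partial>?V)"
    unfolding P_eq space_density by (rule emeasure_density[OF _ sets.top]) measurable
  moreover have "\<dots> = (\<integral>\<^sup>+x. ennreal (\<rho> x) \<partial>?V)" by (rule nn_integral_cong) simp
  ultimately have "emeasure ?P (space ?P) = 1" by simp
  then interpret P: prob_space ?P by (rule prob_spaceI)
  have P_space: "space ?P = points M" and P_sets [measurable_cong]: "sets ?P = sets ?V" by (simp_all add: P_eq)
  have P_bounded: "integrable ?P u" if "u \<in> borel_measurable ?V" "\<And>x. x \<in> points M \<Longrightarrow> \<bar>u x\<bar> \<le> b" for u :: "'a \<Rightarrow> real" and b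
    using that by (intro P.integrable_const_bound[of _ b] AE_I2) (simp_all add: P_space measurable_cong_sets[OF P_sets])
  define R where "R g = grad_inner g \<psi>" for g
  have Rc: "contM (R g)" if "C1M g" for g
    unfolding R_def by (rule rinner_continuous[OF that \<psi>1])
  have ln1: "C1M (\<lambda>x. ln (?q x))"
    by (rule C1M_compose[OF q1, of "{0<..}" ln inverse])
       (auto intro!: DERIV_ln continuous_on_inverse continuous_on_id prior_pos)
  \<comment> \<open>The inner product of the gradients of \<open>ln \<rho>\<close> and
    \<open>\<psi>\<close>; the constant \<open>N\<close> drops out of it.\<close>
  define S where "S x = R ?l x + R (\<lambda>x. ln (?q x)) x" for x
  have Sc: "contM S" unfolding S_def by (intro continuous_map_add Rc l1 ln1)
  have R\<rho>: "R \<rho> x = \<rho> x * S x" if x: "x \<in> points M" for x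
  proof -
    have Eq1: "C1M (\<lambda>x. exp (?l x) * ?q x)" by (rule C1M_mult[OF E1 q1])
    have "R (\<lambda>x. exp (?l x)) x = exp (?l x) * R ?l x"
      unfolding R_def by (rule rinner_compose[OF x l1 \<psi>1, of UNIV exp exp]) (auto intro: continuous_on_exp continuous_on_id)
    moreover have "R (\<lambda>x. ln (?q x)) x = inverse (?q x) * R ?q x"
      unfolding R_def by (rule rinner_compose[OF x q1 \<psi>1, of "{0<..}" ln inverse])
        (auto intro!: DERIV_ln continuous_on_inverse continuous_on_id prior_pos)
    then have "R ?q x = ?q x * R (\<lambda>x. ln (?q x)) x" using prior_pos[OF x] by simp
    moreover have "R (\<lambda>x. exp (?l x) * ?q x) x = ?q x * R (\<lambda>x. exp (?l x)) x + exp (?l x) * R ?q x"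
      unfolding R_def by (rule rinner_mult[OF x E1 q1 \<psi>1])
    moreover have "R \<rho> x = 1 / N * R (\<lambda>x. exp (?l x) * ?q x) x + exp (?l x) * ?q x * R (\<lambda>_. 1 / N) x"
      unfolding R_def \<rho>_def[abs_def] by (rule rinner_mult[OF x Eq1 C1M_const \<psi>1])
    moreover have "R (\<lambda>_. 1 / N) x = 0"
    proof -
      obtain c where c: "c \<in> matlas M" "x \<in> fst c" using chart_ex x by blast
      show ?thesis unfolding R_def by (simp add: rinner_chart[OF c C1M_const \<psi>1] coord_deriv_const[OF c(2)])
    qed
    ultimately show ?thesis by (simp add: \<rho>_def S_def algebra_simps)
  qed
  let ?K = "supp M \<phi>"
  have off_supp: "\<phi> x = 0" if "x \<in> points M - ?K" for x using supp_superset[of M \<phi>] that by blast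
  define a2 where "a2 = A2 M n \<phi> \<psi> est \<omega>"
  define a3 where "a3 = A3 M \<phi> \<psi> \<sigma>"
  define Q where "Q x = \<psi> x - e + (laplacian M \<psi> x + S x) / s\<^sup>2" for x
  have sub: "?K \<subseteq> points M" by (rule compactin_subset_topspace[OF supp])
  \<comment> \<open>A real supremum dominates its members only if they are bounded above, which
    follows from continuity on the compact support. \<open>v\<close> is the expression in the error
    term and \<open>u\<close> a form of it known to be continuous.\<close>
  have sup_bound: "\<bar>u x\<bar> \<le> (SUP x\<in>?K. \<bar>v x\<bar>)"
    if u: "contM u" and x: "x \<in> points M" "\<phi> x \<noteq> 0"
      and uv: "\<And>x. x \<in> points M \<Longrightarrow> v x = u x" for u v :: "'a \<Rightarrow> real" and x
  proof -
    obtain b where b: "\<forall>x\<in>?K. \<bar>u x\<bar> \<le> b"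
      using compactin_bounded_image[OF supp continuous_map_from_subtopology[OF u] sub] by blast
    have v: "v \<eta> = u \<eta>" if "\<eta> \<in> ?K" for \<eta> using uv sub that by blast
    have "bdd_above ((\<lambda>x. \<bar>v x\<bar>) ` ?K)"
      using b v by (intro bdd_aboveI[of _ b]) auto
    moreover have "x \<in> ?K" using supp_superset[of M \<phi>] x by blast
    ultimately have "\<bar>v x\<bar> \<le> (SUP x\<in>?K. \<bar>v x\<bar>)" by (intro cSUP_upper)
    then show ?thesis using v[OF \<open>x \<in> ?K\<close>] by simp
  qed
  have a2: "\<bar>\<psi> x - e + (laplacian M \<psi> x + S x) / s\<^sup>2\<bar> \<le> a2" if x: "x \<in> points M" "\<phi> x \<noteq> 0" for x
    unfolding Q_def[symmetric] a2_def A2_def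
  proof (rule sup_bound[OF _ x])
    show "contM Q"
      unfolding Q_def using s
      by (intro continuous_map_add continuous_map_diff continuous_map_real_divide
          laplacian_continuous[OF \<psi>2] Sc C1M_continuous[OF \<psi>1]) auto
    \<comment> \<open>The inner products of \<open>\<psi>\<close> with the log-likelihood and the
      log-prior make up \<open>S\<close>, and dividing by \<open>n\<close> is dividing by
      \<open>s\<^sup>2\<close>.\<close>
    show "psi_hat M n \<psi> \<omega> x - est \<omega> + weighted_laplacian M ?q \<psi> x / real n = Q x" if "x \<in> points M" for x
      using rinner_commute[OF that, of "gradient M \<psi>" "gradient M ?l"]
      by (simp add: psi_hat_def weighted_laplacian_def Q_def S_def R_def s2 e_def add_divide_distrib)
  qed
  have R\<psi>: "(rnorm M (gradient M \<psi>) x)\<^sup>2 = R \<psi> x" if "x \<in> points M" for x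
    using rinner_nonneg[OF that] by (simp add: rnorm_def R_def)
  have a3: "\<bar>\<sigma>\<^sup>2 - R \<psi> x\<bar> \<le> a3" if x: "x \<in> points M" "\<phi> x \<noteq> 0" for x
    unfolding a3_def A3_def
  proof (rule sup_bound[OF _ x])
    show "contM (\<lambda>x. \<sigma>\<^sup>2 - R \<psi> x)"
      by (intro continuous_map_diff Rc[OF \<psi>1]) auto
    show "\<sigma>\<^sup>2 - (rnorm M (gradient M \<psi>) x)\<^sup>2 = \<sigma>\<^sup>2 - R \<psi> x" if "x \<in> points M" for x
      by (simp only: R\<psi>[OF that])
  qed
  define m where "m = (\<integral>x. \<phi> x \<partial>?P)"
  have A0_eq: "A0 M n \<phi> \<omega> = 1 - m" by (simp add: A0_def m_def)
  define a1 where "a1 = A1 M n \<phi> \<psi> \<omega>"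
  have a1_eq: "a1 = (\<integral>x. \<rho> x * \<bar>R \<phi> x\<bar> \<partial>?V)"
    unfolding a1_def A1_def R_def[symmetric]
    by (intro P_int borel_measurable_abs continuous_map_rvolume_measurable Rc[OF \<phi>1])
  have m_eq: "m = (\<integral>x. \<rho> x * \<phi> x \<partial>?V)" unfolding m_def by (rule P_int) measurable
  have \<phi>i: "integrable ?P \<phi>" using range by (intro P_bounded[of _ 1]) auto
  have "0 \<le> m" unfolding m_def using range by (intro Bochner_Integration.integral_nonneg_AE AE_I2) (auto simp: P_space)
  then have m: "0 < m" using a0 by (simp add: A0_eq)
  have "m \<le> (\<integral>x. 1 \<partial>?P)"
    unfolding m_def using range by (intro integral_mono \<phi>i) (auto simp: P_space)
  then have m1: "m \<le> 1" by (simp add: P.prob_space)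
  define Z where "Z x = s * (\<psi> x - e)" for x
  have [measurable]: "Z \<in> borel_measurable ?V" unfolding Z_def by measurable
  have "d_BL (distr ?P borel Z) (normal_law \<sigma>) \<le>
    4 * ((1 - m) + a1 / (\<sigma> * (s * m)) + s * a2 / \<sigma> + a3 / \<sigma>\<^sup>2)" (is "_ \<le> ?bound")
    unfolding d_BL_def
  proof (rule cSUP_least)
    have "(\<lambda>_. 0 :: real) \<in> {h :: real \<Rightarrow> real. (\<forall>x. h x \<in> {- 1..1}) \<and> (\<forall>x y. \<bar>h x - h y\<bar> \<le> \<bar>x - y\<bar>)}" by simp
    then show "{h :: real \<Rightarrow> real. (\<forall>x. h x \<in> {- 1..1}) \<and> (\<forall>x y. \<bar>h x - h y\<bar> \<le> \<bar>x - y\<bar>)} \<noteq> {}"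
      by (metis empty_iff)
    fix h :: "real \<Rightarrow> real" assume "h \<in> {h. (\<forall>x. h x \<in> {- 1..1}) \<and> (\<forall>x y. \<bar>h x - h y\<bar> \<le> \<bar>x - y\<bar>)}"
    then have h: "\<forall>x. h x \<in> {- 1..1}" "\<forall>x y. \<bar>h x - h y\<bar> \<le> \<bar>x - y\<bar>" by simp_all
    have h1: "\<bar>h x\<bar> \<le> 1" for x using h(1)[THEN spec, of x] by (simp add: abs_le_iff)
    have lip: "\<bar>h x - h y\<bar> \<le> \<bar>x - y\<bar>" for x y using h(2) by blast
    have hc: "continuous_on UNIV h"
      unfolding continuous_on_iff dist_real_def
    proof (intro ballI allI impI)
      fix x \<epsilon> :: real assume "\<epsilon> > 0"
      then show "\<exists>\<delta>>0. \<forall>y\<in>UNIV. \<bar>y - x\<bar> < \<delta> \<longrightarrow> \<bar>h y - h x\<bar> < \<epsilon>"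
        by (intro exI[of _ \<epsilon>] conjI ballI impI le_less_trans[OF lip])
    qed
    then have [measurable]: "h \<in> borel_measurable borel" by (rule borel_measurable_continuous_onI)
    define c where "c = (\<integral>x. h x \<partial>normal_law \<sigma>)"
    interpret G: prob_space "normal_law \<sigma>" by (rule prob_space_normal_density[OF \<sigma>])
    have c_eq: "c = (\<integral>x. normal_density 0 \<sigma> x * h x \<partial>lborel)"
      unfolding c_def by (subst integral_density) auto
    have Gi: "integrable (normal_law \<sigma>) h"
      using h1 by (intro G.integrable_const_bound[of _ 1]) auto
    then have hi: "integrable lborel (\<lambda>x. normal_density 0 \<sigma> x * h x)"
      by (subst (asm) integrable_density) auto
    have "\<bar>c\<bar> \<le> (\<integral>x. \<bar>h x\<bar> \<partial>normal_law \<sigma>)" unfolding c_def by (rule integral_abs_bound)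
    also have "\<dots> \<le> (\<integral>x. 1 \<partial>normal_law \<sigma>)" using h1 Gi by (intro integral_mono integrable_abs) auto
    finally have c1: "\<bar>c\<bar> \<le> 1" by (simp add: G.prob_space[simplified])
    \<comment> \<open>This 2 and the 2 in the bounds of \<open>stein_solution\<close> make up the
      constant 4.\<close>
    have k2: "\<bar>h x - c\<bar> \<le> 2" for x using h1[of x] c1 by linarith
    have centered: "(\<integral>x. normal_density 0 \<sigma> x * (h x - c) \<partial>lborel) = 0"
      using \<sigma> hi c_eq by (simp add: right_diff_distrib)
    have kc: "continuous_on UNIV (\<lambda>x. h x - c)" by (intro continuous_intros hc)
    obtain f f' :: "real \<Rightarrow> real" where f: "\<And>x. (f has_real_derivative f' x) (at x)" "continuous_on UNIV f'"
      "\<And>x. \<sigma>\<^sup>2 * f' x - x * f x = h x - c" "\<And>x. \<bar>f x\<bar> \<le> 2 * 2 / \<sigma>" "\<And>x. \<bar>f' x\<bar> \<le> 2 * 2 / \<sigma>\<^sup>2"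
      by (rule stein_solution[OF \<sigma> kc k2 centered]) (rule that)
    have est: "\<bar>\<integral>x. \<rho> x * (\<phi> x * (h (Z x) - c)) \<partial>?V\<bar> \<le>
        (2 * 2 / \<sigma>\<^sup>2 * a3 + s * (2 * 2 / \<sigma>) * a2) * m + 2 * 2 / \<sigma> / s * a1"
      unfolding Z_def m_eq a1_eq R_def
      by (rule stein_estimate[where k = "\<lambda>x. h x - c" and S = S, OF \<phi>1 _ supp off_supp \<rho>1 \<rho>0 Sc _ \<psi>2 s f(1,2,3,4,5)])
         (use range R\<rho> a2 a3 in \<open>auto simp: R_def\<close>)
    define H where "H = (\<integral>x. h (Z x) \<partial>?P)"
    define H\<phi> where "H\<phi> = (\<integral>x. \<phi> x * h (Z x) \<partial>?P)"
    have iH: "integrable ?P (\<lambda>x. h (Z x))" using h1 by (intro P_bounded[of _ 1]) auto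
    have \<phi>h: "\<bar>\<phi> x * h (Z x)\<bar> \<le> \<phi> x" if "x \<in> points M" for x
      using range[OF that] h1[of "Z x"] mult_left_mono[of "\<bar>h (Z x)\<bar>" 1 "\<phi> x"] by (simp add: abs_mult)
    have iH\<phi>: "integrable ?P (\<lambda>x. \<phi> x * h (Z x))"
    proof (rule P_bounded[of _ 1])
      show "\<bar>\<phi> x * h (Z x)\<bar> \<le> 1" if "x \<in> points M" for x using \<phi>h[OF that] range[OF that] by simp
    qed measurable
    \<comment> \<open>First cutoff error: the mass that the cutoff removes.\<close>
    have d1: "\<bar>H - H\<phi>\<bar> \<le> 1 - m"
    proof -
      have "H - H\<phi> = (\<integral>x. h (Z x) - \<phi> x * h (Z x) \<partial>?P)"
        unfolding H_def H\<phi>_def by (rule Bochner_Integration.integral_diff[OF iH iH\<phi>, symmetric])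
      also have "\<bar>\<dots>\<bar> \<le> (\<integral>x. \<bar>h (Z x) - \<phi> x * h (Z x)\<bar> \<partial>?P)" by (rule integral_abs_bound)
      also have "\<dots> \<le> (\<integral>x. 1 - \<phi> x \<partial>?P)"
      proof (rule integral_mono)
        fix x assume "x \<in> space ?P"
        then have "0 \<le> 1 - \<phi> x" using range by (simp add: P_space)
        then have "(1 - \<phi> x) * \<bar>h (Z x)\<bar> \<le> (1 - \<phi> x) * 1" by (intro mult_left_mono h1)
        moreover have "h (Z x) - \<phi> x * h (Z x) = (1 - \<phi> x) * h (Z x)" by (simp add: algebra_simps)
        ultimately show "\<bar>h (Z x) - \<phi> x * h (Z x)\<bar> \<le> 1 - \<phi> x"
          using \<open>0 \<le> 1 - \<phi> x\<close> by (simp add: abs_mult)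
      qed (intro integrable_abs Bochner_Integration.integrable_diff iH iH\<phi> \<phi>i P.integrable_const)+
      also have "\<dots> = 1 - m"
        using Bochner_Integration.integral_diff[OF P.integrable_const[of 1] \<phi>i] by (simp add: m_def P.prob_space)
      finally show ?thesis .
    qed
    \<comment> \<open>Second cutoff error: dividing by \<open>m\<close> changes a quantity of
      absolute value at most \<open>m\<close>, hence by at most \<open>1 - m\<close>.\<close>
    have "\<bar>H\<phi>\<bar> \<le> (\<integral>x. \<bar>\<phi> x * h (Z x)\<bar> \<partial>?P)" unfolding H\<phi>_def by (rule integral_abs_bound)
    also have "\<dots> \<le> m" unfolding m_def by (intro integral_mono integrable_abs iH\<phi> \<phi>i) (simp only: P_space \<phi>h)
    finally have "\<bar>H\<phi>\<bar> * (1 - m) \<le> m * (1 - m)" using m1 by (intro mult_right_mono) auto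
    moreover have "\<bar>H\<phi> - H\<phi> / m\<bar> = \<bar>H\<phi>\<bar> * (1 - m) / m"
    proof -
      have "H\<phi> - H\<phi> / m = - (H\<phi> * (1 - m) / m)" using m by (simp add: field_simps)
      then show ?thesis using m m1 by (simp add: abs_mult)
    qed
    ultimately have d2: "\<bar>H\<phi> - H\<phi> / m\<bar> \<le> 1 - m" using m by (simp add: pos_divide_le_eq mult.commute)
    have "(\<integral>x. \<rho> x * (\<phi> x * (h (Z x) - c)) \<partial>?V) = (\<integral>x. \<phi> x * (h (Z x) - c) \<partial>?P)"
      by (rule P_int[symmetric]) measurable
    also have "\<dots> = (\<integral>x. \<phi> x * h (Z x) - \<phi> x * c \<partial>?P)" by (simp add: right_diff_distrib)
    also have "\<dots> = H\<phi> - m * c"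
      unfolding H\<phi>_def m_def by (subst Bochner_Integration.integral_diff) (simp_all add: iH\<phi> \<phi>i)
    finally have "\<bar>H\<phi> - m * c\<bar> \<le> (2 * 2 / \<sigma>\<^sup>2 * a3 + s * (2 * 2 / \<sigma>) * a2) * m + 2 * 2 / \<sigma> / s * a1"
      using est by simp
    then have "\<bar>H\<phi> - m * c\<bar> / m \<le> ((2 * 2 / \<sigma>\<^sup>2 * a3 + s * (2 * 2 / \<sigma>) * a2) * m + 2 * 2 / \<sigma> / s * a1) / m"
      using m by (intro divide_right_mono) auto
    also have "\<dots> = 4 * a3 / \<sigma>\<^sup>2 + 4 * (s * a2 / \<sigma>) + 4 * (a1 / (\<sigma> * (s * m)))"
      using m s \<sigma> by (simp add: add_divide_distrib mult_ac)
    also have "\<bar>H\<phi> - m * c\<bar> / m = \<bar>H\<phi> / m - c\<bar>"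
    proof -
      have "H\<phi> / m - c = (H\<phi> - m * c) / m" using m by (simp add: diff_divide_distrib)
      then show ?thesis using m by simp
    qed
    finally have d3: "\<bar>H\<phi> / m - c\<bar> \<le> 4 * a3 / \<sigma>\<^sup>2 + 4 * (s * a2 / \<sigma>) + 4 * (a1 / (\<sigma> * (s * m)))" .
    have "(\<integral>x. h x \<partial>distr ?P borel Z) = H"
      unfolding H_def by (rule integral_distr) (simp_all add: measurable_cong_sets[OF P_sets])
    \<comment> \<open>The cutoff errors add up to \<open>2 * (1 - m)\<close>, which the factor 4
      absorbs.\<close>
    moreover have "\<bar>H - c\<bar> \<le> ?bound" using d1 d2 d3 m1 by (simp add: abs_le_iff)
    ultimately show "\<bar>(\<integral>x. h x \<partial>distr ?P borel Z) - (\<integral>x. h x \<partial>normal_law \<sigma>)\<bar> \<le> ?bound"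
      by (simp add: c_def)
  qed
  moreover have "Z = (\<lambda>x. sqrt (real n) * (\<psi> x - est \<omega>))" by (simp add: fun_eq_iff Z_def s_def e_def)
  ultimately show ?thesis
    unfolding A0_eq a1_def[symmetric] a2_def[symmetric] a3_def[symmetric] s_def[symmetric] by simp
qed

section \<open>Stochastic order\<close>

text \<open>The events in \<open>little_op\<close> may fail to be measurable; measurable supersets
  of the same outer measure reduce the claim to \<open>emeasure\<close>.\<close>

lemma outer_measure_of_Un_le:
  assumes "A \<subseteq> space M" "B \<subseteq> space M"
  shows "outer_measure_of M (A \<union> B) \<le> outer_measure_of M A + outer_measure_of M B"
proof -
  obtain E where E: "E \<in> sets M" "A \<subseteq> E" "outer_measure_of M A = emeasure M E"
    using outer_measure_of_attain[OF assms(1)] by blast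
  obtain F where F: "F \<in> sets M" "B \<subseteq> F" "outer_measure_of M B = emeasure M F"
    using outer_measure_of_attain[OF assms(2)] by blast
  have "outer_measure_of M (A \<union> B) \<le> outer_measure_of M (E \<union> F)"
    using E F by (intro outer_measure_of_mono) blast
  also have "\<dots> = emeasure M (E \<union> F)" using E F by simp
  also have "\<dots> \<le> emeasure M E + emeasure M F" using E F by (intro emeasure_subadditive)
  finally show ?thesis using E F by simp
qed

text \<open>\<open>\<delta> \<le> 1 / 2\<close> keeps \<open>1 - a0\<close> at least one half, which
  doubles the \<open>a1\<close> term; together with the \<open>a2\<close> term this makes
  \<open>3 / \<sigma>\<close>.\<close>

lemma bound_le:
  fixes a0 a1 a2 a3 s \<sigma> \<delta> :: real
  assumes \<delta>: "0 < \<delta>" "\<delta> \<le> 1 / 2" and \<sigma>: "\<sigma> > 0" and s: "s > 0"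
    and a: "\<bar>a0\<bar> \<le> \<delta>" "\<bar>a1\<bar> \<le> \<delta> * s" "\<bar>a2\<bar> \<le> \<delta> / s" "\<bar>a3\<bar> \<le> \<delta>"
  shows "\<bar>4 * (a0 + a1 / (\<sigma> * (s * (1 - a0))) + s * a2 / \<sigma> + a3 / \<sigma>\<^sup>2)\<bar> \<le> \<delta> * (4 * (1 + 3 / \<sigma> + 1 / \<sigma>\<^sup>2))"
proof -
  have a0: "1 - a0 \<ge> 1 / 2" using a(1) \<delta>(2) by (auto simp: abs_le_iff)
  have "\<bar>a1 / (\<sigma> * (s * (1 - a0)))\<bar> = \<bar>a1\<bar> / (\<sigma> * (s * (1 - a0)))"
    using \<sigma> s a0 by (simp add: abs_mult)
  also have "\<dots> \<le> (\<delta> * s) / (\<sigma> * (s * (1 / 2)))"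
    using \<sigma> s a0 a(2) \<delta> by (intro frac_le mult_left_mono) auto
  also have "\<dots> = 2 * \<delta> / \<sigma>" using s by simp
  finally have t1: "\<bar>a1 / (\<sigma> * (s * (1 - a0)))\<bar> \<le> 2 * \<delta> / \<sigma>" .
  have "s * \<bar>a2\<bar> \<le> \<delta>" using a(3) s by (simp add: pos_le_divide_eq mult.commute)
  then have t2: "\<bar>s * a2 / \<sigma>\<bar> \<le> \<delta> / \<sigma>" using s \<sigma> by (simp add: abs_mult divide_right_mono)
  have t3: "\<bar>a3 / \<sigma>\<^sup>2\<bar> \<le> \<delta> / \<sigma>\<^sup>2" using a(4) by (simp add: divide_right_mono)
  have "\<bar>4 * (a0 + a1 / (\<sigma> * (s * (1 - a0))) + s * a2 / \<sigma> + a3 / \<sigma>\<^sup>2)\<bar>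
      \<le> 4 * (\<delta> + 2 * \<delta> / \<sigma> + \<delta> / \<sigma> + \<delta> / \<sigma>\<^sup>2)"
  proof -
    have "\<bar>4 * (x0 + x1 + x2 + x3)\<bar> \<le> 4 * (d0 + d1 + d2 + d3)"
      if "\<bar>x0\<bar> \<le> d0" "\<bar>x1\<bar> \<le> d1" "\<bar>x2\<bar> \<le> d2" "\<bar>x3\<bar> \<le> d3" for x0 x1 x2 x3 d0 d1 d2 d3 :: real
      using that by (auto simp: abs_le_iff)
    from this[OF a(1) t1 t2 t3] show ?thesis .
  qed
  also have "\<dots> = \<delta> * (4 * (1 + 3 / \<sigma> + 1 / \<sigma>\<^sup>2))" by (simp add: algebra_simps)
  finally show ?thesis .
qed

text \<open>A union bound: where the combined bound exceeds \<open>\<epsilon>\<close>, one of the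
  four error terms exceeds \<open>\<delta>\<close> times its rate.\<close>

lemma little_op_bound:
  fixes a0 a1 a2 a3 :: "nat \<Rightarrow> 'w \<Rightarrow> real"
  assumes \<sigma>: "\<sigma> > 0"
    and A0: "little_op Q (\<lambda>n \<omega>. ereal (a0 n \<omega>)) (\<lambda>n. 1)"
    and A1: "little_op Q (\<lambda>n \<omega>. ereal (a1 n \<omega>)) (\<lambda>n. sqrt (real n))"
    and A2: "little_op Q (\<lambda>n \<omega>. ereal (a2 n \<omega>)) (\<lambda>n. 1 / sqrt (real n))"
    and A3: "little_op Q (\<lambda>n \<omega>. ereal (a3 n \<omega>)) (\<lambda>n. 1)"
  shows "little_op Q (\<lambda>n \<omega>. if a0 n \<omega> = 1 then \<infinity> else ereal (4 * (a0 n \<omega> +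
    a1 n \<omega> / (\<sigma> * (sqrt (real n) * (1 - a0 n \<omega>))) + sqrt (real n) * a2 n \<omega> / \<sigma> + a3 n \<omega> / \<sigma>\<^sup>2))) (\<lambda>n. 1)"
    (is "little_op Q ?b _")
  unfolding little_op_def
proof (intro allI impI)
  fix \<epsilon> :: real assume \<epsilon>: "\<epsilon> > 0"
  define C where "C = 4 * (1 + 3 / \<sigma> + 1 / \<sigma>\<^sup>2)"
  have C: "C > 0" unfolding C_def using \<sigma> by (intro mult_pos_pos add_pos_pos) auto
  \<comment> \<open>The cap \<open>1 / 2\<close> also excludes \<open>a0 n \<omega> = 1\<close>, the
    infinite branch of the bound; \<open>\<epsilon> / C\<close> brings the finite branch below
    \<open>\<epsilon>\<close>.\<close>
  define \<delta> where "\<delta> = min (1 / 2) (\<epsilon> / C)"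
  have \<delta>: "0 < \<delta>" "\<delta> \<le> 1 / 2" "\<delta> * C \<le> \<epsilon>"
    using \<epsilon> C by (auto simp: \<delta>_def min_def field_simps)
  define E where "E X a n = {\<omega> \<in> space (Q n). ereal (\<delta> * a n) < \<bar>ereal (X n \<omega>)\<bar>}" for X :: "nat \<Rightarrow> 'w \<Rightarrow> real" and a :: "nat \<Rightarrow> real" and n
  have lim: "(\<lambda>n. outer_measure_of (Q n) (E X a n)) \<longlonglongrightarrow> 0"
    if "little_op Q (\<lambda>n \<omega>. ereal (X n \<omega>)) a" for X a
    using that \<delta>(1) unfolding little_op_def E_def by blast
  let ?E0 = "E a0 (\<lambda>n. 1)" and ?E1 = "E a1 (\<lambda>n. sqrt (real n))"
    and ?E2 = "E a2 (\<lambda>n. 1 / sqrt (real n))" and ?E3 = "E a3 (\<lambda>n. 1)"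
  let ?o = "\<lambda>n. outer_measure_of (Q n)"
  have "(\<lambda>n. ?o n (?E0 n) + ?o n (?E1 n) + ?o n (?E2 n) + ?o n (?E3 n)) \<longlonglongrightarrow> 0 + 0 + 0 + 0"
    by (intro tendsto_add lim A0 A1 A2 A3)
  then have upper: "(\<lambda>n. ?o n (?E0 n) + ?o n (?E1 n) + ?o n (?E2 n) + ?o n (?E3 n)) \<longlonglongrightarrow> 0" by simp
  \<comment> \<open>For \<open>n \<ge> 1\<close> the rates are positive; this covers all but one
    index, which suffices for the limit.\<close>
  have sub: "?o n {\<omega> \<in> space (Q n). ereal (\<epsilon> * 1) < \<bar>?b n \<omega>\<bar>}
      \<le> ?o n (?E0 n) + ?o n (?E1 n) + ?o n (?E2 n) + ?o n (?E3 n)" if n: "n \<ge> 1" for n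
  proof -
    have s: "sqrt (real n) > 0" using n by simp
    have "{\<omega> \<in> space (Q n). ereal (\<epsilon> * 1) < \<bar>?b n \<omega>\<bar>} \<subseteq> ?E0 n \<union> ?E1 n \<union> ?E2 n \<union> ?E3 n"
    proof (rule subsetI, rule ccontr)
      fix \<omega> assume \<omega>: "\<omega> \<in> {\<omega> \<in> space (Q n). ereal (\<epsilon> * 1) < \<bar>?b n \<omega>\<bar>}"
        and "\<omega> \<notin> ?E0 n \<union> ?E1 n \<union> ?E2 n \<union> ?E3 n"
      then have a: "\<bar>a0 n \<omega>\<bar> \<le> \<delta>" "\<bar>a1 n \<omega>\<bar> \<le> \<delta> * sqrt (real n)"
        "\<bar>a2 n \<omega>\<bar> \<le> \<delta> / sqrt (real n)" "\<bar>a3 n \<omega>\<bar> \<le> \<delta>"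
        by (auto simp: E_def)
      have "a0 n \<omega> \<noteq> 1" using a(1) \<delta>(2) by auto
      then have "\<bar>?b n \<omega>\<bar> \<le> ereal (\<delta> * C)"
        using bound_le[OF \<delta>(1,2) \<sigma> s a] unfolding C_def by simp
      also have "\<dots> \<le> ereal \<epsilon>" using \<delta>(3) by simp
      finally have "\<not> ereal \<epsilon> < \<bar>?b n \<omega>\<bar>" by (rule leD)
      moreover have "\<omega> \<in> space (Q n) \<and> ereal (\<epsilon> * 1) < \<bar>?b n \<omega>\<bar>" using \<omega> by (rule CollectD)
      ultimately show False by (simp only: mult_1_right simp_thms)
    qed
    then have "?o n {\<omega> \<in> space (Q n). ereal (\<epsilon> * 1) < \<bar>?b n \<omega>\<bar>} \<le> ?o n (?E0 n \<union> ?E1 n \<union> ?E2 n \<union> ?E3 n)"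
      by (rule outer_measure_of_mono)
    also have "\<dots> \<le> ?o n (?E0 n) + ?o n (?E1 n) + ?o n (?E2 n) + ?o n (?E3 n)"
      by (rule order_trans[OF outer_measure_of_Un_le add_right_mono[OF order_trans[OF outer_measure_of_Un_le
              add_right_mono[OF outer_measure_of_Un_le]]]]) (auto simp: E_def)
    finally show ?thesis .
  qed
  show "(\<lambda>n. ?o n {\<omega> \<in> space (Q n). ereal (\<epsilon> * 1) < \<bar>?b n \<omega>\<bar>}) \<longlonglongrightarrow> 0"
    by (rule tendsto_sandwich[OF always_eventually[OF allI[OF zero_le]] eventually_sequentiallyI[OF sub]
          tendsto_const upper])
qed

text \<open>Probability enters only in the second half: the inequality holds for every single sample
  that has a posterior, and the four stochastic orders are then combined.\<close>

theorem corollary1: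
  fixes M :: "nat \<Rightarrow> ('a, 'x) bayes_model"
    and P0 :: "nat \<Rightarrow> 'x measure"
    and \<psi> :: "nat \<Rightarrow> 'a \<Rightarrow> real"
    and est :: "nat \<Rightarrow> (nat \<Rightarrow> 'x) \<Rightarrow> real"
    and cutoff :: "nat \<Rightarrow> 'a \<Rightarrow> real"
    and \<sigma> :: real
  assumes manifold: "\<And>n. n \<ge> 1 \<Longrightarrow> smooth_manifold (M n)"
    and model: "\<And>n. n \<ge> 1 \<Longrightarrow> dominated_model (M n)"
    and fisher: "\<And>n. n \<ge> 1 \<Longrightarrow> fisher_metric (M n)"
    and metric: "\<And>n. n \<ge> 1 \<Longrightarrow> riemannian_metric (M n)"
    and volume: "\<And>n. n \<ge> 1 \<Longrightarrow> riemannian_volume (M n)"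
    and prior_pos: "\<And>n \<theta>. n \<ge> 1 \<Longrightarrow> \<theta> \<in> points (M n) \<Longrightarrow> prior_density (M n) \<theta> > 0"
    and prior_C1: "\<And>n. n \<ge> 1 \<Longrightarrow> Ck_manifold (M n) 1 (prior_density (M n))"
    and P0_prob: "\<And>n. n \<ge> 1 \<Longrightarrow> prob_space (P0 n)"
    and P0_sets: "\<And>n. n \<ge> 1 \<Longrightarrow> sets (P0 n) = sets (dominating (M n))"
    and posterior_exists:
      "\<And>n. n \<ge> 1 \<Longrightarrow> AE \<omega> in sample_law (P0 n) n. posterior_exists (M n) n \<omega>"
    and sigma_pos: "\<sigma> > 0"
    and psi_C2: "\<And>n. n \<ge> 1 \<Longrightarrow> Ck_manifold (M n) 2 (\<psi> n)"
    and estimator: "\<And>n. n \<ge> 1 \<Longrightarrow> est n \<in> borel_measurable (sample_law (P0 n) n)"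
    and cutoff_range: "\<And>n \<theta>. n \<ge> 1 \<Longrightarrow> \<theta> \<in> points (M n) \<Longrightarrow> cutoff n \<theta> \<in> {0..1}"
    and cutoff_C1: "\<And>n. n \<ge> 1 \<Longrightarrow> Ck_manifold (M n) 1 (cutoff n)"
    and cutoff_supp: "\<And>n. n \<ge> 1 \<Longrightarrow> compactin (mtop (M n)) (supp (M n) (cutoff n))"
    and A0: "little_op (\<lambda>n. sample_law (P0 n) n)
               (\<lambda>n \<omega>. ereal (A0 (M n) n (cutoff n) \<omega>)) (\<lambda>n. 1)"
    and A1: "little_op (\<lambda>n. sample_law (P0 n) n)
               (\<lambda>n \<omega>. ereal (A1 (M n) n (cutoff n) (\<psi> n) \<omega>)) (\<lambda>n. sqrt (real n))"
    and A2: "little_op (\<lambda>n. sample_law (P0 n) n)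
               (\<lambda>n \<omega>. ereal (A2 (M n) n (cutoff n) (\<psi> n) (est n) \<omega>)) (\<lambda>n. 1 / sqrt (real n))"
    and A3: "little_op (\<lambda>n. sample_law (P0 n) n)
               (\<lambda>n \<omega>. ereal (A3 (M n) (cutoff n) (\<psi> n) \<sigma>)) (\<lambda>n. 1)"
  shows
    "let Z = (\<lambda>n \<omega> \<theta>. sqrt (real n) * (\<psi> n \<theta> - est n \<omega>));
         bound = (\<lambda>n \<omega>.
           let a0 = A0 (M n) n (cutoff n) \<omega>;
               a1 = A1 (M n) n (cutoff n) (\<psi> n) \<omega>;
               a2 = A2 (M n) n (cutoff n) (\<psi> n) (est n) \<omega>;
               a3 = A3 (M n) (cutoff n) (\<psi> n) \<sigma>
           in if a0 = 1 then \<infinity>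
              else ereal (4 * (a0 + a1 / (\<sigma> * (sqrt (real n) * (1 - a0)))
                                  + sqrt (real n) * a2 / \<sigma> + a3 / \<sigma>\<^sup>2)))
     in (\<forall>n\<ge>1. \<forall>\<omega>\<in>space (sample_law (P0 n) n). posterior_exists (M n) n \<omega> \<longrightarrow>
           ereal (d_BL (distr (posterior (M n) n \<omega>) borel (Z n \<omega>)) (normal_law \<sigma>)) \<le> bound n \<omega>) \<and>
        little_op (\<lambda>n. sample_law (P0 n) n) bound (\<lambda>n. 1)"
proof -
  let ?bound = "\<lambda>n \<omega>. if A0 (M n) n (cutoff n) \<omega> = 1 then \<infinity> else ereal (4 * (A0 (M n) n (cutoff n) \<omega> +
    A1 (M n) n (cutoff n) (\<psi> n) \<omega> / (\<sigma> * (sqrt (real n) * (1 - A0 (M n) n (cutoff n) \<omega>))) +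
    sqrt (real n) * A2 (M n) n (cutoff n) (\<psi> n) (est n) \<omega> / \<sigma> + A3 (M n) (cutoff n) (\<psi> n) \<sigma> / \<sigma>\<^sup>2))"
  have bound: "ereal (d_BL (distr (posterior (M n) n \<omega>) borel (\<lambda>\<theta>. sqrt (real n) * (\<psi> n \<theta> - est n \<omega>))) (normal_law \<sigma>))
      \<le> ?bound n \<omega>"
    if n: "n \<ge> 1" and \<omega>: "\<omega> \<in> space (sample_law (P0 n) n)" and ex: "posterior_exists (M n) n \<omega>" for n \<omega>
  proof (cases "A0 (M n) n (cutoff n) \<omega> = 1")
    case False
    interpret riemannian_mfd "M n" using manifold[OF n] metric[OF n] volume[OF n] by unfold_locales
    \<comment> \<open>The log-likelihood is assumed C^1 at data points in the space of the
      dominating measure. The sample lies there because \<open>P0\<close> has the same measurable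
      sets, and a finite sum preserves C^1.\<close>
    have "\<omega> i \<in> space (dominating (M n))" if "i < n" for i
      using \<omega> that sets_eq_imp_space_eq[OF P0_sets[OF n]] by (auto simp: sample_law_def space_PiM)
    then have "C1M (\<lambda>\<theta>. loglik (M n) \<theta> (\<omega> i))" if "i < n" for i
      using model[OF n] that unfolding dominated_model_def C1M_iff by blast
    then have "C1M (sample_loglik (M n) n \<omega>)"
      unfolding sample_loglik_def[abs_def] by (intro C1M_sum) auto
    then have "Ck_manifold (M n) 1 (sample_loglik (M n) n \<omega>)" unfolding C1M_iff .
    from posterior_d_BL_le[OF manifold[OF n] metric[OF n] volume[OF n] prior_pos[OF n] prior_C1[OF n] this ex n
        sigma_pos psi_C2[OF n] cutoff_range[OF n] cutoff_C1[OF n] cutoff_supp[OF n] False]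
    show ?thesis using False by simp
  qed simp
  have "little_op (\<lambda>n. sample_law (P0 n) n) ?bound (\<lambda>n. 1)"
    by (rule little_op_bound[OF sigma_pos A0 A1 A2 A3])
  then show ?thesis unfolding Let_def by (intro conjI allI ballI impI bound)
qed

end
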